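(* The $\mathcal I^{\mathrm{mb}}$-interpretation (majorizability upon the bounding interpretation) is a sound type-informative base interpretation of $\mathrm{HA}^\omega$.
   Context: $\mathrm{HA}^\omega$: intuitionistic theory with finite types generated by $\sigma\to\tau$ from ground types $\mathbb N$, $\mathbb B$; constants: combinators $\Pi,\Sigma$, zero $0^{\mathbb N}$, successor $\mathsf S^{\mathbb N\to\mathbb N}$, recursors $\mathsf R_\sigma:\mathbb N\to\sigma\to(\mathbb N\to\sigma\to\sigma)\to\sigma$ (simultaneous recursion allowed), Booleans $0^{\mathbb B},1^{\mathbb B}$, conditionals $\mathrm{Cond}_\sigma:\mathbb B\to\sigma\to\sigma\to\sigma$; relation symbols: only logical equality $\equiv_\sigma$ at every type. Formulas use $\bot,\wedge,\to,\forall x^\sigma,\exists x^\sigma$; $A\vee B$ abbreviates $\exists i^{\mathbb B}((i\equiv0\to A)\wedge(i\equiv1\to B))$. Axioms: equality and combinator axioms ($\Pi xy\equiv x$, $\Sigma xyz\equiv xz(yz)$); $\mathsf S$ injective, $0\notin\mathrm{range}(\mathsf S)$; $\mathsf R0wf\equiv w$, $\mathsf R(\mathsf Sn)wf\equiv fn(\mathsf Rnwf)$; $\neg(0\equiv_{\mathbb B}1)$; $D(0)\wedge D(1)\to\forall i^{\mathbb B}D(i)$ for all formulas $D$; $\mathrm{Cond}(0,x,y)\equiv x$, $\mathrm{Cond}(1,x,y)\equiv y$; induction for all formulas. Target language: the language of $\mathrm{HA}^\omega$ with the extra type constructor $\sigma\mapsto\sigma^*$ (non-empty finite subsets) and constants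 for singleton, union, indexed union $\bigcup_{w\in t}qw$, membership, combinators and recursors for all these types, and $\mathrm m:\mathbb N^*\to\mathbb N$ (maximum). $\mathcal S^\omega_*$ is the structure with $\mathcal S_{\mathbb N}=\mathbb N$, $\mathcal S_{\mathbb B}=\{0,1\}$, $\mathcal S_{\rho\to\sigma}$ all functions from $\mathcal S_\rho$ to $\mathcal S_\sigma$, $\mathcal S_{\sigma^*}$ all non-empty finite subsets of $\mathcal S_\sigma$. The target theory $T$ is the set of sentences true in $\mathcal S^\omega_*$. Strong majorizability on arithmetical star types (generated from $\mathbb N$ by $\to$ and $*$): $x\le^B_{\mathbb N}y$ iff $x\le y$; $f\le^B_{\sigma\to\tau}g$ iff $\forall x,y(x\le^B_\sigma y\to fx\le^B_\tau gy\wedge gx\le^B_\tau gy)$; $a\le^B_{\sigma^*}b$ iff $\forall u\in a\,\exists v\in b\,(u\le^B_\sigma v)\wedge\forall v\in b\,(v\le^B_\sigma v)$. An element $a$ is monotone if $a\le^B a$. For finite types over $\mathbb N,\mathbb B$: $\mathbb N^\dagger=\mathbb N$, $\mathbb B^\dagger$ is empty, $(\sigma\to\tau)^\dagger=\sigma^\dagger\to\tau^\dagger$, understood as $\tau^\dagger$ if $\sigma^\dagger$ is empty and as empty if $\tau^\dagger$ is empty. $\sigma$ is bounded if $\sigma^\dagger$ is empty, otherwise unbounded. For unbounded $\rho$, $x\le^B_\rho a$ ($x:\rho$, $a:\rho^\dagger$) is: $x\le a$ if $\rho=\mathbb N$; for $\sigma,\tau$ unbounded, $f\le^B_{\sigma\to\tau}g$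 is $\forall x^\sigma,a^{\sigma^\dagger}(x\le^B_\sigma a\to fx\le^B_\tau ga)\wedge\forall z^{\sigma^\dagger},a^{\sigma^\dagger}(z\le^B_{\sigma^\dagger}a\to gz\le^B_{\tau^\dagger}ga)$; for $\sigma$ bounded, $\tau$ unbounded, $f\le^B_{\sigma\to\tau}c$ is $\forall x^\sigma(fx\le^B_\tau c)\wedge c\le^B_{\tau^\dagger}c$. $\mathcal L^{\mathcal I}$ adds to the language of $\mathrm{HA}^\omega$ a unary predicate $\mathcal I_\sigma(x^\sigma)$ for each type. $\mathcal I^{\mathrm{mb}}$: if $\sigma$ is unbounded, $\mathcal I_\sigma(x)$ has one positive witness $a$ of type $\sigma^\dagger$, no negative ones, and $\langle\mathcal I_\sigma(x)\rangle^a$ is $x\le^B_\sigma a$; if $\sigma$ is bounded, $\mathcal I_\sigma(x)$ has no witnesses and $\langle\mathcal I_\sigma(x)\rangle$ is true. The witnessing types are the arithmetical star types and their elements are, by definition, the monotone elements; thus all quantifiers over witnesses and counter-witnesses range over monotone elements, and witnessing terms must be monotone. $\mathcal U$-interpretation (boldface letters are possibly empty tuples; $\forall\boldsymbol b\in\boldsymbol B$ is componentwise): $\langle x\equiv_\sigma y\rangle$ is $x=y$; $\langle\bot\rangle:\equiv\bot$; $\langle A\wedge B\rangle^{\boldsymbol a,\boldsymbol c}_{\boldsymbol b,\boldsymbol d}:\equiv\langle A\rangle^{\boldsymbol a}_{\boldsymbol b}\wedge\langle B\rangle^{\boldsymbol c}_{\boldsymbol d}$; $\langle A\to B\rangle^{\boldsymbol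 f,\boldsymbol g}_{\boldsymbol a,\boldsymbol d}:\equiv\forall\boldsymbol b\in\boldsymbol g\boldsymbol a\boldsymbol d\,\langle A\rangle^{\boldsymbol a}_{\boldsymbol b}\to\langle B\rangle^{\boldsymbol f\boldsymbol a}_{\boldsymbol d}$; $\langle\forall xA\rangle^{\boldsymbol a}_{\boldsymbol b}:\equiv\forall x\langle A\rangle^{\boldsymbol a}_{\boldsymbol b}$; $\langle\exists xA\rangle^{\boldsymbol a}_{\boldsymbol B}:\equiv\exists x\forall\boldsymbol b\in\boldsymbol B\langle A\rangle^{\boldsymbol a}_{\boldsymbol b}$. $A(\boldsymbol x)$ is $\mathcal U$-interpretable if there are closed (monotone) witnessing terms $\boldsymbol t$ such that $T$ proves $\langle A(\boldsymbol x)\rangle^{\boldsymbol t}_{\boldsymbol b}$ for all (monotone) $\boldsymbol b$ and all $\boldsymbol x$. $A^{\mathcal I}$ replaces $\forall x^\sigma(\dots)$ by $\forall x^\sigma(\mathcal I_\sigma(x)\to\dots)$ and $\exists x^\sigma(\dots)$ by $\exists x^\sigma(\mathcal I_\sigma(x)\wedge\dots)$. $A(\boldsymbol x)$ is $\mathcal I$-interpretable if $\forall\boldsymbol x(\mathcal I(\boldsymbol x)\to A^{\mathcal I}(\boldsymbol x))$ is $\mathcal U$-interpretable. A base interpretation is a sound type-informative base interpretation of $\mathrm{HA}^\omega$ if all $\mathcal I_\sigma(c)$ ($c^\sigma$ a constant of $\mathrm{HA}^\omega$) and all $\forall x^\sigma\forall f^{\sigma\to\tau}(\mathcal I_\sigma(x)\wedge\mathcal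 I_{\sigma\to\tau}(f)\to\mathcal I_\tau(fx))$ are $\mathcal U$-interpretable, and all non-logical axioms of $\mathrm{HA}^\omega$ are $\mathcal I$-interpretable. *)

theory Defs
  imports Main "HOL-Library.FuncSet"
begin

section \<open>Types, terms and formulas\<close>

text \<open>
  One syntax serves both for \<open>HA\<^sup>\<omega>\<close> and for the target language: \<open>HA\<^sup>\<omega>\<close> is the part without
  \<open>Star\<close> (and, for formulas, without \<open>Ipred\<close>).
\<close>

datatype ty = N | B | Fun ty ty  (infixr \<open>\<rightarrow>\<close> 65) | Star ty

fun finite_type :: "ty \<Rightarrow> bool" where
  "finite_type N \<longleftrightarrow> True"
| "finite_type B \<longleftrightarrow> True"
| "finite_type (\<sigma> \<rightarrow> \<tau>) \<longleftrightarrow> finite_type \<sigma> \<and> finite_type \<tau>"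
| "finite_type (Star \<sigma>) \<longleftrightarrow> False"

fun arith_star_type :: "ty \<Rightarrow> bool" where
  "arith_star_type N \<longleftrightarrow> True"
| "arith_star_type B \<longleftrightarrow> False"
| "arith_star_type (\<sigma> \<rightarrow> \<tau>) \<longleftrightarrow> arith_star_type \<sigma> \<and> arith_star_type \<tau>"
| "arith_star_type (Star \<sigma>) \<longleftrightarrow> arith_star_type \<sigma>"

definition arrs :: "ty list \<Rightarrow> ty \<Rightarrow> ty" where
  "arrs \<sigma>s \<tau> = foldr (\<rightarrow>) \<sigma>s \<tau>"

text \<open>
  \<open>Rec \<sigma>s i\<close> is the \<open>i\<close>-th component of the simultaneous recursor for the tuple of types \<open>\<sigma>s\<close>;
  the ordinary recursor \<open>R\<^sub>\<sigma>\<close> is \<open>Rec [\<sigma>] 0\<close>. \<open>CIUnion\<close> stands for \<open>\<Union>w\<in>t. q w\<close>, with arguments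
  in the order \<open>t\<close>, \<open>q\<close>; \<open>Maxi\<close> is the constant \<open>m\<close>.
\<close>

datatype const =
    CPi ty ty | CSigma ty ty ty | Zero | Succ | Rec "ty list" nat | Bool0 | Bool1 | Cond ty
  | Single ty | CUnion ty | CIUnion ty ty | Mem ty | Maxi

definition step_type :: "ty list \<Rightarrow> ty \<Rightarrow> ty" where
  "step_type \<sigma>s \<tau> = N \<rightarrow> arrs \<sigma>s \<tau>"

fun const_type :: "const \<Rightarrow> ty" where
  "const_type (CPi \<sigma> \<tau>) = \<sigma> \<rightarrow> \<tau> \<rightarrow> \<sigma>"
| "const_type (CSigma \<rho> \<sigma> \<tau>) = (\<rho> \<rightarrow> \<sigma> \<rightarrow> \<tau>) \<rightarrow> (\<rho> \<rightarrow> \<sigma>) \<rightarrow> \<rho> \<rightarrow> \<tau>"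
| "const_type Zero = N"
| "const_type Succ = N \<rightarrow> N"
| "const_type (Rec \<sigma>s i) = N \<rightarrow> arrs (\<sigma>s @ map (step_type \<sigma>s) \<sigma>s) (\<sigma>s ! i)"
| "const_type Bool0 = B"
| "const_type Bool1 = B"
| "const_type (Cond \<sigma>) = B \<rightarrow> \<sigma> \<rightarrow> \<sigma> \<rightarrow> \<sigma>"
| "const_type (Single \<sigma>) = \<sigma> \<rightarrow> Star \<sigma>"
| "const_type (CUnion \<sigma>) = Star \<sigma> \<rightarrow> Star \<sigma> \<rightarrow> Star \<sigma>"
| "const_type (CIUnion \<sigma> \<tau>) = Star \<sigma> \<rightarrow> (\<sigma> \<rightarrow> Star \<tau>) \<rightarrow> Star \<tau>"
| "const_type (Mem \<sigma>) = \<sigma> \<rightarrow> Star \<sigma> \<rightarrow> B"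
| "const_type Maxi = Star N \<rightarrow> N"

fun const_ok :: "const \<Rightarrow> bool" where
  "const_ok (Rec \<sigma>s i) \<longleftrightarrow> i < length \<sigma>s"
| "const_ok _ \<longleftrightarrow> True"

text \<open>The constants that are not in \<open>HA\<^sup>\<omega>\<close> are exactly those with a star in their type.\<close>

definition ha_const :: "const \<Rightarrow> bool" where
  "ha_const c \<longleftrightarrow> const_ok c \<and> finite_type (const_type c)"

text \<open>De Bruijn indices: in a context \<open>\<Gamma>\<close>, \<open>Var n\<close> is a variable of type \<open>\<Gamma> ! n\<close>.\<close>

datatype tm = Var nat | Con const | App tm tm  (infixl \<open>\<bullet>\<close> 90)

definition apps :: "tm \<Rightarrow> tm list \<Rightarrow> tm" where
  "apps t ts = foldl (\<bullet>) t ts"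

inductive has_type :: "ty list \<Rightarrow> tm \<Rightarrow> ty \<Rightarrow> bool" where
  "n < length \<Gamma> \<Longrightarrow> has_type \<Gamma> (Var n) (\<Gamma> ! n)"
| "const_ok c \<Longrightarrow> has_type \<Gamma> (Con c) (const_type c)"
| "has_type \<Gamma> s (\<sigma> \<rightarrow> \<tau>) \<Longrightarrow> has_type \<Gamma> t \<sigma> \<Longrightarrow> has_type \<Gamma> (s \<bullet> t) \<tau>"

fun ha_term :: "tm \<Rightarrow> bool" where
  "ha_term (Var n) \<longleftrightarrow> True"
| "ha_term (Con c) \<longleftrightarrow> ha_const c"
| "ha_term (s \<bullet> t) \<longleftrightarrow> ha_term s \<and> ha_term t"

datatype fm =
    Eq ty tm tm | Ipred ty tm | Bot | And fm fm | Imp fm fm | All ty fm | Ex ty fm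

fun ha_fm :: "ty list \<Rightarrow> fm \<Rightarrow> bool" where
  "ha_fm \<Gamma> (Eq \<sigma> s t) \<longleftrightarrow>
     finite_type \<sigma> \<and> ha_term s \<and> ha_term t \<and> has_type \<Gamma> s \<sigma> \<and> has_type \<Gamma> t \<sigma>"
| "ha_fm \<Gamma> (Ipred \<sigma> t) \<longleftrightarrow> False"
| "ha_fm \<Gamma> Bot \<longleftrightarrow> True"
| "ha_fm \<Gamma> (And C D) \<longleftrightarrow> ha_fm \<Gamma> C \<and> ha_fm \<Gamma> D"
| "ha_fm \<Gamma> (Imp C D) \<longleftrightarrow> ha_fm \<Gamma> C \<and> ha_fm \<Gamma> D"
| "ha_fm \<Gamma> (All \<sigma> C) \<longleftrightarrow> finite_type \<sigma> \<and> ha_fm (\<sigma> # \<Gamma>) C"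
| "ha_fm \<Gamma> (Ex \<sigma> C) \<longleftrightarrow> finite_type \<sigma> \<and> ha_fm (\<sigma> # \<Gamma>) C"

definition ha_formula :: "ty list \<Rightarrow> fm \<Rightarrow> bool" where
  "ha_formula \<Gamma> C \<longleftrightarrow> list_all finite_type \<Gamma> \<and> ha_fm \<Gamma> C"

fun subst_tm :: "(nat \<Rightarrow> tm) \<Rightarrow> tm \<Rightarrow> tm" where
  "subst_tm s (Var n) = s n"
| "subst_tm s (Con c) = Con c"
| "subst_tm s (t \<bullet> u) = subst_tm s t \<bullet> subst_tm s u"

definition up :: "(nat \<Rightarrow> tm) \<Rightarrow> nat \<Rightarrow> tm" where
  "up s = case_nat (Var 0) (\<lambda>n. subst_tm (\<lambda>k. Var (Suc k)) (s n))"

fun subst :: "(nat \<Rightarrow> tm) \<Rightarrow> fm \<Rightarrow> fm" where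
  "subst s (Eq \<sigma> t u) = Eq \<sigma> (subst_tm s t) (subst_tm s u)"
| "subst s (Ipred \<sigma> t) = Ipred \<sigma> (subst_tm s t)"
| "subst s Bot = Bot"
| "subst s (And C D) = And (subst s C) (subst s D)"
| "subst s (Imp C D) = Imp (subst s C) (subst s D)"
| "subst s (All \<sigma> C) = All \<sigma> (subst (up s) C)"
| "subst s (Ex \<sigma> C) = Ex \<sigma> (subst (up s) C)"

text \<open>
  For \<open>D\<close> in context \<open>\<sigma> # \<Gamma>\<close>, \<open>inst k t D\<close> is \<open>D(t)\<close>, where \<open>t\<close> lives in \<open>\<Gamma>\<close> extended by \<open>k\<close>
  variables in front.
\<close>

definition inst :: "nat \<Rightarrow> tm \<Rightarrow> fm \<Rightarrow> fm" where
  "inst k t D = subst (case_nat t (\<lambda>n. Var (n + k))) D"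


section \<open>The non-logical axioms of \<open>HA\<^sup>\<omega>\<close>\<close>

text \<open>
  \<open>ha_axiom \<Gamma> C\<close>: the formula \<open>C\<close> with free variables of types \<open>\<Gamma>\<close> is an axiom. The equality axioms
  are reflexivity and substitution in arbitrary formulas. In the recursor axioms the
  context lists the arguments in their order: (\<open>n\<close>,) \<open>w\<^sub>1 \<dots> w\<^sub>k\<close>, \<open>f\<^sub>1 \<dots> f\<^sub>k\<close>.
\<close>

inductive ha_axiom :: "ty list \<Rightarrow> fm \<Rightarrow> bool" where
  eq_refl: "finite_type \<sigma> \<Longrightarrow> ha_axiom [\<sigma>] (Eq \<sigma> (Var 0) (Var 0))"
| eq_subst: "ha_formula (\<sigma> # \<Gamma>) D \<Longrightarrow>
    ha_axiom (\<sigma> # \<sigma> # \<Gamma>)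
      (Imp (Eq \<sigma> (Var 0) (Var 1)) (Imp (inst 2 (Var 0) D) (inst 2 (Var 1) D)))"
| pi: "finite_type \<sigma> \<Longrightarrow> finite_type \<tau> \<Longrightarrow>
    ha_axiom [\<sigma>, \<tau>] (Eq \<sigma> (Con (CPi \<sigma> \<tau>) \<bullet> Var 0 \<bullet> Var 1) (Var 0))"
| sigma: "finite_type \<rho> \<Longrightarrow> finite_type \<sigma> \<Longrightarrow> finite_type \<tau> \<Longrightarrow>
    ha_axiom [\<rho> \<rightarrow> \<sigma> \<rightarrow> \<tau>, \<rho> \<rightarrow> \<sigma>, \<rho>]
      (Eq \<tau> (Con (CSigma \<rho> \<sigma> \<tau>) \<bullet> Var 0 \<bullet> Var 1 \<bullet> Var 2) (Var 0 \<bullet> Var 2 \<bullet> (Var 1 \<bullet> Var 2)))"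
| succ_inj: "ha_axiom [N, N]
    (Imp (Eq N (Con Succ \<bullet> Var 0) (Con Succ \<bullet> Var 1)) (Eq N (Var 0) (Var 1)))"
| succ_zero: "ha_axiom [N] (Imp (Eq N (Con Succ \<bullet> Var 0) (Con Zero)) Bot)"
| rec_zero: "list_all finite_type \<sigma>s \<Longrightarrow> i < length \<sigma>s \<Longrightarrow> k = length \<sigma>s \<Longrightarrow>
    ha_axiom (\<sigma>s @ map (step_type \<sigma>s) \<sigma>s)
      (Eq (\<sigma>s ! i) (apps (Con (Rec \<sigma>s i)) (Con Zero # map Var [0..<2 * k])) (Var i))"
| rec_succ: "list_all finite_type \<sigma>s \<Longrightarrow> i < length \<sigma>s \<Longrightarrow> k = length \<sigma>s \<Longrightarrow>
    ha_axiom (N # \<sigma>s @ map (step_type \<sigma>s) \<sigma>s)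
      (Eq (\<sigma>s ! i)
        (apps (Con (Rec \<sigma>s i)) ((Con Succ \<bullet> Var 0) # map Var [1..<2 * k + 1]))
        (apps (Var (k + 1 + i))
          (Var 0 # map (\<lambda>j. apps (Con (Rec \<sigma>s j)) (map Var [0..<2 * k + 1])) [0..<k])))"
| bool_distinct: "ha_axiom [] (Imp (Eq B (Con Bool0) (Con Bool1)) Bot)"
| bool_ind: "ha_formula (B # \<Gamma>) D \<Longrightarrow>
    ha_axiom \<Gamma> (Imp (And (inst 0 (Con Bool0) D) (inst 0 (Con Bool1) D)) (All B D))"
| cond0: "finite_type \<sigma> \<Longrightarrow>
    ha_axiom [\<sigma>, \<sigma>] (Eq \<sigma> (Con (Cond \<sigma>) \<bullet> Con Bool0 \<bullet> Var 0 \<bullet> Var 1) (Var 0))"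
| cond1: "finite_type \<sigma> \<Longrightarrow>
    ha_axiom [\<sigma>, \<sigma>] (Eq \<sigma> (Con (Cond \<sigma>) \<bullet> Con Bool1 \<bullet> Var 0 \<bullet> Var 1) (Var 1))"
| nat_ind: "ha_formula (N # \<Gamma>) D \<Longrightarrow>
    ha_axiom \<Gamma>
      (Imp (And (inst 0 (Con Zero) D) (All N (Imp D (inst 1 (Con Succ \<bullet> Var 0) D)))) (All N D))"


section \<open>The structure \<open>\<S>\<^sup>\<omega>\<^sub>*\<close>\<close>

text \<open>
  The disjoint union of all \<open>\<S>\<^sub>\<sigma>\<close> has cardinality \<open>\<beth>\<^sub>\<omega>\<close>, and no type of HOL can be proved to be that
  large. So \<open>\<S>\<^sup>\<omega>\<^sub>*\<close> is described, up to isomorphism, inside an arbitrary type \<open>'u\<close>: \<open>Dom S \<sigma>\<close> is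
  \<open>\<S>\<^sub>\<sigma>\<close>, an element of \<open>Dom S (\<sigma> \<rightarrow> \<tau>)\<close> is a function via \<open>app S\<close>, and an element of
  \<open>Dom S (Star \<sigma>)\<close> is a set via \<open>elems S\<close>. \<open>bool S False\<close> and \<open>bool S True\<close> are 0 and 1.
\<close>

record 'u type_structure =
  Dom :: "ty \<Rightarrow> 'u set"
  num :: "nat \<Rightarrow> 'u"
  bool :: "bool \<Rightarrow> 'u"
  app :: "'u \<Rightarrow> 'u \<Rightarrow> 'u"
  elems :: "'u \<Rightarrow> 'u set"

definition full_star_structure :: "'u type_structure \<Rightarrow> bool" where
  "full_star_structure S \<longleftrightarrow>
     bij_betw (num S) UNIV (Dom S N) \<and>
     bij_betw (bool S) UNIV (Dom S B) \<and>
     (\<forall>\<sigma> \<tau>. bij_betw (\<lambda>f. restrict (app S f) (Dom S \<sigma>))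
        (Dom S (\<sigma> \<rightarrow> \<tau>)) (Dom S \<sigma> \<rightarrow>\<^sub>E Dom S \<tau>)) \<and>
     (\<forall>\<sigma>. bij_betw (elems S) (Dom S (Star \<sigma>)) {X. X \<subseteq> Dom S \<sigma> \<and> finite X \<and> X \<noteq> {}})"

definition nat_of :: "'u type_structure \<Rightarrow> 'u \<Rightarrow> nat" where
  "nat_of S = inv (num S)"

definition mk_fun :: "'u type_structure \<Rightarrow> ty \<Rightarrow> ty \<Rightarrow> ('u \<Rightarrow> 'u) \<Rightarrow> 'u" where
  "mk_fun S \<sigma> \<tau> F =
     inv_into (Dom S (\<sigma> \<rightarrow> \<tau>)) (\<lambda>f. restrict (app S f) (Dom S \<sigma>)) (restrict F (Dom S \<sigma>))"

definition mk_set :: "'u type_structure \<Rightarrow> ty \<Rightarrow> 'u set \<Rightarrow> 'u" where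
  "mk_set S \<sigma> X = inv_into (Dom S (Star \<sigma>)) (elems S) X"

fun mk_funs :: "'u type_structure \<Rightarrow> ty list \<Rightarrow> ty \<Rightarrow> ('u list \<Rightarrow> 'u) \<Rightarrow> 'u" where
  "mk_funs S [] \<tau> F = F []"
| "mk_funs S (\<sigma> # \<sigma>s) \<tau> F = mk_fun S \<sigma> (arrs \<sigma>s \<tau>) (\<lambda>x. mk_funs S \<sigma>s \<tau> (\<lambda>xs. F (x # xs)))"

definition app_list :: "'u type_structure \<Rightarrow> 'u \<Rightarrow> 'u list \<Rightarrow> 'u" where
  "app_list S f xs = foldl (app S) f xs"

fun rec_values :: "'u type_structure \<Rightarrow> nat \<Rightarrow> 'u list \<Rightarrow> 'u list \<Rightarrow> 'u list" where
  "rec_values S 0 ws fs = ws"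
| "rec_values S (Suc n) ws fs = map (\<lambda>f. app_list S f (num S n # rec_values S n ws fs)) fs"

fun const_val :: "'u type_structure \<Rightarrow> const \<Rightarrow> 'u" where
  "const_val S (CPi \<sigma> \<tau>) = mk_funs S [\<sigma>, \<tau>] \<sigma> (\<lambda>xs. xs ! 0)"
| "const_val S (CSigma \<rho> \<sigma> \<tau>) =
     mk_funs S [\<rho> \<rightarrow> \<sigma> \<rightarrow> \<tau>, \<rho> \<rightarrow> \<sigma>, \<rho>] \<tau>
       (\<lambda>xs. app S (app S (xs ! 0) (xs ! 2)) (app S (xs ! 1) (xs ! 2)))"
| "const_val S Zero = num S 0"
| "const_val S Succ = mk_fun S N N (\<lambda>x. num S (Suc (nat_of S x)))"
| "const_val S (Rec \<sigma>s i) =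
     mk_funs S (N # \<sigma>s @ map (step_type \<sigma>s) \<sigma>s) (\<sigma>s ! i)
       (\<lambda>xs. let k = length \<sigma>s; ws = take k (tl xs); fs = drop k (tl xs)
             in rec_values S (nat_of S (xs ! 0)) ws fs ! i)"
| "const_val S Bool0 = bool S False"
| "const_val S Bool1 = bool S True"
| "const_val S (Cond \<sigma>) =
     mk_funs S [B, \<sigma>, \<sigma>] \<sigma> (\<lambda>xs. if xs ! 0 = bool S False then xs ! 1 else xs ! 2)"
| "const_val S (Single \<sigma>) = mk_fun S \<sigma> (Star \<sigma>) (\<lambda>x. mk_set S \<sigma> {x})"
| "const_val S (CUnion \<sigma>) =
     mk_funs S [Star \<sigma>, Star \<sigma>] (Star \<sigma>) (\<lambda>xs. mk_set S \<sigma> (elems S (xs ! 0) \<union> elems S (xs ! 1)))"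
| "const_val S (CIUnion \<sigma> \<tau>) =
     mk_funs S [Star \<sigma>, \<sigma> \<rightarrow> Star \<tau>] (Star \<tau>)
       (\<lambda>xs. mk_set S \<tau> (\<Union>w\<in>elems S (xs ! 0). elems S (app S (xs ! 1) w)))"
| "const_val S (Mem \<sigma>) = mk_funs S [\<sigma>, Star \<sigma>] B (\<lambda>xs. bool S (xs ! 0 \<in> elems S (xs ! 1)))"
| "const_val S Maxi = mk_fun S (Star N) N (\<lambda>a. num S (Max (nat_of S ` elems S a)))"

fun eval :: "'u type_structure \<Rightarrow> 'u list \<Rightarrow> tm \<Rightarrow> 'u" where
  "eval S e (Var n) = e ! n"
| "eval S e (Con c) = const_val S c"
| "eval S e (s \<bullet> t) = app S (eval S e s) (eval S e t)"


section \<open>Majorizability\<close>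

text \<open>Strong majorizability; only meaningful on arithmetical star types, so \<open>B\<close> is irrelevant.\<close>

fun smaj :: "'u type_structure \<Rightarrow> ty \<Rightarrow> 'u \<Rightarrow> 'u \<Rightarrow> bool" where
  "smaj S N x y \<longleftrightarrow> nat_of S x \<le> nat_of S y"
| "smaj S B x y \<longleftrightarrow> False"
| "smaj S (\<sigma> \<rightarrow> \<tau>) f g \<longleftrightarrow>
     (\<forall>x\<in>Dom S \<sigma>. \<forall>y\<in>Dom S \<sigma>. smaj S \<sigma> x y \<longrightarrow>
        smaj S \<tau> (app S f x) (app S g y) \<and> smaj S \<tau> (app S g x) (app S g y))"
| "smaj S (Star \<sigma>) a b \<longleftrightarrow>
     (\<forall>u\<in>elems S a. \<exists>v\<in>elems S b. smaj S \<sigma> u v) \<and> (\<forall>v\<in>elems S b. smaj S \<sigma> v v)"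

definition Mon :: "'u type_structure \<Rightarrow> ty \<Rightarrow> 'u set" where
  "Mon S \<sigma> = {a \<in> Dom S \<sigma>. smaj S \<sigma> a a}"

text \<open>
  \<open>dagger \<sigma>\<close> is \<open>\<sigma>\<^sup>\<dagger>\<close>, with \<open>None\<close> for ``empty''; it is only used for finite types, so its value on
  \<open>Star \<sigma>\<close> is irrelevant.
\<close>

fun dagger :: "ty \<Rightarrow> ty option" where
  "dagger N = Some N"
| "dagger B = None"
| "dagger (\<sigma> \<rightarrow> \<tau>) =
     (case dagger \<tau> of
        None \<Rightarrow> None
      | Some \<tau>' \<Rightarrow> (case dagger \<sigma> of None \<Rightarrow> Some \<tau>' | Some \<sigma>' \<Rightarrow> Some (\<sigma>' \<rightarrow> \<tau>')))"
| "dagger (Star \<sigma>) = None"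

text \<open>
  \<open>maj S \<rho> x a\<close> is \<open>x \<le>\<^sup>B\<^sub>\<rho> a\<close> for unbounded \<open>\<rho>\<close>, where \<open>x : \<rho>\<close> and \<open>a : \<rho>\<^sup>\<dagger>\<close>; other \<open>\<rho>\<close> are irrelevant.
\<close>

fun maj :: "'u type_structure \<Rightarrow> ty \<Rightarrow> 'u \<Rightarrow> 'u \<Rightarrow> bool" where
  "maj S N x a \<longleftrightarrow> nat_of S x \<le> nat_of S a"
| "maj S B x a \<longleftrightarrow> False"
| "maj S (\<sigma> \<rightarrow> \<tau>) f g \<longleftrightarrow>
     (case dagger \<sigma> of
        Some \<sigma>' \<Rightarrow>
          (\<forall>x\<in>Dom S \<sigma>. \<forall>a\<in>Dom S \<sigma>'. maj S \<sigma> x a \<longrightarrow> maj S \<tau> (app S f x) (app S g a)) \<and>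
          (\<forall>z\<in>Dom S \<sigma>'. \<forall>a\<in>Dom S \<sigma>'. smaj S \<sigma>' z a \<longrightarrow>
             smaj S (the (dagger \<tau>)) (app S g z) (app S g a))
      | None \<Rightarrow>
          (\<forall>x\<in>Dom S \<sigma>. maj S \<tau> (app S f x) g) \<and> smaj S (the (dagger \<tau>)) g g)"
| "maj S (Star \<sigma>) x a \<longleftrightarrow> False"


section \<open>The \<open>\<U>\<close>-interpretation over a base interpretation\<close>

text \<open>
  A base interpretation gives, for each \<open>\<I>\<^sub>\<sigma>(x)\<close>, the types of the positive and negative witnesses
  and the relation \<open>\<langle>\<I>\<^sub>\<sigma>(x)\<rangle>\<close> between \<open>x\<close>, the positive and the negative witnesses.
\<close>

record 'u base =
  Ipos :: "ty \<Rightarrow> ty list"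
  Ineg :: "ty \<Rightarrow> ty list"
  Irel :: "ty \<Rightarrow> 'u \<Rightarrow> 'u list \<Rightarrow> 'u list \<Rightarrow> bool"

definition base_interpretation :: "'u base \<Rightarrow> bool" where
  "base_interpretation J \<longleftrightarrow>
     (\<forall>\<sigma>. finite_type \<sigma> \<longrightarrow> list_all arith_star_type (Ipos J \<sigma>) \<and> list_all arith_star_type (Ineg J \<sigma>))"

fun pos :: "'u base \<Rightarrow> fm \<Rightarrow> ty list" and neg :: "'u base \<Rightarrow> fm \<Rightarrow> ty list" where
  "pos J (Eq \<sigma> s t) = []"
| "pos J (Ipred \<sigma> t) = Ipos J \<sigma>"
| "pos J Bot = []"
| "pos J (And C D) = pos J C @ pos J D"
| "pos J (Imp C D) =
     map (arrs (pos J C)) (pos J D) @ map (\<lambda>\<tau>. arrs (pos J C @ neg J D) (Star \<tau>)) (neg J C)"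
| "pos J (All \<sigma> C) = pos J C"
| "pos J (Ex \<sigma> C) = pos J C"
| "neg J (Eq \<sigma> s t) = []"
| "neg J (Ipred \<sigma> t) = Ineg J \<sigma>"
| "neg J Bot = []"
| "neg J (And C D) = neg J C @ neg J D"
| "neg J (Imp C D) = pos J C @ neg J D"
| "neg J (All \<sigma> C) = neg J C"
| "neg J (Ex \<sigma> C) = map Star (neg J C)"

definition env :: "'u type_structure \<Rightarrow> ty list \<Rightarrow> 'u list set" where
  "env S \<sigma>s = listset (map (Dom S) \<sigma>s)"

definition mon_tuples :: "'u type_structure \<Rightarrow> ty list \<Rightarrow> 'u list set" where
  "mon_tuples S \<sigma>s = listset (map (Mon S) \<sigma>s)"

definition tuples_in :: "'u type_structure \<Rightarrow> ty list \<Rightarrow> 'u list \<Rightarrow> 'u list set" where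
  "tuples_in S \<sigma>s Bs = listset (map (elems S) Bs) \<inter> mon_tuples S \<sigma>s"

text \<open>
  \<open>interp S J C e as bs\<close>: the formula \<open>\<langle>C\<rangle>\<close> with positive witnesses \<open>as\<close> and negative witnesses
  \<open>bs\<close> is true in \<open>S\<close> under the assignment \<open>e\<close>. All quantifiers over witnesses, also the bounded
  ones, range over monotone elements.
\<close>

fun interp :: "'u type_structure \<Rightarrow> 'u base \<Rightarrow> fm \<Rightarrow> 'u list \<Rightarrow> 'u list \<Rightarrow> 'u list \<Rightarrow> bool" where
  "interp S J (Eq \<sigma> s t) e as bs \<longleftrightarrow> eval S e s = eval S e t"
| "interp S J (Ipred \<sigma> t) e as bs \<longleftrightarrow> Irel J \<sigma> (eval S e t) as bs"
| "interp S J Bot e as bs \<longleftrightarrow> False"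
| "interp S J (And C D) e as bs \<longleftrightarrow>
     interp S J C e (take (length (pos J C)) as) (take (length (neg J C)) bs) \<and>
     interp S J D e (drop (length (pos J C)) as) (drop (length (neg J C)) bs)"
| "interp S J (Imp C D) e as bs \<longleftrightarrow>
     (let fs = take (length (pos J D)) as; gs = drop (length (pos J D)) as;
          a = take (length (pos J C)) bs; d = drop (length (pos J C)) bs
      in (\<forall>b \<in> tuples_in S (neg J C) (map (\<lambda>g. app_list S g (a @ d)) gs). interp S J C e a b)
         \<longrightarrow> interp S J D e (map (\<lambda>f. app_list S f a) fs) d)"
| "interp S J (All \<sigma> C) e as bs \<longleftrightarrow> (\<forall>x \<in> Dom S \<sigma>. interp S J C (x # e) as bs)"
| "interp S J (Ex \<sigma> C) e as bs \<longleftrightarrow>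
     (\<exists>x \<in> Dom S \<sigma>. \<forall>b \<in> tuples_in S (neg J C) bs. interp S J C (x # e) as b)"

text \<open>
  The target theory consists of the sentences true in \<open>\<S>\<^sup>\<omega>\<^sub>*\<close>, so provability in it is truth in \<open>S\<close>.
  Closed terms are those typable in the empty context.
\<close>

definition U_interpretable :: "'u type_structure \<Rightarrow> 'u base \<Rightarrow> ty list \<Rightarrow> fm \<Rightarrow> bool" where
  "U_interpretable S J \<Gamma> C \<longleftrightarrow>
     (\<exists>ts. list_all2 (has_type []) ts (pos J C) \<and>
           map (eval S []) ts \<in> mon_tuples S (pos J C) \<and>
           (\<forall>bs \<in> mon_tuples S (neg J C). \<forall>e \<in> env S \<Gamma>. interp S J C e (map (eval S []) ts) bs))"

fun relativize :: "fm \<Rightarrow> fm" where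
  "relativize (Eq \<sigma> s t) = Eq \<sigma> s t"
| "relativize (Ipred \<sigma> t) = Ipred \<sigma> t"
| "relativize Bot = Bot"
| "relativize (And C D) = And (relativize C) (relativize D)"
| "relativize (Imp C D) = Imp (relativize C) (relativize D)"
| "relativize (All \<sigma> C) = All \<sigma> (Imp (Ipred \<sigma> (Var 0)) (relativize C))"
| "relativize (Ex \<sigma> C) = Ex \<sigma> (And (Ipred \<sigma> (Var 0)) (relativize C))"

fun Conj_imp :: "fm list \<Rightarrow> fm \<Rightarrow> fm" where
  "Conj_imp [] C = C"
| "Conj_imp (D # Ds) C = Imp (foldl And D Ds) C"

fun Alls :: "ty list \<Rightarrow> fm \<Rightarrow> fm" where
  "Alls [] C = C"
| "Alls (\<sigma> # \<Gamma>) C = Alls \<Gamma> (All \<sigma> C)"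

definition I_interpretable :: "'u type_structure \<Rightarrow> 'u base \<Rightarrow> ty list \<Rightarrow> fm \<Rightarrow> bool" where
  "I_interpretable S J \<Gamma> C \<longleftrightarrow>
     U_interpretable S J []
       (Alls \<Gamma> (Conj_imp (map (\<lambda>i. Ipred (\<Gamma> ! i) (Var i)) [0..<length \<Gamma>]) (relativize C)))"

definition sound_type_informative_base_interpretation :: "'u type_structure \<Rightarrow> 'u base \<Rightarrow> bool" where
  "sound_type_informative_base_interpretation S J \<longleftrightarrow>
     base_interpretation J \<and>
     (\<forall>c. ha_const c \<longrightarrow> U_interpretable S J [] (Ipred (const_type c) (Con c))) \<and>
     (\<forall>\<sigma> \<tau>. finite_type \<sigma> \<longrightarrow> finite_type \<tau> \<longrightarrow>
        U_interpretable S J []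
          (All \<sigma> (All (\<sigma> \<rightarrow> \<tau>)
            (Imp (And (Ipred \<sigma> (Var 1)) (Ipred (\<sigma> \<rightarrow> \<tau>) (Var 0))) (Ipred \<tau> (Var 0 \<bullet> Var 1)))))) \<and>
     (\<forall>\<Gamma> C. ha_axiom \<Gamma> C \<longrightarrow> I_interpretable S J \<Gamma> C)"

definition I_mb :: "'u type_structure \<Rightarrow> 'u base" where
  "I_mb S = \<lparr>
     Ipos = (\<lambda>\<sigma>. case dagger \<sigma> of None \<Rightarrow> [] | Some \<sigma>' \<Rightarrow> [\<sigma>']),
     Ineg = (\<lambda>\<sigma>. []),
     Irel = (\<lambda>\<sigma> x as bs. case dagger \<sigma> of None \<Rightarrow> True | Some \<sigma>' \<Rightarrow> maj S \<sigma> x (as ! 0)) \<rparr>"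

end

theory Submission
  imports Defs
begin

text \<open>
  Each recursor is majorized by a recursor that takes a join at every step: a maximum at type \<open>N\<close>,
  a union at star types, pointwise at function types. Joins of positive witnesses also preserve
  the interpretation of a formula for each fixed negative witness, because a joined function takes
  joined values and a larger finite set of counter-witnesses gives a stronger premise. This settles
  induction. The witnesses of \<open>D(0), \<dots>, D(m)\<close> are the first iterates of the step witness, joined
  along the way, so that the last of them works for all \<open>n \<le> m\<close>. The counter-witnesses are
  collected backwards into finite sets, along the same iteration. The hypothesis \<open>\<I>(n)\<close> provides
  the bound \<open>m\<close> and nothing else about \<open>n\<close>.
\<close>

text \<open>The plain recursor does not majorize itself: with initial value 5 and a step that is
  constantly 0, its value drops from 5 to 0 between zero steps and one step. This is what forces the
  joins. A realizer never sees the number it works for, only a bound m. Every step function is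
  therefore given m itself in place of the running count, which is legitimate because m bounds every
  count up to m. The resulting iteration, \<open>iterates\<close>, serves twice: as the majorant of
  the recursors and as the realizer of induction. Witnesses have to be closed terms and monotone at
  once. The predicate \<open>mdef\<close> carries both properties through variables, application,
  abstraction, joins and recursion, so that realizers can be given as plain functions on
  assignments. Counter-witnesses come in tuples, and a tuple of finite sets stands for a box, the
  product of its components. Unions are formed componentwise, so the boxes collected for induction
  are in general larger than the families of challenges that actually arise.\<close>

section \<open>Assignments, monotone tuples and iterated application\<close>

lemma listset_iff: "xs \<in> listset As \<longleftrightarrow> length xs = length As \<and> (\<forall>i<length As. xs ! i \<in> As ! i)"
proof (induction As arbitrary: xs)
  case (Cons A As)
  then show ?case
    by (cases xs) (auto simp: set_Cons_def nth_Cons less_Suc_eq_0_disj split: nat.splits)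
qed auto

lemma env_iff: "e \<in> env S \<Gamma> \<longleftrightarrow> length e = length \<Gamma> \<and> (\<forall>i<length \<Gamma>. e ! i \<in> Dom S (\<Gamma> ! i))"
  by (auto simp: env_def listset_iff)

lemma env_Nil [simp]: "e \<in> env S [] \<longleftrightarrow> e = []"
  by (simp add: env_iff)

lemma env_Cons: "e \<in> env S (\<sigma> # \<Gamma>) \<longleftrightarrow> (\<exists>x e'. e = x # e' \<and> x \<in> Dom S \<sigma> \<and> e' \<in> env S \<Gamma>)"
  by (auto simp: env_def set_Cons_def)

lemma env_Cons' [simp]: "x # e \<in> env S (\<sigma> # \<Gamma>) \<longleftrightarrow> x \<in> Dom S \<sigma> \<and> e \<in> env S \<Gamma>"
  by (simp add: env_Cons)

lemma env_append: "e \<in> env S \<Gamma> \<Longrightarrow> e' \<in> env S \<Delta> \<Longrightarrow> e @ e' \<in> env S (\<Gamma> @ \<Delta>)"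
  by (auto simp: env_iff nth_append)

lemma env_appendE:
  assumes "e \<in> env S (\<Gamma> @ \<Delta>)"
  obtains e1 e2 where "e = e1 @ e2" "e1 \<in> env S \<Gamma>" "e2 \<in> env S \<Delta>"
  using assms
proof (induction \<Gamma> arbitrary: e thesis)
  case Nil
  then show ?case by (metis append_Nil env_Nil)
next
  case (Cons \<sigma> \<Gamma>)
  then show ?case by (metis append_Cons env_Cons)
qed

lemma env_length: "e \<in> env S \<Gamma> \<Longrightarrow> length e = length \<Gamma>"
  by (simp add: env_iff)

lemma mon_tuples_iff:
  "e \<in> mon_tuples S \<Gamma> \<longleftrightarrow> length e = length \<Gamma> \<and> (\<forall>i<length \<Gamma>. e ! i \<in> Mon S (\<Gamma> ! i))"
  by (auto simp: mon_tuples_def listset_iff)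

lemma mon_tuples_env: "e \<in> mon_tuples S \<Gamma> \<Longrightarrow> e \<in> env S \<Gamma>"
  by (auto simp: mon_tuples_iff env_iff Mon_def)

lemma mon_tuples_Nil [simp]: "e \<in> mon_tuples S [] \<longleftrightarrow> e = []"
  by (simp add: mon_tuples_iff)

lemma mon_tuples_Cons:
  "e \<in> mon_tuples S (\<sigma> # \<Gamma>) \<longleftrightarrow> (\<exists>x e'. e = x # e' \<and> x \<in> Mon S \<sigma> \<and> e' \<in> mon_tuples S \<Gamma>)"
  by (auto simp: mon_tuples_def set_Cons_def)

lemma mon_tuples_Cons' [simp]:
  "x # e \<in> mon_tuples S (\<sigma> # \<Gamma>) \<longleftrightarrow> x \<in> Mon S \<sigma> \<and> e \<in> mon_tuples S \<Gamma>"
  by (simp add: mon_tuples_Cons)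

lemma mon_tuples_append:
  "e \<in> mon_tuples S \<Gamma> \<Longrightarrow> e' \<in> mon_tuples S \<Delta> \<Longrightarrow> e @ e' \<in> mon_tuples S (\<Gamma> @ \<Delta>)"
  by (auto simp: mon_tuples_iff nth_append)

lemma mon_tuples_appendE:
  assumes "e \<in> mon_tuples S (\<Gamma> @ \<Delta>)"
  obtains e1 e2 where "e = e1 @ e2" "e1 \<in> mon_tuples S \<Gamma>" "e2 \<in> mon_tuples S \<Delta>"
  using assms
proof (induction \<Gamma> arbitrary: e thesis)
  case Nil
  then show ?case by (metis append_Nil mon_tuples_Nil)
next
  case (Cons \<sigma> \<Gamma>)
  then show ?case by (metis append_Cons mon_tuples_Cons)
qed

lemma mon_tuples_length: "e \<in> mon_tuples S \<Gamma> \<Longrightarrow> length e = length \<Gamma>"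
  by (simp add: mon_tuples_iff)

lemma arrs_simps [simp]: "arrs [] \<tau> = \<tau>" "arrs (\<sigma> # \<Gamma>) \<tau> = \<sigma> \<rightarrow> arrs \<Gamma> \<tau>"
  by (simp_all add: arrs_def)

lemma arith_arrs [simp]:
  "arith_star_type (arrs \<Gamma> \<tau>) \<longleftrightarrow> list_all arith_star_type \<Gamma> \<and> arith_star_type \<tau>"
  by (induction \<Gamma>) auto

lemma app_list_simps [simp]:
  "app_list S f [] = f" "app_list S f (x # xs) = app_list S (app S f x) xs"
  by (simp_all add: app_list_def)

lemma eval_apps: "eval S e (apps t ts) = app_list S (eval S e t) (map (eval S e) ts)"
  by (induction ts arbitrary: t) (auto simp: apps_def app_list_def)

lemma has_type_apps:
  "has_type \<Gamma> t (arrs \<Delta> \<tau>) \<Longrightarrow> list_all2 (has_type \<Gamma>) ts \<Delta> \<Longrightarrow> has_type \<Gamma> (apps t ts) \<tau>"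
proof (induction \<Delta> arbitrary: t ts)
  case (Cons \<sigma> \<Delta>)
  then obtain u us where "ts = u # us" "has_type \<Gamma> u \<sigma>" "list_all2 (has_type \<Gamma>) us \<Delta>"
    by (auto simp: list_all2_Cons2)
  with Cons show ?case
    by (simp add: apps_def has_type.intros)
qed (simp add: apps_def)

lemma has_type_Con: "const_ok c \<Longrightarrow> \<sigma> = const_type c \<Longrightarrow> has_type \<Gamma> (Con c) \<sigma>"
  by (simp add: has_type.intros)

lemma has_type_Var: "n < length \<Gamma> \<Longrightarrow> \<sigma> = \<Gamma> ! n \<Longrightarrow> has_type \<Gamma> (Var n) \<sigma>"
  by (simp add: has_type.intros)

lemma has_type_subst_tm:
  assumes "has_type \<Delta> t \<tau>" "\<And>i. i < length \<Delta> \<Longrightarrow> has_type \<Gamma> (s i) (\<Delta> ! i)"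
  shows "has_type \<Gamma> (subst_tm s t) \<tau>"
  using assms by (induction rule: has_type.induct) (auto intro: has_type.intros)

lemma eval_subst_tm:
  assumes "has_type \<Delta> t \<tau>" "\<And>i. i < length \<Delta> \<Longrightarrow> eval S e (s i) = e' ! i"
  shows "eval S e (subst_tm s t) = eval S e' t"
  using assms by (induction rule: has_type.induct) auto

section \<open>The structure\<close>

locale star_structure =
  fixes S :: "'u type_structure"
  assumes full: "full_star_structure S"
begin

lemma bij_num: "bij_betw (num S) UNIV (Dom S N)"
  and bij_bool: "bij_betw (bool S) UNIV (Dom S B)"
  and bij_app: "bij_betw (\<lambda>f. restrict (app S f) (Dom S \<sigma>))
        (Dom S (\<sigma> \<rightarrow> \<tau>)) (Dom S \<sigma> \<rightarrow>\<^sub>E Dom S \<tau>)"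
  and bij_elems: "bij_betw (elems S) (Dom S (Star \<sigma>)) {X. X \<subseteq> Dom S \<sigma> \<and> finite X \<and> X \<noteq> {}}"
  using full by (auto simp: full_star_structure_def)

lemma num_Dom [simp]: "num S n \<in> Dom S N"
  using bij_num by (auto simp: bij_betw_def)

lemma nat_of_num [simp]: "nat_of S (num S n) = n"
  using bij_num by (simp add: nat_of_def bij_betw_def)

lemma num_nat_of [simp]: "x \<in> Dom S N \<Longrightarrow> num S (nat_of S x) = x"
  using bij_num by (simp add: nat_of_def bij_betw_def f_inv_into_f)

lemma num_eq_iff [simp]: "num S m = num S n \<longleftrightarrow> m = n"
  by (metis nat_of_num)

lemma bool_Dom [simp]: "bool S b \<in> Dom S B"
  using bij_bool by (auto simp: bij_betw_def)

lemma bool_eq_iff [simp]: "bool S a = bool S b \<longleftrightarrow> a = b"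
  using bij_bool by (auto simp: bij_betw_def dest: injD)

lemma Dom_B: "Dom S B = {bool S False, bool S True}"
  using bij_bool by (auto simp: bij_betw_def UNIV_bool)

lemma app_Dom: "f \<in> Dom S (\<sigma> \<rightarrow> \<tau>) \<Longrightarrow> x \<in> Dom S \<sigma> \<Longrightarrow> app S f x \<in> Dom S \<tau>"
  using bij_betw_apply[OF bij_app, of f \<sigma> \<tau>] by (auto simp: PiE_iff)

lemma Dom_fun_eqI:
  assumes "f \<in> Dom S (\<sigma> \<rightarrow> \<tau>)" "g \<in> Dom S (\<sigma> \<rightarrow> \<tau>)" "\<And>x. x \<in> Dom S \<sigma> \<Longrightarrow> app S f x = app S g x"
  shows "f = g"
proof -
  have "restrict (app S f) (Dom S \<sigma>) = restrict (app S g) (Dom S \<sigma>)"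
    using assms(3) by (rule restrict_ext)
  then show ?thesis
    using assms(1,2) bij_app[of \<sigma> \<tau>] by (auto simp: bij_betw_def dest: inj_onD)
qed

lemma
  assumes "\<And>x. x \<in> Dom S \<sigma> \<Longrightarrow> F x \<in> Dom S \<tau>"
  shows mk_fun_Dom: "mk_fun S \<sigma> \<tau> F \<in> Dom S (\<sigma> \<rightarrow> \<tau>)"
    and app_mk_fun: "x \<in> Dom S \<sigma> \<Longrightarrow> app S (mk_fun S \<sigma> \<tau> F) x = F x"
proof -
  have F: "restrict F (Dom S \<sigma>) \<in> (\<lambda>f. restrict (app S f) (Dom S \<sigma>)) ` Dom S (\<sigma> \<rightarrow> \<tau>)"
    using assms bij_app[of \<sigma> \<tau>] by (auto simp: bij_betw_def)
  show "mk_fun S \<sigma> \<tau> F \<in> Dom S (\<sigma> \<rightarrow> \<tau>)"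
    unfolding mk_fun_def using F by (rule inv_into_into)
  have "restrict (app S (mk_fun S \<sigma> \<tau> F)) (Dom S \<sigma>) = restrict F (Dom S \<sigma>)"
    unfolding mk_fun_def using F by (rule f_inv_into_f)
  then show "x \<in> Dom S \<sigma> \<Longrightarrow> app S (mk_fun S \<sigma> \<tau> F) x = F x"
    by (metis restrict_apply')
qed

lemma
  assumes "X \<subseteq> Dom S \<sigma>" "finite X" "X \<noteq> {}"
  shows mk_set_Dom: "mk_set S \<sigma> X \<in> Dom S (Star \<sigma>)"
    and elems_mk_set: "elems S (mk_set S \<sigma> X) = X"
proof -
  have X: "X \<in> elems S ` Dom S (Star \<sigma>)"
    using assms bij_elems[of \<sigma>] by (simp add: bij_betw_def)
  show "mk_set S \<sigma> X \<in> Dom S (Star \<sigma>)" "elems S (mk_set S \<sigma> X) = X"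
    unfolding mk_set_def by (rule inv_into_into[OF X]) (rule f_inv_into_f[OF X])
qed

lemma
  assumes "a \<in> Dom S (Star \<sigma>)"
  shows elems_subset: "elems S a \<subseteq> Dom S \<sigma>"
    and finite_elems: "finite (elems S a)"
    and elems_nonempty: "elems S a \<noteq> {}"
  using bij_betw_apply[OF bij_elems assms] by auto

lemma mk_funs_Dom:
  "\<forall>xs\<in>env S \<sigma>s. F xs \<in> Dom S \<tau> \<Longrightarrow> mk_funs S \<sigma>s \<tau> F \<in> Dom S (arrs \<sigma>s \<tau>)"
  by (induction \<sigma>s arbitrary: F) (auto intro!: mk_fun_Dom)

lemma app_mk_funs:
  "\<forall>xs\<in>env S \<sigma>s. F xs \<in> Dom S \<tau> \<Longrightarrow> xs \<in> env S \<sigma>s \<Longrightarrow>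
    app_list S (mk_funs S \<sigma>s \<tau> F) xs = F xs"
proof (induction \<sigma>s arbitrary: F xs)
  case (Cons \<sigma> \<sigma>s)
  then obtain x ys where xs: "xs = x # ys" "x \<in> Dom S \<sigma>" "ys \<in> env S \<sigma>s"
    by (auto simp: env_Cons)
  have F: "\<forall>ys\<in>env S \<sigma>s. F (y # ys) \<in> Dom S \<tau>" if "y \<in> Dom S \<sigma>" for y
    using Cons.prems(1) that by auto
  have "app S (mk_funs S (\<sigma> # \<sigma>s) \<tau> F) x = mk_funs S \<sigma>s \<tau> (\<lambda>xs. F (x # xs))"
    using F xs(2) by (simp add: app_mk_fun mk_funs_Dom)
  with Cons.IH[OF F[OF xs(2)] xs(3)] show ?case
    by (simp add: xs)
qed simp

declare mk_funs.simps [simp del]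

lemma app_list_Dom:
  "f \<in> Dom S (arrs \<sigma>s \<tau>) \<Longrightarrow> xs \<in> env S \<sigma>s \<Longrightarrow> app_list S f xs \<in> Dom S \<tau>"
proof (induction \<sigma>s arbitrary: f xs)
  case (Cons \<sigma> \<sigma>s)
  from Cons.prems obtain x ys where xs: "xs = x # ys" "x \<in> Dom S \<sigma>" "ys \<in> env S \<sigma>s"
    by (auto simp: env_Cons)
  have "app S f x \<in> Dom S (arrs \<sigma>s \<tau>)"
    using Cons.prems(1) xs(2) by (intro app_Dom[of f \<sigma>]) simp_all
  with Cons.IH xs show ?case
    by simp
qed simp

section \<open>Values of the constants\<close>

lemma rec_values_env:
  assumes "ws \<in> env S \<sigma>s" "fs \<in> env S (map (step_type \<sigma>s) \<sigma>s)"
  shows "rec_values S n ws fs \<in> env S \<sigma>s"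
proof (induction n)
  case (Suc n)
  have "app_list S (fs ! i) (num S n # rec_values S n ws fs) \<in> Dom S (\<sigma>s ! i)" if "i < length \<sigma>s" for i
  proof (rule app_list_Dom[of _ "N # \<sigma>s"])
    show "fs ! i \<in> Dom S (arrs (N # \<sigma>s) (\<sigma>s ! i))"
      using that assms(2) by (auto simp: env_iff step_type_def)
  qed (use Suc in simp)
  then show ?case
    using assms(2) by (auto simp: env_iff)
qed (use assms in simp)

lemma rec_fun_Dom:
  assumes "i < length \<sigma>s" "xs \<in> env S (N # \<sigma>s @ map (step_type \<sigma>s) \<sigma>s)"
  shows "rec_values S n (take (length \<sigma>s) (tl xs)) (drop (length \<sigma>s) (tl xs)) ! i \<in> Dom S (\<sigma>s ! i)"
proof -
  obtain m ws fs where xs: "xs = m # ws @ fs" "ws \<in> env S \<sigma>s" "fs \<in> env S (map (step_type \<sigma>s) \<sigma>s)"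
    using assms(2) by (auto simp: env_Cons elim!: env_appendE)
  then show ?thesis
    using rec_values_env[OF xs(2,3), of n] assms(1) by (simp add: env_iff)
qed

lemma app_Rec:
  assumes "i < length \<sigma>s" "n \<in> Dom S N" "ws \<in> env S \<sigma>s" "fs \<in> env S (map (step_type \<sigma>s) \<sigma>s)"
  shows "app_list S (const_val S (Rec \<sigma>s i)) (n # ws @ fs) = rec_values S (nat_of S n) ws fs ! i"
proof -
  have "length ws = length \<sigma>s"
    using assms(3) by (simp add: env_iff)
  moreover have "n # ws @ fs \<in> env S (N # \<sigma>s @ map (step_type \<sigma>s) \<sigma>s)"
    using assms(2-4) by (simp add: env_append)
  ultimately show ?thesis
    using rec_fun_Dom[OF assms(1)] by (subst const_val.simps, subst app_mk_funs) (auto simp: Let_def)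
qed

lemma app_Succ [simp]: "x \<in> Dom S N \<Longrightarrow> app S (const_val S Succ) x = num S (Suc (nat_of S x))"
  by (simp add: app_mk_fun)

lemma
  assumes "\<forall>xs\<in>env S \<sigma>s. F xs \<in> Dom S \<tau>"
  shows mk_funs_app2: "\<sigma>s = [\<rho>\<^sub>0, \<rho>\<^sub>1] \<Longrightarrow> x \<in> Dom S \<rho>\<^sub>0 \<Longrightarrow> y \<in> Dom S \<rho>\<^sub>1 \<Longrightarrow>
      app S (app S (mk_funs S \<sigma>s \<tau> F) x) y = F [x, y]"
    and mk_funs_app3: "\<sigma>s = [\<rho>\<^sub>0, \<rho>\<^sub>1, \<rho>\<^sub>2] \<Longrightarrow> x \<in> Dom S \<rho>\<^sub>0 \<Longrightarrow> y \<in> Dom S \<rho>\<^sub>1 \<Longrightarrow> z \<in> Dom S \<rho>\<^sub>2 \<Longrightarrow>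
      app S (app S (app S (mk_funs S \<sigma>s \<tau> F) x) y) z = F [x, y, z]"
  using app_mk_funs[OF assms, of "[x, y]"] app_mk_funs[OF assms, of "[x, y, z]"] by auto

lemma CPi_app [simp]:
  "x \<in> Dom S \<sigma> \<Longrightarrow> y \<in> Dom S \<tau> \<Longrightarrow> app S (app S (const_val S (CPi \<sigma> \<tau>)) x) y = x"
  by (subst const_val.simps, subst mk_funs_app2) (auto simp: env_Cons)

lemma CSigma_app [simp]:
  assumes "x \<in> Dom S (\<rho> \<rightarrow> \<sigma> \<rightarrow> \<tau>)" "y \<in> Dom S (\<rho> \<rightarrow> \<sigma>)" "z \<in> Dom S \<rho>"
  shows "app S (app S (app S (const_val S (CSigma \<rho> \<sigma> \<tau>)) x) y) z = app S (app S x z) (app S y z)"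
  using assms by (subst const_val.simps, subst mk_funs_app3) (auto simp: env_Cons intro!: app_Dom[OF app_Dom app_Dom])

lemma Cond_app [simp]:
  assumes "i \<in> Dom S B" "x \<in> Dom S \<sigma>" "y \<in> Dom S \<sigma>"
  shows "app S (app S (app S (const_val S (Cond \<sigma>)) i) x) y = (if i = bool S False then x else y)"
  using assms by (subst const_val.simps, subst mk_funs_app3) (auto simp: env_Cons)

lemma Single_app: "x \<in> Dom S \<sigma> \<Longrightarrow> app S (const_val S (Single \<sigma>)) x = mk_set S \<sigma> {x}"
  by (simp add: app_mk_fun mk_set_Dom)

lemma union_Dom:
  "a \<in> Dom S (Star \<sigma>) \<Longrightarrow> b \<in> Dom S (Star \<sigma>) \<Longrightarrow> mk_set S \<sigma> (elems S a \<union> elems S b) \<in> Dom S (Star \<sigma>)"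
  by (intro mk_set_Dom) (simp_all add: elems_subset finite_elems elems_nonempty)

lemma CUnion_app:
  assumes "a \<in> Dom S (Star \<sigma>)" "b \<in> Dom S (Star \<sigma>)"
  shows "app S (app S (const_val S (CUnion \<sigma>)) a) b = mk_set S \<sigma> (elems S a \<union> elems S b)"
  using assms by (subst const_val.simps, subst mk_funs_app2) (auto simp: env_Cons union_Dom)

lemma
  assumes "a \<in> Dom S (Star \<sigma>)" "f \<in> Dom S (\<sigma> \<rightarrow> Star \<tau>)"
  shows Union_Dom: "mk_set S \<tau> (\<Union>w\<in>elems S a. elems S (app S f w)) \<in> Dom S (Star \<tau>)"
    and elems_Union: "elems S (mk_set S \<tau> (\<Union>w\<in>elems S a. elems S (app S f w))) =
      (\<Union>w\<in>elems S a. elems S (app S f w))"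
proof -
  have fw: "app S f w \<in> Dom S (Star \<tau>)" if "w \<in> elems S a" for w
    using that elems_subset[OF assms(1)] by (intro app_Dom[OF assms(2)]) auto
  have "(\<Union>w\<in>elems S a. elems S (app S f w)) \<subseteq> Dom S \<tau>"
    by (intro UN_least elems_subset[OF fw])
  moreover have "finite (\<Union>w\<in>elems S a. elems S (app S f w))"
    by (intro finite_UN_I finite_elems[OF assms(1)] finite_elems[OF fw])
  moreover have "(\<Union>w\<in>elems S a. elems S (app S f w)) \<noteq> {}"
    using elems_nonempty[OF assms(1)] elems_nonempty[OF fw] by simp
  ultimately
  show "mk_set S \<tau> (\<Union>w\<in>elems S a. elems S (app S f w)) \<in> Dom S (Star \<tau>)"
    "elems S (mk_set S \<tau> (\<Union>w\<in>elems S a. elems S (app S f w))) = (\<Union>w\<in>elems S a. elems S (app S f w))"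
    by (simp_all add: mk_set_Dom elems_mk_set)
qed

lemma CIUnion_app:
  assumes "a \<in> Dom S (Star \<sigma>)" "f \<in> Dom S (\<sigma> \<rightarrow> Star \<tau>)"
  shows "app S (app S (const_val S (CIUnion \<sigma> \<tau>)) a) f = mk_set S \<tau> (\<Union>w\<in>elems S a. elems S (app S f w))"
  using assms by (subst const_val.simps, subst mk_funs_app2) (auto simp: env_Cons Union_Dom)

lemma Maxi_app: "a \<in> Dom S (Star N) \<Longrightarrow> app S (const_val S Maxi) a = num S (Max (nat_of S ` elems S a))"
  by (simp add: app_mk_fun)

lemma const_val_Dom:
  assumes "const_ok c"
  shows "const_val S c \<in> Dom S (const_type c)"
proof -
  have funs: "mk_funs S \<sigma>s \<tau> F \<in> Dom S \<rho>"
    if "\<rho> = arrs \<sigma>s \<tau>" "\<forall>xs\<in>env S \<sigma>s. F xs \<in> Dom S \<tau>" for \<sigma>s \<tau> \<rho> F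
    using that mk_funs_Dom by simp
  show ?thesis
  proof (cases c)
    case (CSigma \<rho> \<sigma> \<tau>)
    then show ?thesis
      by (auto simp: env_Cons intro!: funs app_Dom[OF app_Dom app_Dom])
  next
    case (Rec \<sigma>s i)
    with assms rec_fun_Dom show ?thesis
      by (auto simp: Let_def intro!: funs)
  next
    case (Single \<sigma>)
    then show ?thesis
      by (auto intro!: mk_fun_Dom mk_set_Dom)
  qed (auto simp: env_Cons union_Dom Union_Dom intro!: funs mk_fun_Dom)
qed

lemma eval_Dom: "has_type \<Gamma> t \<tau> \<Longrightarrow> e \<in> env S \<Gamma> \<Longrightarrow> eval S e t \<in> Dom S \<tau>"
proof (induction rule: has_type.induct)
  case (3 \<Gamma> s \<sigma> \<tau> t)
  then show ?case
    using app_Dom by simp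
qed (simp_all add: env_iff const_val_Dom del: const_val.simps)

section \<open>Definable monotone functions\<close>

text \<open>Strong majorizability demands a monotone right-hand side in its function and set
  clauses. Whatever majorizes something is therefore in \<open>Mon\<close> as soon as it lies in the
  carrier.\<close>

lemma smaj_refl_right: "smaj S \<sigma> x y \<Longrightarrow> smaj S \<sigma> y y"
  by (cases \<sigma>) auto

text \<open>At function types the pair \<open>u\<close>, \<open>v\<close> is split into
  \<open>u\<close>, \<open>v\<close> and \<open>v\<close>, \<open>v\<close>. The second pair is
  available because \<open>v\<close> is monotone by \<open>smaj_refl_right\<close>.\<close>

lemma smaj_trans: "smaj S \<sigma> x y \<Longrightarrow> smaj S \<sigma> y z \<Longrightarrow> smaj S \<sigma> x z"
proof (induction \<sigma> arbitrary: x y z)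
  case (Fun \<sigma> \<tau>)
  show ?case
    unfolding smaj.simps
  proof (intro ballI impI conjI)
    fix u v
    assume uv: "u \<in> Dom S \<sigma>" "v \<in> Dom S \<sigma>" "smaj S \<sigma> u v"
    then have "smaj S \<sigma> v v"
      using smaj_refl_right by blast
    with uv Fun.prems have "smaj S \<tau> (app S x u) (app S y v)" "smaj S \<tau> (app S y v) (app S z v)"
      by auto
    then show "smaj S \<tau> (app S x u) (app S z v)"
      by (rule Fun.IH(2))
    show "smaj S \<tau> (app S z u) (app S z v)"
      using uv Fun.prems by auto
  qed
next
  case (Star \<sigma>)
  from Star.prems show ?case
    by (auto; metis Star.IH)
qed auto

lemma smaj_appD:
  "smaj S (\<sigma> \<rightarrow> \<tau>) f g \<Longrightarrow> smaj S \<sigma> x y \<Longrightarrow> x \<in> Dom S \<sigma> \<Longrightarrow> y \<in> Dom S \<sigma> \<Longrightarrow>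
    smaj S \<tau> (app S f x) (app S g y)"
  by simp

definition tmaj :: "ty list \<Rightarrow> 'u list \<Rightarrow> 'u list \<Rightarrow> bool" where
  "tmaj \<Gamma> xs ys \<longleftrightarrow> (\<forall>i<length \<Gamma>. smaj S (\<Gamma> ! i) (xs ! i) (ys ! i))"

lemma tmaj_Nil [simp]: "tmaj [] xs ys"
  by (simp add: tmaj_def)

lemma tmaj_Cons [simp]:
  "tmaj (\<sigma> # \<Gamma>) (x # xs) (y # ys) \<longleftrightarrow> smaj S \<sigma> x y \<and> tmaj \<Gamma> xs ys"
  by (auto simp: tmaj_def nth_Cons less_Suc_eq_0_disj split: nat.splits)

lemma tmaj_append:
  assumes "length xs = length \<Gamma>" "length ys = length \<Gamma>"
  shows "tmaj (\<Gamma> @ \<Delta>) (xs @ xs') (ys @ ys') \<longleftrightarrow> tmaj \<Gamma> xs ys \<and> tmaj \<Delta> xs' ys'"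
  using assms
proof (induction \<Gamma> arbitrary: xs ys)
  case (Cons \<sigma> \<Gamma>)
  then show ?case
    by (auto simp: length_Suc_conv)
qed simp

lemma tmaj_refl_right: "tmaj \<Gamma> xs ys \<Longrightarrow> tmaj \<Gamma> ys ys"
  using smaj_refl_right by (auto simp: tmaj_def)

lemma tmaj_trans: "tmaj \<Gamma> xs ys \<Longrightarrow> tmaj \<Gamma> ys zs \<Longrightarrow> tmaj \<Gamma> xs zs"
  using smaj_trans by (auto simp: tmaj_def)

lemma mon_tuples_tmaj: "e \<in> mon_tuples S \<Gamma> \<longleftrightarrow> e \<in> env S \<Gamma> \<and> tmaj \<Gamma> e e"
  by (auto simp: mon_tuples_iff env_iff tmaj_def Mon_def)

text \<open>
  Witnesses are found as functions of an environment that are both definable by a term and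
  monotone. New arguments are added at the end of an environment, so that in a bracket
  abstraction no variable has to be renamed.
\<close>

definition mdef :: "ty list \<Rightarrow> ty \<Rightarrow> ('u list \<Rightarrow> 'u) \<Rightarrow> bool" where
  "mdef \<Gamma> \<sigma> F \<longleftrightarrow>
     (\<exists>t. has_type \<Gamma> t \<sigma> \<and> (\<forall>e\<in>env S \<Gamma>. eval S e t = F e)) \<and>
     (\<forall>e\<in>env S \<Gamma>. \<forall>e'\<in>env S \<Gamma>. tmaj \<Gamma> e e' \<longrightarrow> smaj S \<sigma> (F e) (F e'))"

definition mdefs :: "ty list \<Rightarrow> ty list \<Rightarrow> ('u list \<Rightarrow> 'u list) \<Rightarrow> bool" where
  "mdefs \<Gamma> \<Delta> F \<longleftrightarrow>
     (\<forall>e\<in>env S \<Gamma>. length (F e) = length \<Delta>) \<and> (\<forall>i<length \<Delta>. mdef \<Gamma> (\<Delta> ! i) (\<lambda>e. F e ! i))"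

lemma mdef_Dom: "mdef \<Gamma> \<sigma> F \<Longrightarrow> e \<in> env S \<Gamma> \<Longrightarrow> F e \<in> Dom S \<sigma>"
  unfolding mdef_def by (metis eval_Dom)

lemma mdef_smaj:
  "mdef \<Gamma> \<sigma> F \<Longrightarrow> e \<in> env S \<Gamma> \<Longrightarrow> e' \<in> env S \<Gamma> \<Longrightarrow> tmaj \<Gamma> e e' \<Longrightarrow> smaj S \<sigma> (F e) (F e')"
  unfolding mdef_def by blast

lemma mdef_Mon: "mdef \<Gamma> \<sigma> F \<Longrightarrow> e \<in> mon_tuples S \<Gamma> \<Longrightarrow> F e \<in> Mon S \<sigma>"
  using mdef_Dom mdef_smaj by (simp add: Mon_def mon_tuples_tmaj)

lemma mdefs_length: "mdefs \<Gamma> \<Delta> F \<Longrightarrow> e \<in> env S \<Gamma> \<Longrightarrow> length (F e) = length \<Delta>"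
  unfolding mdefs_def by blast

lemma mdefs_nth: "mdefs \<Gamma> \<Delta> F \<Longrightarrow> i < length \<Delta> \<Longrightarrow> mdef \<Gamma> (\<Delta> ! i) (\<lambda>e. F e ! i)"
  unfolding mdefs_def by blast

lemma mdefs_env: "mdefs \<Gamma> \<Delta> F \<Longrightarrow> e \<in> env S \<Gamma> \<Longrightarrow> F e \<in> env S \<Delta>"
  by (simp add: env_iff[of "F e"] mdefs_length mdef_Dom[OF mdefs_nth])

lemma mdefs_tmaj:
  "mdefs \<Gamma> \<Delta> F \<Longrightarrow> e \<in> env S \<Gamma> \<Longrightarrow> e' \<in> env S \<Gamma> \<Longrightarrow> tmaj \<Gamma> e e' \<Longrightarrow> tmaj \<Delta> (F e) (F e')"
  by (simp add: tmaj_def[of \<Delta>] mdef_smaj[OF mdefs_nth])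

lemma mdefs_mon: "mdefs \<Gamma> \<Delta> F \<Longrightarrow> e \<in> mon_tuples S \<Gamma> \<Longrightarrow> F e \<in> mon_tuples S \<Delta>"
  using mdefs_env mdefs_tmaj by (simp add: mon_tuples_tmaj)

text \<open>The closure lemmas produce raw applications of constants and variables. This replaces
  them by the intended function, which has to agree with them on assignments only.\<close>

lemma mdef_cong: "(\<And>e. e \<in> env S \<Gamma> \<Longrightarrow> F e = G e) \<Longrightarrow> mdef \<Gamma> \<sigma> F \<longleftrightarrow> mdef \<Gamma> \<sigma> G"
  unfolding mdef_def by simp

lemma mdefs_cong: "(\<And>e. e \<in> env S \<Gamma> \<Longrightarrow> F e = G e) \<Longrightarrow> mdefs \<Gamma> \<Delta> F \<longleftrightarrow> mdefs \<Gamma> \<Delta> G"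
proof -
  assume eq: "\<And>e. e \<in> env S \<Gamma> \<Longrightarrow> F e = G e"
  then have "mdef \<Gamma> (\<Delta> ! i) (\<lambda>e. F e ! i) \<longleftrightarrow> mdef \<Gamma> (\<Delta> ! i) (\<lambda>e. G e ! i)" for i
    by (intro mdef_cong) simp
  with eq show ?thesis
    unfolding mdefs_def by simp
qed

lemma mdef_var: "n < length \<Gamma> \<Longrightarrow> \<sigma> = \<Gamma> ! n \<Longrightarrow> mdef \<Gamma> \<sigma> (\<lambda>e. e ! n)"
  unfolding mdef_def by (auto intro!: exI[of _ "Var n"] has_type_Var simp: tmaj_def)

lemma mdef_app:
  assumes "mdef \<Gamma> (\<sigma> \<rightarrow> \<tau>) F" "mdef \<Gamma> \<sigma> G"
  shows "mdef \<Gamma> \<tau> (\<lambda>e. app S (F e) (G e))"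
proof -
  obtain s t where "has_type \<Gamma> s (\<sigma> \<rightarrow> \<tau>)" "\<forall>e\<in>env S \<Gamma>. eval S e s = F e"
    "has_type \<Gamma> t \<sigma>" "\<forall>e\<in>env S \<Gamma>. eval S e t = G e"
    using assms unfolding mdef_def by blast
  then have "has_type \<Gamma> (s \<bullet> t) \<tau>" "\<forall>e\<in>env S \<Gamma>. eval S e (s \<bullet> t) = app S (F e) (G e)"
    by (auto intro: has_type.intros)
  moreover have "smaj S \<tau> (app S (F e) (G e)) (app S (F e') (G e'))"
    if "e \<in> env S \<Gamma>" "e' \<in> env S \<Gamma>" "tmaj \<Gamma> e e'" for e e'
    using that assms by (intro smaj_appD mdef_smaj mdef_Dom)
  ultimately show ?thesis
    unfolding mdef_def by blast
qed

lemma mdef_const: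
  assumes "const_ok c" "\<sigma> = const_type c" "smaj S \<sigma> (const_val S c) (const_val S c)"
  shows "mdef \<Gamma> \<sigma> (\<lambda>e. const_val S c)"
  using assms unfolding mdef_def by (auto intro!: exI[of _ "Con c"] has_type_Con)

text \<open>Terms for the components of \<open>F\<close> are substituted into a term for
  \<open>G\<close>. With projections as \<open>F\<close>, this moves a definition into a longer
  context.\<close>

lemma mdef_comp:
  assumes F: "mdefs \<Gamma> \<Delta> F" and G: "mdef \<Delta> \<tau> G"
  shows "mdef \<Gamma> \<tau> (\<lambda>e. G (F e))"
proof -
  have "\<forall>i<length \<Delta>. \<exists>t. has_type \<Gamma> t (\<Delta> ! i) \<and> (\<forall>e\<in>env S \<Gamma>. eval S e t = F e ! i)"
    using F unfolding mdefs_def mdef_def by blast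
  then obtain s where s: "has_type \<Gamma> (s i) (\<Delta> ! i) \<and> (\<forall>e\<in>env S \<Gamma>. eval S e (s i) = F e ! i)"
    if "i < length \<Delta>" for i
    by metis
  obtain t where t: "has_type \<Delta> t \<tau>" "\<forall>e\<in>env S \<Delta>. eval S e t = G e"
    using G unfolding mdef_def by blast
  have "has_type \<Gamma> (subst_tm s t) \<tau>"
    using t s by (blast intro: has_type_subst_tm)
  moreover have "eval S e (subst_tm s t) = G (F e)" if "e \<in> env S \<Gamma>" for e
    using eval_subst_tm[OF t(1), of S e s "F e"] s t(2) that mdefs_env[OF F that] by auto
  moreover have "smaj S \<tau> (G (F e)) (G (F e'))"
    if "e \<in> env S \<Gamma>" "e' \<in> env S \<Gamma>" "tmaj \<Gamma> e e'" for e e'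
    using that F G by (blast intro: mdef_smaj mdefs_env mdefs_tmaj)
  ultimately show ?thesis
    unfolding mdef_def by blast
qed

lemma mdefs_comp: "mdefs \<Gamma> \<Delta> F \<Longrightarrow> mdefs \<Delta> \<tau>s G \<Longrightarrow> mdefs \<Gamma> \<tau>s (\<lambda>e. G (F e))"
  using mdefs_env mdef_comp[of \<Gamma> \<Delta> F] unfolding mdefs_def[of _ \<tau>s] by blast

lemma mdefs_Nil [simp]: "mdefs \<Gamma> [] F \<longleftrightarrow> (\<forall>e\<in>env S \<Gamma>. F e = [])"
  by (simp add: mdefs_def)

lemma mdefs_Cons: "mdef \<Gamma> \<sigma> F \<Longrightarrow> mdefs \<Gamma> \<Delta> G \<Longrightarrow> mdefs \<Gamma> (\<sigma> # \<Delta>) (\<lambda>e. F e # G e)"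
  by (auto simp: mdefs_def nth_Cons split: nat.splits)

lemma mdefs_append:
  assumes F: "mdefs \<Gamma> \<Delta> F" and G: "mdefs \<Gamma> \<Delta>' G"
  shows "mdefs \<Gamma> (\<Delta> @ \<Delta>') (\<lambda>e. F e @ G e)"
proof -
  have "mdef \<Gamma> ((\<Delta> @ \<Delta>') ! i) (\<lambda>e. (F e @ G e) ! i)" if i: "i < length \<Delta> + length \<Delta>'" for i
  proof (cases "i < length \<Delta>")
    case True
    then have "mdef \<Gamma> ((\<Delta> @ \<Delta>') ! i) (\<lambda>e. F e ! i)"
      using F by (simp add: mdefs_def nth_append)
    then show ?thesis
      by (rule mdef_cong[THEN iffD1, rotated]) (use F True in \<open>simp add: mdefs_def nth_append\<close>)
  next
    case False
    then have "mdef \<Gamma> ((\<Delta> @ \<Delta>') ! i) (\<lambda>e. G e ! (i - length \<Delta>))"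
      using G i by (simp add: mdefs_def nth_append)
    then show ?thesis
      by (rule mdef_cong[THEN iffD1, rotated]) (use F False in \<open>simp add: mdefs_def nth_append\<close>)
  qed
  then show ?thesis
    using F G by (simp add: mdefs_def)
qed

lemma mdefs_slice:
  assumes "\<Gamma> = \<Gamma>1 @ \<Delta> @ \<Gamma>2"
  shows "mdefs \<Gamma> \<Delta> (\<lambda>e. take (length \<Delta>) (drop (length \<Gamma>1) e))"
proof -
  have "mdef \<Gamma> (\<Delta> ! i) (\<lambda>e. take (length \<Delta>) (drop (length \<Gamma>1) e) ! i)" if "i < length \<Delta>" for i
  proof -
    have "mdef \<Gamma> (\<Delta> ! i) (\<lambda>e. e ! (length \<Gamma>1 + i))"
      using that assms by (intro mdef_var) (auto simp: nth_append)
    then show ?thesis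
      by (rule mdef_cong[THEN iffD1, rotated]) (use that assms in \<open>simp add: env_iff\<close>)
  qed
  then show ?thesis
    using assms by (simp add: mdefs_def env_iff)
qed

lemma mdefs_take: "mdefs (\<Gamma> @ \<Delta>) \<Gamma> (take (length \<Gamma>))"
  using mdefs_slice[of "\<Gamma> @ \<Delta>" "[]" \<Gamma> \<Delta>] by simp

lemma mdefs_drop: "mdefs (\<Gamma> @ \<Delta>) \<Delta> (drop (length \<Gamma>))"
  by (rule mdefs_cong[THEN iffD1, rotated, OF mdefs_slice[of "\<Gamma> @ \<Delta>" \<Gamma> \<Delta> "[]"]])
    (simp_all add: env_iff)

lemma mdefs_id: "mdefs \<Gamma> \<Gamma> (\<lambda>e. e)"
  by (simp add: mdefs_def mdef_var env_iff)

section \<open>Abstraction and application for definable functions\<close>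

text \<open>Bracket abstraction by recursion on the term: a leaf other than the abstracted variable
  gets a \<open>CPi\<close>, an application gets a \<open>CSigma\<close>.\<close>

lemma has_type_abs:
  assumes "has_type (\<Gamma> @ [\<sigma>]) t \<tau>"
  shows "\<exists>t'. has_type \<Gamma> t' (\<sigma> \<rightarrow> \<tau>) \<and>
    (\<forall>e\<in>env S \<Gamma>. \<forall>x\<in>Dom S \<sigma>. app S (eval S e t') x = eval S (e @ [x]) t)"
  using assms
proof (induction "\<Gamma> @ [\<sigma>]" t \<tau> rule: has_type.induct)
  case (1 n)
  show ?case
  proof (cases "n < length \<Gamma>")
    case True
    let ?t = "Con (CPi (\<Gamma> ! n) \<sigma>) \<bullet> Var n"
    have "has_type \<Gamma> ?t (\<sigma> \<rightarrow> \<Gamma> ! n)"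
      using True by (auto intro!: has_type.intros(3) has_type_Con has_type_Var)
    with True show ?thesis
      by (intro exI[of _ ?t]) (simp add: env_iff nth_append del: const_val.simps)
  next
    case False
    with 1 have n: "n = length \<Gamma>"
      by simp
    \<comment> \<open>The identity, as S K K. The dummy argument of the second K may have any type;
      here it is \<open>\<sigma>\<close>.\<close>
    let ?t = "Con (CSigma \<sigma> (\<sigma> \<rightarrow> \<sigma>) \<sigma>) \<bullet> Con (CPi \<sigma> (\<sigma> \<rightarrow> \<sigma>)) \<bullet> Con (CPi \<sigma> \<sigma>)"
    have "has_type \<Gamma> ?t (\<sigma> \<rightarrow> \<sigma>)"
      by (rule has_type.intros(3) has_type_Con | simp)+
    moreover have "app S (eval S e ?t) x = x" if "x \<in> Dom S \<sigma>" for e x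
      using that const_val_Dom[of "CPi \<sigma> (\<sigma> \<rightarrow> \<sigma>)"] const_val_Dom[of "CPi \<sigma> \<sigma>"] app_Dom
      by (simp del: const_val.simps)
    ultimately show ?thesis
      using n by (intro exI[of _ ?t]) (simp add: env_iff nth_append del: const_val.simps)
  qed
next
  case (2 c)
  let ?t = "Con (CPi (const_type c) \<sigma>) \<bullet> Con c"
  have "has_type \<Gamma> ?t (\<sigma> \<rightarrow> const_type c)"
    using 2 by (auto intro!: has_type.intros(3) has_type_Con)
  with 2 show ?case
    by (intro exI[of _ ?t]) (simp add: const_val_Dom del: const_val.simps)
next
  case (3 s \<rho> \<tau> t)
  then obtain s' t' where st: "has_type \<Gamma> s' (\<sigma> \<rightarrow> \<rho> \<rightarrow> \<tau>)" "has_type \<Gamma> t' (\<sigma> \<rightarrow> \<rho>)"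
    "\<forall>e\<in>env S \<Gamma>. \<forall>x\<in>Dom S \<sigma>. app S (eval S e s') x = eval S (e @ [x]) s"
    "\<forall>e\<in>env S \<Gamma>. \<forall>x\<in>Dom S \<sigma>. app S (eval S e t') x = eval S (e @ [x]) t"
    by auto
  let ?t = "Con (CSigma \<sigma> \<rho> \<tau>) \<bullet> s' \<bullet> t'"
  have "has_type \<Gamma> ?t (\<sigma> \<rightarrow> \<tau>)"
    using st(1,2) by (intro has_type.intros(3) has_type_Con) auto
  moreover have "app S (eval S e ?t) x = eval S (e @ [x]) (s \<bullet> t)"
    if "e \<in> env S \<Gamma>" "x \<in> Dom S \<sigma>" for e x
    using that st eval_Dom[OF st(1) that(1)] eval_Dom[OF st(2) that(1)]
    by (simp del: const_val.simps)
  ultimately show ?case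
    by blast
qed

lemma mdef_abs:
  assumes "mdef (\<Gamma> @ [\<sigma>]) \<tau> F"
  shows "mdef \<Gamma> (\<sigma> \<rightarrow> \<tau>) (\<lambda>e. mk_fun S \<sigma> \<tau> (\<lambda>x. F (e @ [x])))"
    and "e \<in> env S \<Gamma> \<Longrightarrow> x \<in> Dom S \<sigma> \<Longrightarrow> app S (mk_fun S \<sigma> \<tau> (\<lambda>x. F (e @ [x]))) x = F (e @ [x])"
proof -
  have F: "F (e @ [x]) \<in> Dom S \<tau>" if "e \<in> env S \<Gamma>" "x \<in> Dom S \<sigma>" for e x
    using that by (intro mdef_Dom[OF assms] env_append) auto
  have app: "app S (mk_fun S \<sigma> \<tau> (\<lambda>x. F (e @ [x]))) x = F (e @ [x])" if "e \<in> env S \<Gamma>" "x \<in> Dom S \<sigma>" for e x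
    using that F by (intro app_mk_fun) auto
  then show "e \<in> env S \<Gamma> \<Longrightarrow> x \<in> Dom S \<sigma> \<Longrightarrow> app S (mk_fun S \<sigma> \<tau> (\<lambda>x. F (e @ [x]))) x = F (e @ [x])" .
  obtain t where t: "has_type (\<Gamma> @ [\<sigma>]) t \<tau>" "\<forall>e\<in>env S (\<Gamma> @ [\<sigma>]). eval S e t = F e"
    using assms unfolding mdef_def by blast
  obtain t' where t': "has_type \<Gamma> t' (\<sigma> \<rightarrow> \<tau>)"
    "\<forall>e\<in>env S \<Gamma>. \<forall>x\<in>Dom S \<sigma>. app S (eval S e t') x = eval S (e @ [x]) t"
    using has_type_abs[OF t(1)] by blast
  have "eval S e t' = mk_fun S \<sigma> \<tau> (\<lambda>x. F (e @ [x]))" if e: "e \<in> env S \<Gamma>" for e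
  proof (rule Dom_fun_eqI)
    show "eval S e t' \<in> Dom S (\<sigma> \<rightarrow> \<tau>)"
      using t'(1) e by (rule eval_Dom)
    show "mk_fun S \<sigma> \<tau> (\<lambda>x. F (e @ [x])) \<in> Dom S (\<sigma> \<rightarrow> \<tau>)"
      using F e by (intro mk_fun_Dom) auto
    show "app S (eval S e t') x = app S (mk_fun S \<sigma> \<tau> (\<lambda>x. F (e @ [x]))) x" if "x \<in> Dom S \<sigma>" for x
      using that e t'(2) t(2) app by (simp add: env_append)
  qed
  \<comment> \<open>\<open>smaj\<close> of two functions also demands that the second one be
    monotone. That half is the instance with \<open>e'\<close> on both sides, where
    \<open>tmaj \<Gamma> e' e'\<close> holds because \<open>e'\<close> is a right-hand side.\<close>
  moreover have "smaj S (\<sigma> \<rightarrow> \<tau>) (mk_fun S \<sigma> \<tau> (\<lambda>x. F (e @ [x]))) (mk_fun S \<sigma> \<tau> (\<lambda>x. F (e' @ [x])))"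
    if e: "e \<in> env S \<Gamma>" "e' \<in> env S \<Gamma>" "tmaj \<Gamma> e e'" for e e'
    using e tmaj_refl_right[OF e(3)]
    by (auto simp: app tmaj_append env_length env_append intro!: mdef_smaj[OF assms])
  ultimately show "mdef \<Gamma> (\<sigma> \<rightarrow> \<tau>) (\<lambda>e. mk_fun S \<sigma> \<tau> (\<lambda>x. F (e @ [x])))"
    unfolding mdef_def using t'(1) by blast
qed

lemma mdef_abs_list:
  assumes "mdef (\<Gamma> @ \<Delta>) \<tau> F"
  shows "\<exists>G. mdef \<Gamma> (arrs \<Delta> \<tau>) G \<and> (\<forall>e\<in>env S \<Gamma>. \<forall>xs\<in>env S \<Delta>. app_list S (G e) xs = F (e @ xs))"
  using assms
proof (induction \<Delta> arbitrary: \<Gamma>)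
  case Nil
  then show ?case by auto
next
  case (Cons \<sigma> \<Delta>)
  then obtain G where G: "mdef (\<Gamma> @ [\<sigma>]) (arrs \<Delta> \<tau>) G"
    "\<forall>e\<in>env S (\<Gamma> @ [\<sigma>]). \<forall>xs\<in>env S \<Delta>. app_list S (G e) xs = F (e @ xs)"
    by (metis append.assoc append_Cons append_Nil)
  have "app_list S (mk_fun S \<sigma> (arrs \<Delta> \<tau>) (\<lambda>x. G (e @ [x]))) xs = F (e @ xs)"
    if e: "e \<in> env S \<Gamma>" and xs: "xs \<in> env S (\<sigma> # \<Delta>)" for e xs
  proof -
    obtain y ys where ys: "xs = y # ys" "y \<in> Dom S \<sigma>" "ys \<in> env S \<Delta>"
      using xs by (auto simp: env_Cons)
    have "e @ [y] \<in> env S (\<Gamma> @ [\<sigma>])"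
      using e ys(2) by (intro env_append) auto
    with G(2) ys(3) have "app_list S (G (e @ [y])) ys = F ((e @ [y]) @ ys)"
      by blast
    then show ?thesis
      using mdef_abs(2)[OF G(1) e ys(2)] ys(1) by simp
  qed
  with mdef_abs(1)[OF G(1)] show ?case
    by (intro exI[of _ "\<lambda>e. mk_fun S \<sigma> (arrs \<Delta> \<tau>) (\<lambda>x. G (e @ [x]))"]) simp
qed

lemma mdefs_abs_list:
  assumes "mdefs (\<Gamma> @ \<Delta>) \<tau>s F"
  shows "\<exists>G. mdefs \<Gamma> (map (arrs \<Delta>) \<tau>s) G \<and>
    (\<forall>e\<in>env S \<Gamma>. \<forall>xs\<in>env S \<Delta>. map (\<lambda>g. app_list S g xs) (G e) = F (e @ xs))"
proof -
  have "\<forall>i<length \<tau>s. \<exists>G. mdef \<Gamma> (arrs \<Delta> (\<tau>s ! i)) G \<and>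
    (\<forall>e\<in>env S \<Gamma>. \<forall>xs\<in>env S \<Delta>. app_list S (G e) xs = F (e @ xs) ! i)"
    using assms by (intro allI impI mdef_abs_list) (simp add: mdefs_def)
  then obtain H where H: "mdef \<Gamma> (arrs \<Delta> (\<tau>s ! i)) (H i)"
    "\<forall>e\<in>env S \<Gamma>. \<forall>xs\<in>env S \<Delta>. app_list S (H i e) xs = F (e @ xs) ! i" if "i < length \<tau>s" for i
    by metis
  let ?G = "\<lambda>e. map (\<lambda>i. H i e) [0..<length \<tau>s]"
  have "mdefs \<Gamma> (map (arrs \<Delta>) \<tau>s) ?G"
    using H(1) by (simp add: mdefs_def)
  moreover have "map (\<lambda>g. app_list S g xs) (?G e) = F (e @ xs)"
    if "e \<in> env S \<Gamma>" "xs \<in> env S \<Delta>" for e xs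
    using that H(2) mdefs_length[OF assms env_append[OF that]] by (intro nth_equalityI) auto
  ultimately show ?thesis
    by blast
qed

lemma mdefs_hd_tl:
  assumes "mdefs \<Gamma> (\<sigma> # \<Delta>) F"
  shows "mdef \<Gamma> \<sigma> (\<lambda>e. hd (F e))" "mdefs \<Gamma> \<Delta> (\<lambda>e. tl (F e))"
    "e \<in> env S \<Gamma> \<Longrightarrow> F e = hd (F e) # tl (F e)"
proof -
  have ne: "F e \<noteq> []" if "e \<in> env S \<Gamma>" for e
    using mdefs_length[OF assms that] by auto
  have "mdef (\<sigma> # \<Delta>) \<sigma> (\<lambda>e. e ! 0)" "mdefs (\<sigma> # \<Delta>) \<Delta> (drop 1)"
    using mdef_var[of 0 "\<sigma> # \<Delta>"] mdefs_drop[of "[\<sigma>]" \<Delta>] by simp_all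
  with assms have *: "mdef \<Gamma> \<sigma> (\<lambda>e. F e ! 0)" "mdefs \<Gamma> \<Delta> (\<lambda>e. drop 1 (F e))"
    by (auto intro: mdef_comp mdefs_comp)
  show "mdef \<Gamma> \<sigma> (\<lambda>e. hd (F e))"
    by (rule mdef_cong[THEN iffD1, rotated, OF *(1)]) (simp add: ne hd_conv_nth)
  show "mdefs \<Gamma> \<Delta> (\<lambda>e. tl (F e))"
    using *(2) by (simp add: drop_Suc)
  show "e \<in> env S \<Gamma> \<Longrightarrow> F e = hd (F e) # tl (F e)"
    using ne by simp
qed

lemma mdef_app_list:
  "mdef \<Gamma> (arrs \<Delta> \<tau>) F \<Longrightarrow> mdefs \<Gamma> \<Delta> A \<Longrightarrow> mdef \<Gamma> \<tau> (\<lambda>e. app_list S (F e) (A e))"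
proof (induction \<Delta> arbitrary: F A)
  case Nil
  then show ?case
    by (subst mdef_cong[of _ _ F]) auto
next
  case (Cons \<sigma> \<Delta>)
  note A = mdefs_hd_tl[OF Cons.prems(2)]
  have "mdef \<Gamma> \<tau> (\<lambda>e. app_list S (app S (F e) (hd (A e))) (tl (A e)))"
    using Cons.prems(1) A(1,2) by (intro Cons.IH mdef_app) auto
  then show ?case
    by (rule mdef_cong[THEN iffD1, rotated]) (metis A(3) app_list_simps(2))
qed

lemma mdefs_app_list:
  assumes F: "mdefs \<Gamma> (map (arrs \<Delta>) \<tau>s) F" and A: "mdefs \<Gamma> \<Delta> A"
  shows "mdefs \<Gamma> \<tau>s (\<lambda>e. map (\<lambda>f. app_list S f (A e)) (F e))"
proof -
  have "mdef \<Gamma> (\<tau>s ! i) (\<lambda>e. map (\<lambda>f. app_list S f (A e)) (F e) ! i)" if i: "i < length \<tau>s" for i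
  proof -
    have "mdef \<Gamma> (\<tau>s ! i) (\<lambda>e. app_list S (F e ! i) (A e))"
      using F A i by (intro mdef_app_list[of _ \<Delta>]) (auto simp: mdefs_def)
    then show ?thesis
      by (rule mdef_cong[THEN iffD1, rotated]) (use F i in \<open>simp add: mdefs_def\<close>)
  qed
  then show ?thesis
    using F by (simp add: mdefs_def)
qed

lemma mdefs_terms:
  assumes "mdefs \<Gamma> \<Delta> F"
  shows "\<exists>ts. list_all2 (has_type \<Gamma>) ts \<Delta> \<and> (\<forall>e\<in>env S \<Gamma>. map (eval S e) ts = F e)"
proof -
  have "\<forall>i<length \<Delta>. \<exists>t. has_type \<Gamma> t (\<Delta> ! i) \<and> (\<forall>e\<in>env S \<Gamma>. eval S e t = F e ! i)"
    using mdefs_nth[OF assms] unfolding mdef_def by blast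
  then obtain s where s: "has_type \<Gamma> (s i) (\<Delta> ! i)" "\<forall>e\<in>env S \<Gamma>. eval S e (s i) = F e ! i"
    if "i < length \<Delta>" for i
    by metis
  have "list_all2 (has_type \<Gamma>) (map s [0..<length \<Delta>]) \<Delta>"
    using s(1) by (simp add: list_all2_conv_all_nth)
  moreover have "map (eval S e) (map s [0..<length \<Delta>]) = F e" if "e \<in> env S \<Gamma>" for e
    using s(2) that mdefs_length[OF assms that] by (intro nth_equalityI) auto
  ultimately show ?thesis
    by blast
qed

end

section \<open>Joins and monotone recursion\<close>

text \<open>Defined on carriers; a term for it is found in \<open>mdef_join\<close>. The clause for
  \<open>B\<close> is a default, as \<open>B\<close> is not an arithmetical type.\<close>

fun join :: "'u type_structure \<Rightarrow> ty \<Rightarrow> 'u \<Rightarrow> 'u \<Rightarrow> 'u" where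
  "join S N a b = num S (max (nat_of S a) (nat_of S b))"
| "join S B a b = a"
| "join S (\<sigma> \<rightarrow> \<tau>) f g = mk_fun S \<sigma> \<tau> (\<lambda>x. join S \<tau> (app S f x) (app S g x))"
| "join S (Star \<sigma>) a b = mk_set S \<sigma> (elems S a \<union> elems S b)"

definition joins :: "'u type_structure \<Rightarrow> ty list \<Rightarrow> 'u list \<Rightarrow> 'u list \<Rightarrow> 'u list" where
  "joins S \<sigma>s as bs = map (\<lambda>i. join S (\<sigma>s ! i) (as ! i) (bs ! i)) [0..<length \<sigma>s]"

text \<open>Taking joins makes the recursion monotone in the number of steps.\<close>

fun jrec :: "'u type_structure \<Rightarrow> ty list \<Rightarrow> nat \<Rightarrow> 'u list \<Rightarrow> ('u list \<Rightarrow> 'u list) \<Rightarrow> 'u list" where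
  "jrec S \<sigma>s 0 w f = w"
| "jrec S \<sigma>s (Suc n) w f = joins S \<sigma>s (jrec S \<sigma>s n w f) (f (jrec S \<sigma>s n w f))"

lemma length_joins [simp]: "length (joins S \<sigma>s as bs) = length \<sigma>s"
  by (simp add: joins_def)

lemma joins_nth [simp]: "i < length \<sigma>s \<Longrightarrow> joins S \<sigma>s as bs ! i = join S (\<sigma>s ! i) (as ! i) (bs ! i)"
  by (simp add: joins_def)

lemma joins_Cons: "joins S (\<sigma> # \<sigma>s) (a # as) (b # bs) = join S \<sigma> a b # joins S \<sigma>s as bs"
  by (rule nth_equalityI) (auto simp: nth_Cons split: nat.splits)

lemma joins_append:
  "length as = length \<sigma>s \<Longrightarrow> length bs = length \<sigma>s \<Longrightarrow>
    joins S (\<sigma>s @ \<tau>s) (as @ as') (bs @ bs') = joins S \<sigma>s as bs @ joins S \<tau>s as' bs'"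
  by (rule nth_equalityI) (auto simp: nth_append)

context star_structure
begin

section \<open>Set operations as monotone terms\<close>

lemma mdef_Single:
  assumes "mdef \<Gamma> \<sigma> F"
  shows "mdef \<Gamma> (Star \<sigma>) (\<lambda>e. mk_set S \<sigma> {F e})"
proof -
  have "smaj S (\<sigma> \<rightarrow> Star \<sigma>) (const_val S (Single \<sigma>)) (const_val S (Single \<sigma>))"
    by (auto simp: Single_app elems_mk_set smaj_refl_right simp del: const_val.simps)
  then have "mdef \<Gamma> (Star \<sigma>) (\<lambda>e. app S (const_val S (Single \<sigma>)) (F e))"
    by (intro mdef_app[of _ \<sigma>, OF mdef_const] assms) (simp_all del: smaj.simps const_val.simps)
  then show ?thesis
    by (rule mdef_cong[THEN iffD1, rotated]) (rule Single_app[OF mdef_Dom[OF assms]])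
qed

lemma elems_union:
  "a \<in> Dom S (Star \<sigma>) \<Longrightarrow> b \<in> Dom S (Star \<sigma>) \<Longrightarrow>
    elems S (mk_set S \<sigma> (elems S a \<union> elems S b)) = elems S a \<union> elems S b"
  by (intro elems_mk_set) (simp_all add: elems_subset finite_elems elems_nonempty)

lemma mdef_union:
  assumes "mdef \<Gamma> (Star \<sigma>) F" "mdef \<Gamma> (Star \<sigma>) G"
  shows "mdef \<Gamma> (Star \<sigma>) (\<lambda>e. mk_set S \<sigma> (elems S (F e) \<union> elems S (G e)))"
proof -
  have app: "app S (const_val S (CUnion \<sigma>)) a \<in> Dom S (Star \<sigma> \<rightarrow> Star \<sigma>)" if "a \<in> Dom S (Star \<sigma>)" for a
    using const_val_Dom[of "CUnion \<sigma>"] that by (intro app_Dom) (auto simp del: const_val.simps)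
  have "smaj S (Star \<sigma> \<rightarrow> Star \<sigma> \<rightarrow> Star \<sigma>) (const_val S (CUnion \<sigma>)) (const_val S (CUnion \<sigma>))"
    unfolding smaj.simps(3)
    by (auto simp: CUnion_app elems_union simp del: const_val.simps)
  then have "mdef \<Gamma> (Star \<sigma>) (\<lambda>e. app S (app S (const_val S (CUnion \<sigma>)) (F e)) (G e))"
    by (intro mdef_app[of _ "Star \<sigma>", OF mdef_app[of _ "Star \<sigma>", OF mdef_const]] assms)
      (simp_all del: smaj.simps const_val.simps)
  then show ?thesis
    by (rule mdef_cong[THEN iffD1, rotated])
      (rule CUnion_app[OF mdef_Dom[OF assms(1)] mdef_Dom[OF assms(2)]])
qed

text \<open>Let \<open>x\<close> lie in the set \<open>app S f u\<close> with \<open>u\<close> in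
  \<open>a\<close>. Some \<open>v\<close> in \<open>b\<close> majorizes \<open>u\<close>, hence
  \<open>app S g v\<close> majorizes \<open>app S f u\<close> and contains a majorant of
  \<open>x\<close>; it is one of the sets in the second union.\<close>

lemma smaj_CIUnion:
  "smaj S (Star \<sigma> \<rightarrow> (\<sigma> \<rightarrow> Star \<tau>) \<rightarrow> Star \<tau>) (const_val S (CIUnion \<sigma> \<tau>)) (const_val S (CIUnion \<sigma> \<tau>))"
proof -
  have *: "smaj S (Star \<tau>) (app S (app S (const_val S (CIUnion \<sigma> \<tau>)) a) f)
      (app S (app S (const_val S (CIUnion \<sigma> \<tau>)) b) g)"
    if Dom: "a \<in> Dom S (Star \<sigma>)" "b \<in> Dom S (Star \<sigma>)" "f \<in> Dom S (\<sigma> \<rightarrow> Star \<tau>)" "g \<in> Dom S (\<sigma> \<rightarrow> Star \<tau>)"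
      and le: "smaj S (Star \<sigma>) a b" "smaj S (\<sigma> \<rightarrow> Star \<tau>) f g" for a b f g
  proof -
    have ab: "\<forall>u\<in>elems S a. \<exists>v\<in>elems S b. smaj S \<sigma> u v" "\<forall>v\<in>elems S b. smaj S \<sigma> v v"
      using le(1) by simp_all
    have fg: "smaj S (Star \<tau>) (app S f u) (app S g v)" if "u \<in> elems S a" "v \<in> elems S b" "smaj S \<sigma> u v" for u v
      using that elems_subset Dom le(2) by (intro smaj_appD[of \<sigma>]) auto
    have gg: "smaj S (Star \<tau>) (app S g v) (app S g v)" if "v \<in> elems S b" for v
      using that elems_subset Dom ab(2) smaj_refl_right[OF le(2)] by (intro smaj_appD[of \<sigma>]) auto
    have "\<exists>y\<in>\<Union>v\<in>elems S b. elems S (app S g v). smaj S \<tau> x y"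
      if "u \<in> elems S a" "x \<in> elems S (app S f u)" for u x
    proof -
      obtain v where v: "v \<in> elems S b" "smaj S \<sigma> u v"
        using ab(1) \<open>u \<in> elems S a\<close> by blast
      with fg[OF that(1) v] that(2) have "\<exists>y\<in>elems S (app S g v). smaj S \<tau> x y"
        by simp
      with v(1) show ?thesis
        by blast
    qed
    moreover have "smaj S \<tau> y y" if "v \<in> elems S b" "y \<in> elems S (app S g v)" for v y
      using gg[OF that(1)] that(2) by simp
    ultimately show ?thesis
      using Dom by (simp add: CIUnion_app elems_Union del: const_val.simps)
  qed
  show ?thesis
    unfolding smaj.simps(3)[of S "Star \<sigma>"] smaj.simps(3)[of S "\<sigma> \<rightarrow> Star \<tau>"]
    by (intro ballI impI conjI *) (auto dest: smaj_refl_right simp del: smaj.simps)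
qed

lemma mdef_Union:
  assumes "mdef \<Gamma> (Star \<sigma>) F" "mdef \<Gamma> (\<sigma> \<rightarrow> Star \<tau>) G"
  shows "mdef \<Gamma> (Star \<tau>) (\<lambda>e. mk_set S \<tau> (\<Union>w\<in>elems S (F e). elems S (app S (G e) w)))"
proof -
  have "mdef \<Gamma> (Star \<tau>) (\<lambda>e. app S (app S (const_val S (CIUnion \<sigma> \<tau>)) (F e)) (G e))"
    using smaj_CIUnion[of \<sigma> \<tau>]
    by (intro mdef_app[of _ "\<sigma> \<rightarrow> Star \<tau>", OF mdef_app[of _ "Star \<sigma>", OF mdef_const]] assms)
      (simp_all del: smaj.simps const_val.simps)
  then show ?thesis
    by (rule mdef_cong[THEN iffD1, rotated])
      (rule CIUnion_app[OF mdef_Dom[OF assms(1)] mdef_Dom[OF assms(2)]])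
qed

text \<open>The box of a tuple of sets is swept by nested indexed unions, one for each component.
  The variable chosen by an outer union is appended to the context of the inner ones.\<close>

lemma mdef_Union_tuples:
  assumes "mdefs \<Gamma> (map Star \<Delta>) A" "mdef (\<Gamma> @ \<Delta>) (Star \<tau>) F"
  shows "\<exists>G. mdef \<Gamma> (Star \<tau>) G \<and>
    (\<forall>e\<in>env S \<Gamma>. elems S (G e) = (\<Union>b\<in>listset (map (elems S) (A e)). elems S (F (e @ b))))"
  using assms
proof (induction \<Delta> arbitrary: \<Gamma> A)
  case Nil
  then show ?case
    by (intro exI[of _ F]) auto
next
  case (Cons \<sigma> \<Delta>)
  have "mdefs \<Gamma> (Star \<sigma> # map Star \<Delta>) A"
    using Cons.prems(1) by simp
  note A = mdefs_hd_tl[OF this]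
  have "mdefs (\<Gamma> @ [\<sigma>]) (map Star \<Delta>) (\<lambda>e. tl (A (take (length \<Gamma>) e)))"
    by (rule mdefs_comp[OF mdefs_take A(2)])
  moreover have "mdef ((\<Gamma> @ [\<sigma>]) @ \<Delta>) (Star \<tau>) F"
    using Cons.prems(2) by simp
  ultimately obtain G where G: "mdef (\<Gamma> @ [\<sigma>]) (Star \<tau>) G"
    "\<forall>e\<in>env S (\<Gamma> @ [\<sigma>]). elems S (G e) =
      (\<Union>b\<in>listset (map (elems S) (tl (A (take (length \<Gamma>) e)))). elems S (F (e @ b)))"
    using Cons.IH by metis
  let ?f = "\<lambda>e. mk_fun S \<sigma> (Star \<tau>) (\<lambda>x. G (e @ [x]))"
  let ?G = "\<lambda>e. mk_set S \<tau> (\<Union>w\<in>elems S (hd (A e)). elems S (app S (?f e) w))"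
  have "elems S (?G e) = (\<Union>b\<in>listset (map (elems S) (A e)). elems S (F (e @ b)))" if e: "e \<in> env S \<Gamma>" for e
  proof -
    have "elems S (app S (?f e) w) = (\<Union>b\<in>listset (map (elems S) (tl (A e))). elems S (F (e @ w # b)))"
      if "w \<in> elems S (hd (A e))" for w
    proof -
      have "w \<in> Dom S \<sigma>"
        using that elems_subset[OF mdef_Dom[OF A(1) e]] by blast
      moreover from this e have "e @ [w] \<in> env S (\<Gamma> @ [\<sigma>])"
        by (intro env_append) auto
      ultimately show ?thesis
        using G e by (simp add: mdef_abs(2)[OF G(1)] env_length)
    qed
    moreover have "map (elems S) (A e) = elems S (hd (A e)) # map (elems S) (tl (A e))"
      by (metis A(3)[OF e] list.simps(9))
    moreover have "elems S (?G e) = (\<Union>w\<in>elems S (hd (A e)). elems S (app S (?f e) w))"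
      by (rule elems_Union[OF mdef_Dom[OF A(1) e] mdef_Dom[OF mdef_abs(1)[OF G(1)] e]])
    ultimately show ?thesis
      by (auto simp: set_Cons_def)
  qed
  with mdef_Union[OF A(1) mdef_abs(1)[OF G(1)]] show ?case
    by (intro exI[of _ ?G]) simp
qed

section \<open>Properties of joins\<close>

lemma join_Dom: "a \<in> Dom S \<sigma> \<Longrightarrow> b \<in> Dom S \<sigma> \<Longrightarrow> join S \<sigma> a b \<in> Dom S \<sigma>"
proof (induction \<sigma> arbitrary: a b)
  case (Fun \<sigma> \<tau>)
  then show ?case
    using app_Dom[of a \<sigma> \<tau>] app_Dom[of b \<sigma> \<tau>] by (simp add: mk_fun_Dom)
qed (simp_all add: union_Dom)

lemma app_join:
  assumes "f \<in> Dom S (\<sigma> \<rightarrow> \<tau>)" "g \<in> Dom S (\<sigma> \<rightarrow> \<tau>)" "x \<in> Dom S \<sigma>"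
  shows "app S (join S (\<sigma> \<rightarrow> \<tau>) f g) x = join S \<tau> (app S f x) (app S g x)"
  using app_Dom[OF assms(1)] app_Dom[OF assms(2)] assms(3) by (simp add: app_mk_fun join_Dom)

lemma app_list_join:
  assumes "f \<in> Dom S (arrs \<Delta> \<tau>)" "g \<in> Dom S (arrs \<Delta> \<tau>)" "xs \<in> env S \<Delta>"
  shows "app_list S (join S (arrs \<Delta> \<tau>) f g) xs = join S \<tau> (app_list S f xs) (app_list S g xs)"
  using assms
proof (induction \<Delta> arbitrary: f g xs)
  case (Cons \<sigma> \<Delta>)
  from Cons.prems(3) obtain y ys where xs: "xs = y # ys" "y \<in> Dom S \<sigma>" "ys \<in> env S \<Delta>"
    by (auto simp: env_Cons)
  have "app S f y \<in> Dom S (arrs \<Delta> \<tau>)" "app S g y \<in> Dom S (arrs \<Delta> \<tau>)"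
    using Cons.prems xs(2) by (auto intro: app_Dom[of _ \<sigma>])
  with Cons.prems xs show ?case
    by (simp add: app_join Cons.IH del: join.simps)
qed simp

lemma smaj_Maxi: "smaj S (Star N \<rightarrow> N) (const_val S Maxi) (const_val S Maxi)"
proof -
  have "Max (nat_of S ` elems S a) \<le> Max (nat_of S ` elems S b)"
    if "a \<in> Dom S (Star N)" "b \<in> Dom S (Star N)" "smaj S (Star N) a b" for a b
    using that by (subst Max_le_iff) (auto simp: finite_elems elems_nonempty Max_ge_iff)
  then show ?thesis
    by (simp add: Maxi_app del: const_val.simps)
qed

lemma mdef_join:
  "arith_star_type \<sigma> \<Longrightarrow> mdef \<Gamma> \<sigma> F \<Longrightarrow> mdef \<Gamma> \<sigma> G \<Longrightarrow> mdef \<Gamma> \<sigma> (\<lambda>e. join S \<sigma> (F e) (G e))"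
proof (induction \<sigma> arbitrary: \<Gamma> F G)
  case N
  let ?set = "\<lambda>F e. mk_set S N {F e}"
  \<comment> \<open>The binary maximum is obtained from \<open>Maxi\<close>, as the maximum of a
    union of two singletons.\<close>
  have "mdef \<Gamma> N (\<lambda>e. app S (const_val S Maxi) (mk_set S N (elems S (?set F e) \<union> elems S (?set G e))))"
    using N smaj_Maxi by (intro mdef_app[of _ "Star N", OF mdef_const] mdef_union mdef_Single) (simp_all del: smaj.simps const_val.simps)
  then show ?case
  proof (rule mdef_cong[THEN iffD1, rotated])
    fix e assume e: "e \<in> env S \<Gamma>"
    have "F e \<in> Dom S N" "G e \<in> Dom S N"
      using N e by (blast intro: mdef_Dom)+
    moreover from this have "mk_set S N {F e, G e} \<in> Dom S (Star N)"
      by (intro mk_set_Dom) auto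
    ultimately show "app S (const_val S Maxi) (mk_set S N (elems S (?set F e) \<union> elems S (?set G e))) = join S N (F e) (G e)"
      by (simp add: Maxi_app elems_mk_set insert_commute max.commute del: const_val.simps)
  qed
next
  case (Fun \<sigma> \<tau>)
  \<comment> \<open>Both functions are applied to a fresh last variable; the join of the two values
    is then abstracted again.\<close>
  let ?F = "\<lambda>F e. app S (F (take (length \<Gamma>) e)) (e ! length \<Gamma>)"
  have "mdef (\<Gamma> @ [\<sigma>]) \<tau> (\<lambda>e. join S \<tau> (?F F e) (?F G e))"
    using Fun.prems
    by (intro Fun.IH(2) mdef_app[of _ \<sigma>] mdef_comp[OF mdefs_take] mdef_var) auto
  note mdef_abs(1)[OF this]
  then show ?case
    by (rule mdef_cong[THEN iffD1, rotated]) (simp add: env_iff nth_append)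
next
  case (Star \<sigma>)
  then show ?case
    by (simp add: mdef_union)
qed auto

text \<open>Monotonicity comes with definability: it is read off from \<open>mdef\<close> for the
  join of two variables.\<close>

lemma smaj_join:
  assumes "arith_star_type \<sigma>" "a \<in> Dom S \<sigma>" "a' \<in> Dom S \<sigma>" "b \<in> Dom S \<sigma>" "b' \<in> Dom S \<sigma>"
    "smaj S \<sigma> a a'" "smaj S \<sigma> b b'"
  shows "smaj S \<sigma> (join S \<sigma> a b) (join S \<sigma> a' b')"
proof -
  have "mdef [\<sigma>, \<sigma>] \<sigma> (\<lambda>e. join S \<sigma> (e ! 0) (e ! 1))"
    using assms(1) by (intro mdef_join mdef_var) auto
  from mdef_smaj[OF this, of "[a, b]" "[a', b']"] assms show ?thesis
    by simp
qed

text \<open>At function types \<open>a x\<close> lies below \<open>a y\<close> because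
  \<open>a\<close> is monotone, and \<open>a y\<close> lies below the join at \<open>y\<close> by
  the induction hypothesis. At set types each element reappears in the union and majorizes itself.
  Both arguments use that \<open>a\<close> and \<open>b\<close> are monotone.\<close>

lemma join_upper:
  "arith_star_type \<sigma> \<Longrightarrow> a \<in> Mon S \<sigma> \<Longrightarrow> b \<in> Mon S \<sigma> \<Longrightarrow>
    smaj S \<sigma> a (join S \<sigma> a b) \<and> smaj S \<sigma> b (join S \<sigma> a b)"
proof (induction \<sigma> arbitrary: a b)
  case (Fun \<sigma> \<tau>)
  have ab: "a \<in> Dom S (\<sigma> \<rightarrow> \<tau>)" "b \<in> Dom S (\<sigma> \<rightarrow> \<tau>)" "smaj S (\<sigma> \<rightarrow> \<tau>) a a" "smaj S (\<sigma> \<rightarrow> \<tau>) b b"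
    using Fun.prems by (simp_all add: Mon_def)
  from smaj_join[OF Fun.prems(1) ab(1) ab(1) ab(2) ab(2) ab(3,4)]
  have j: "smaj S (\<sigma> \<rightarrow> \<tau>) (join S (\<sigma> \<rightarrow> \<tau>) a b) (join S (\<sigma> \<rightarrow> \<tau>) a b)" .
  have *: "smaj S \<tau> (app S a x) (app S (join S (\<sigma> \<rightarrow> \<tau>) a b) y) \<and>
      smaj S \<tau> (app S b x) (app S (join S (\<sigma> \<rightarrow> \<tau>) a b) y)"
    if xy: "x \<in> Dom S \<sigma>" "y \<in> Dom S \<sigma>" "smaj S \<sigma> x y" for x y
  proof -
    have "app S a y \<in> Mon S \<tau>" "app S b y \<in> Mon S \<tau>"
      using xy ab smaj_refl_right[OF xy(3)] by (auto simp: Mon_def intro: app_Dom)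
    with Fun.IH(2) Fun.prems(1)
    have "smaj S \<tau> (app S a y) (join S \<tau> (app S a y) (app S b y))"
      "smaj S \<tau> (app S b y) (join S \<tau> (app S a y) (app S b y))"
      by auto
    moreover have "smaj S \<tau> (app S a x) (app S a y)" "smaj S \<tau> (app S b x) (app S b y)"
      using xy ab by auto
    ultimately show ?thesis
      using xy(2) ab by (simp add: app_join del: join.simps) (meson smaj_trans)
  qed
  from * j show ?case
    by (simp del: join.simps)
next
  case (Star \<sigma>)
  then show ?case
    by (auto simp: Mon_def elems_union)
qed (auto simp: Mon_def)

lemma join_Mon:
  "arith_star_type \<sigma> \<Longrightarrow> a \<in> Mon S \<sigma> \<Longrightarrow> b \<in> Mon S \<sigma> \<Longrightarrow> join S \<sigma> a b \<in> Mon S \<sigma>"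
  by (simp add: Mon_def join_Dom smaj_join)

lemma joins_mon:
  "list_all arith_star_type \<sigma>s \<Longrightarrow> as \<in> mon_tuples S \<sigma>s \<Longrightarrow> bs \<in> mon_tuples S \<sigma>s \<Longrightarrow>
    joins S \<sigma>s as bs \<in> mon_tuples S \<sigma>s"
  by (simp add: mon_tuples_iff list_all_length join_Mon)

lemma joins_upper:
  "list_all arith_star_type \<sigma>s \<Longrightarrow> as \<in> mon_tuples S \<sigma>s \<Longrightarrow> bs \<in> mon_tuples S \<sigma>s \<Longrightarrow>
    tmaj \<sigma>s as (joins S \<sigma>s as bs) \<and> tmaj \<sigma>s bs (joins S \<sigma>s as bs)"
  by (simp add: mon_tuples_iff list_all_length tmaj_def join_upper)

lemma mdefs_joins:
  assumes "list_all arith_star_type \<sigma>s" "mdefs \<Gamma> \<sigma>s F" "mdefs \<Gamma> \<sigma>s G"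
  shows "mdefs \<Gamma> \<sigma>s (\<lambda>e. joins S \<sigma>s (F e) (G e))"
  using assms by (auto simp: mdefs_def list_all_length intro: mdef_join)

section \<open>Recursion with joins\<close>

lemma jrec_mon:
  assumes "list_all arith_star_type \<sigma>s" "w \<in> mon_tuples S \<sigma>s"
    and "\<And>v. v \<in> mon_tuples S \<sigma>s \<Longrightarrow> f v \<in> mon_tuples S \<sigma>s"
  shows "jrec S \<sigma>s n w f \<in> mon_tuples S \<sigma>s"
  using assms by (induction n) (simp_all add: joins_mon)

lemma jrec_increasing:
  assumes "list_all arith_star_type \<sigma>s" "w \<in> mon_tuples S \<sigma>s"
    and "\<And>v. v \<in> mon_tuples S \<sigma>s \<Longrightarrow> f v \<in> mon_tuples S \<sigma>s" "n \<le> m"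
  shows "tmaj \<sigma>s (jrec S \<sigma>s n w f) (jrec S \<sigma>s m w f)"
  using \<open>n \<le> m\<close>
proof (induction m rule: dec_induct)
  case base
  then show ?case
    using jrec_mon[OF assms(1-3)] by (simp add: mon_tuples_tmaj)
next
  case (step m)
  have "tmaj \<sigma>s (jrec S \<sigma>s m w f) (jrec S \<sigma>s (Suc m) w f)"
    using joins_upper[OF assms(1)] jrec_mon[OF assms(1-3)] assms(3) by simp
  with step show ?case
    by (blast intro: tmaj_trans)
qed

text \<open>The term is a simultaneous recursor whose step performs the join. Monotonicity in the
  environment includes monotonicity in the number of steps \<open>M e\<close>, and this is what the
  joins provide.\<close>

lemma mdefs_jrec:
  assumes arith: "list_all arith_star_type \<sigma>s"
    and M: "mdef \<Gamma> N M" and W: "mdefs \<Gamma> \<sigma>s W" and F: "mdefs (\<Gamma> @ \<sigma>s) \<sigma>s F"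
  shows "mdefs \<Gamma> \<sigma>s (\<lambda>e. jrec S \<sigma>s (nat_of S (M e)) (W e) (\<lambda>v. F (e @ v)))"
proof -
  define R where "R = (\<lambda>n e. jrec S \<sigma>s n (W e) (\<lambda>v. F (e @ v)))"
  define J where "J = (\<lambda>e. joins S \<sigma>s (drop (length \<Gamma>) e) (F e))"
  have J: "mdefs (\<Gamma> @ \<sigma>s) \<sigma>s J"
    unfolding J_def by (intro mdefs_joins arith mdefs_drop F)
  have R_Suc: "R (Suc n) e = J (e @ R n e)" if "e \<in> env S \<Gamma>" for n e
    using that by (simp add: R_def J_def env_length)
  have R_env: "R n e \<in> env S \<sigma>s" if "e \<in> env S \<Gamma>" for n e
  proof (induction n)
    case 0
    then show ?case
      using mdefs_env[OF W that] by (simp add: R_def)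
  next
    case (Suc n)
    then show ?case
      using that by (simp add: R_Suc mdefs_env[OF J] env_append)
  qed
  \<comment> \<open>The steps of a recursor take the count as their first argument, whereas
    \<open>J\<close> expects the environment and the current values. This map deletes the slot of
    the count.\<close>
  have "mdefs (\<Gamma> @ N # \<sigma>s) (\<Gamma> @ \<sigma>s) (\<lambda>e. take (length \<Gamma>) e @ drop (Suc (length \<Gamma>)) e)"
    using mdefs_take[of \<Gamma> "N # \<sigma>s"] mdefs_drop[of "\<Gamma> @ [N]" \<sigma>s] by (intro mdefs_append) simp_all
  from mdefs_abs_list[OF mdefs_comp[OF this J]]
  obtain H where H: "mdefs \<Gamma> (map (arrs (N # \<sigma>s)) \<sigma>s) H"
    "\<forall>e\<in>env S \<Gamma>. \<forall>xs\<in>env S (N # \<sigma>s). map (\<lambda>h. app_list S h xs) (H e) =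
      J (take (length \<Gamma>) (e @ xs) @ drop (Suc (length \<Gamma>)) (e @ xs))"
    by blast
  have step_type: "map (arrs (N # \<sigma>s)) \<sigma>s = map (step_type \<sigma>s) \<sigma>s"
    by (simp add: step_type_def)
  have rec: "rec_values S n (W e) (H e) = R n e" if e: "e \<in> env S \<Gamma>" for n e
  proof (induction n)
    case (Suc n)
    have "num S n # R n e \<in> env S (N # \<sigma>s)"
      using R_env[OF e] by simp
    with H(2) e have "map (\<lambda>h. app_list S h (num S n # R n e)) (H e) =
        J (take (length \<Gamma>) (e @ num S n # R n e) @ drop (Suc (length \<Gamma>)) (e @ num S n # R n e))"
      by blast
    with e Suc show ?case
      by (simp add: R_Suc env_length)
  qed (simp add: R_def)
  obtain tM where tM: "has_type \<Gamma> tM N" "\<forall>e\<in>env S \<Gamma>. eval S e tM = M e"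
    using M unfolding mdef_def by blast
  obtain tW where tW: "list_all2 (has_type \<Gamma>) tW \<sigma>s" "\<forall>e\<in>env S \<Gamma>. map (eval S e) tW = W e"
    using mdefs_terms[OF W] by blast
  obtain tH where tH: "list_all2 (has_type \<Gamma>) tH (map (step_type \<sigma>s) \<sigma>s)"
    "\<forall>e\<in>env S \<Gamma>. map (eval S e) tH = H e"
    using mdefs_terms[OF H(1)] unfolding step_type by blast
  let ?t = "\<lambda>i. apps (Con (Rec \<sigma>s i)) (tM # tW @ tH)"
  have t: "has_type \<Gamma> (?t i) (\<sigma>s ! i)" if "i < length \<sigma>s" for i
    using that tM(1) tW(1) tH(1)
    by (intro has_type_apps[of _ _ "N # \<sigma>s @ map (step_type \<sigma>s) \<sigma>s"] has_type_Con)
      (auto intro: list_all2_appendI)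
  have eval_t: "eval S e (?t i) = R (nat_of S (M e)) e ! i" if "i < length \<sigma>s" "e \<in> env S \<Gamma>" for i e
    using that tM(2) tW(2) tH(2) mdef_Dom[OF M that(2)] mdefs_env[OF W that(2)]
      mdefs_env[OF H(1)[unfolded step_type] that(2)] rec[OF that(2)]
    by (simp add: eval_apps app_Rec step_type_def del: const_val.simps app_list_simps)
  have "tmaj \<sigma>s (R (nat_of S (M e)) e) (R (nat_of S (M e')) e')"
    if e: "e \<in> env S \<Gamma>" "e' \<in> env S \<Gamma>" "tmaj \<Gamma> e e'" for e e'
  proof -
    have "tmaj \<sigma>s (R n e) (R n e')" for n
    proof (induction n)
      case 0
      then show ?case
        using mdefs_tmaj[OF W e] by (simp add: R_def)
    next
      case (Suc n)
      then show ?case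
        using e by (simp add: R_Suc) (intro mdefs_tmaj[OF J] env_append R_env, auto simp: tmaj_append env_length)
    qed
    \<comment> \<open>So far the environment has grown at a fixed number of steps. Now the number of
      steps grows at \<open>e'\<close>, which requires monotone data; \<open>e'\<close> is monotone
      as a right-hand side.\<close>
    moreover have "tmaj \<sigma>s (R (nat_of S (M e)) e') (R (nat_of S (M e')) e')"
      unfolding R_def
    proof (rule jrec_increasing[OF arith])
      have e': "e' \<in> mon_tuples S \<Gamma>"
        using e tmaj_refl_right[OF e(3)] by (simp add: mon_tuples_tmaj)
      then show "W e' \<in> mon_tuples S \<sigma>s"
        by (rule mdefs_mon[OF W])
      show "F (e' @ v) \<in> mon_tuples S \<sigma>s" if "v \<in> mon_tuples S \<sigma>s" for v
        using that e' by (intro mdefs_mon[OF F] mon_tuples_append)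
      show "nat_of S (M e) \<le> nat_of S (M e')"
        using mdef_smaj[OF M e] by simp
    qed
    ultimately show ?thesis
      by (rule tmaj_trans)
  qed
  with t eval_t env_length[OF R_env] have "mdefs \<Gamma> \<sigma>s (\<lambda>e. R (nat_of S (M e)) e)"
    unfolding mdefs_def mdef_def tmaj_def by auto
  then show ?thesis
    by (simp add: R_def)
qed

end

section \<open>Realizing the non-logical axioms\<close>

lemma map_arrs_Nil [simp]: "map (arrs []) \<Gamma> = \<Gamma>"
  by (induction \<Gamma>) auto

section \<open>Substitution, relativization and the interpretation\<close>

text \<open>The assumption covers all indices, also those beyond the length of \<open>e'\<close>, so
  no typing is involved. For the shifts in \<open>inst\<close> it holds there too, since
  \<open>(x # e) ! Suc n\<close> is \<open>e ! n\<close> for every \<open>n\<close>.\<close>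

lemma eval_subst:
  assumes "\<And>n. eval S e (s n) = e' ! n"
  shows "eval S e (subst_tm s t) = eval S e' t"
  using assms by (induction t) auto

lemma pos_subst [simp]: "pos J (subst s C) = pos J C"
  and neg_subst [simp]: "neg J (subst s C) = neg J C"
  by (induction C arbitrary: s) auto

lemma eval_up:
  assumes "\<And>n. eval S e (s n) = e' ! n"
  shows "eval S (x # e) (up s n) = (x # e') ! n"
proof (cases n)
  case (Suc m)
  have "eval S (x # e) (subst_tm (\<lambda>k. Var (Suc k)) (s m)) = eval S e (s m)"
    by (rule eval_subst) simp
  with Suc assms show ?thesis
    by (simp add: up_def)
qed (simp add: up_def)

lemma interp_subst:
  assumes "\<And>n. eval S e (s n) = e' ! n"
  shows "interp S J (subst s C) e as bs \<longleftrightarrow> interp S J C e' as bs"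
  using assms
proof (induction C arbitrary: e e' s as bs)
  case (All \<sigma> C)
  have "interp S J (subst (up s) C) (x # e) as bs \<longleftrightarrow> interp S J C (x # e') as bs" for x
    by (rule All.IH) (rule eval_up[OF All.prems])
  then show ?case
    by simp
next
  case (Ex \<sigma> C)
  have "interp S J (subst (up s) C) (x # e) as b \<longleftrightarrow> interp S J C (x # e') as b" for x b
    by (rule Ex.IH) (rule eval_up[OF Ex.prems])
  then show ?case
    by simp
next
  case (And C D)
  from And.IH[OF And.prems] show ?case
    by simp
next
  case (Imp C D)
  from Imp.IH[OF Imp.prems] show ?case
    by (simp add: Let_def)
qed (simp_all add: eval_subst)

lemma interp_inst:
  "interp S J (inst 0 t C) e as bs \<longleftrightarrow> interp S J C (eval S e t # e) as bs"
  "interp S J (inst (Suc 0) t C) (x # e) as bs \<longleftrightarrow> interp S J C (eval S (x # e) t # e) as bs"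
  "interp S J (inst 2 t C) (x # y # e) as bs \<longleftrightarrow> interp S J C (eval S (x # y # e) t # e) as bs"
  unfolding inst_def by (rule interp_subst; simp split: nat.splits)+

lemma relativize_subst [simp]: "relativize (subst s C) = subst s (relativize C)"
  by (induction C arbitrary: s) (auto simp: up_def)

lemma relativize_inst [simp]: "relativize (inst k t C) = inst k t (relativize C)"
  by (simp add: inst_def)

lemma pos_inst [simp]: "pos J (inst k t C) = pos J C"
  and neg_inst [simp]: "neg J (inst k t C) = neg J C"
  by (simp_all add: inst_def)

lemma interp_Imp_append:
  assumes "length fs = length (pos J D)" "length a = length (pos J C)"
  shows "interp S J (Imp C D) e (fs @ gs) (a @ d) \<longleftrightarrow>
    ((\<forall>b\<in>tuples_in S (neg J C) (map (\<lambda>g. app_list S g (a @ d)) gs). interp S J C e a b) \<longrightarrow>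
      interp S J D e (map (\<lambda>f. app_list S f a) fs) d)"
  using assms by (simp add: Let_def)

lemma dagger_arith: "dagger \<sigma> = Some \<sigma>' \<Longrightarrow> arith_star_type \<sigma>'"
  by (induction \<sigma> arbitrary: \<sigma>') (auto split: option.splits)

lemma I_mb_simps [simp]:
  "Ipos (I_mb S) \<sigma> = (case dagger \<sigma> of None \<Rightarrow> [] | Some \<sigma>' \<Rightarrow> [\<sigma>'])"
  "Ineg (I_mb S) \<sigma> = []"
  "Irel (I_mb S) \<sigma> x as bs \<longleftrightarrow> (case dagger \<sigma> of None \<Rightarrow> True | Some \<sigma>' \<Rightarrow> maj S \<sigma> x (as ! 0))"
  by (simp_all add: I_mb_def)

text \<open>Joins behave well at arithmetical star types only; this makes them available for the
  witnesses and for the sets of counter-witnesses of every formula.\<close>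

lemma arith_pos: "list_all arith_star_type (pos (I_mb S) C)"
  and arith_neg: "list_all arith_star_type (neg (I_mb S) C)"
proof -
  have "list_all arith_star_type (pos (I_mb S) C) \<and> list_all arith_star_type (neg (I_mb S) C)"
  proof (induction C)
    case (Ipred \<sigma> t)
    then show ?case
      using dagger_arith[of \<sigma>] by (simp split: option.split)
  qed (simp_all add: list.pred_map comp_def list.pred_True)
  then show "list_all arith_star_type (pos (I_mb S) C)" "list_all arith_star_type (neg (I_mb S) C)"
    by simp_all
qed

lemma pos_Alls [simp]: "pos J (Alls \<Gamma> C) = pos J C"
  and neg_Alls [simp]: "neg J (Alls \<Gamma> C) = neg J C"
  by (induction \<Gamma> arbitrary: C) auto

lemma interp_Alls:
  "interp S J (Alls \<Gamma> C) e as bs \<longleftrightarrow> (\<forall>e'\<in>env S \<Gamma>. interp S J C (e' @ e) as bs)"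
proof (induction \<Gamma> arbitrary: C)
  case (Cons \<sigma> \<Gamma>)
  have "(\<forall>e'\<in>env S (\<sigma> # \<Gamma>). P e') \<longleftrightarrow> (\<forall>e'\<in>env S \<Gamma>. \<forall>x\<in>Dom S \<sigma>. P (x # e'))" for P
    by (auto simp: env_Cons)
  with Cons show ?case
    by simp
qed simp

lemma neg_conj:
  "neg (I_mb S) C = [] \<Longrightarrow> \<forall>D\<in>set Ds. neg (I_mb S) D = [] \<Longrightarrow> neg (I_mb S) (foldl And C Ds) = []"
  by (induction Ds arbitrary: C) auto

context star_structure
begin

section \<open>Enlarging bounds and joining witnesses\<close>

lemma maj_refl_right: "dagger \<sigma> = Some \<sigma>' \<Longrightarrow> maj S \<sigma> x a \<Longrightarrow> smaj S \<sigma>' a a"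
  by (cases \<sigma>) (auto split: option.splits)

text \<open>At an unbounded argument type the bound \<open>c\<close> of an argument is itself
  monotone, so \<open>a\<close> and \<open>b\<close> can be compared at the pair \<open>c\<close>,
  \<open>c\<close>.\<close>

lemma maj_smaj: "dagger \<sigma> = Some \<sigma>' \<Longrightarrow> maj S \<sigma> x a \<Longrightarrow> smaj S \<sigma>' a b \<Longrightarrow> maj S \<sigma> x b"
proof (induction \<sigma> arbitrary: \<sigma>' x a b)
  case (Fun \<sigma> \<tau>)
  from Fun.prems(1) obtain \<tau>' where \<tau>': "dagger \<tau> = Some \<tau>'"
    by (auto split: option.splits)
  show ?case
  proof (cases "dagger \<sigma>")
    case None
    with Fun \<tau>' show ?thesis
      by (auto dest: smaj_refl_right)
  next
    case (Some \<rho>)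
    with Fun.prems(1) \<tau>' have \<sigma>': "\<sigma>' = (\<rho> \<rightarrow> \<tau>')"
      by simp
    have "maj S \<tau> (app S x y) (app S b c)"
      if y: "y \<in> Dom S \<sigma>" "c \<in> Dom S \<rho>" "maj S \<sigma> y c" for y c
    proof (rule Fun.IH(2)[OF \<tau>'])
      show "maj S \<tau> (app S x y) (app S a c)"
        using Fun.prems(2) Some y by simp
      show "smaj S \<tau>' (app S a c) (app S b c)"
        using Fun.prems(3) \<sigma>' y maj_refl_right[OF Some y(3)] by simp
    qed
    moreover have "smaj S \<tau>' (app S b z) (app S b c)"
      if "z \<in> Dom S \<rho>" "c \<in> Dom S \<rho>" "smaj S \<rho> z c" for z c
      using that Fun.prems(3) \<sigma>' by simp
    ultimately show ?thesis
      using Some \<tau>' by simp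
  qed
qed auto

lemma app_list_Mon: "f \<in> Mon S (arrs \<Delta> \<tau>) \<Longrightarrow> xs \<in> mon_tuples S \<Delta> \<Longrightarrow> app_list S f xs \<in> Mon S \<tau>"
proof (induction \<Delta> arbitrary: f xs)
  case (Cons \<sigma> \<Delta>)
  from Cons.prems(2) obtain y ys where xs: "xs = y # ys" "y \<in> Mon S \<sigma>" "ys \<in> mon_tuples S \<Delta>"
    by (auto simp: mon_tuples_Cons)
  have "app S f y \<in> Mon S (arrs \<Delta> \<tau>)"
    using Cons.prems(1) xs(2) app_Dom[of f \<sigma> "arrs \<Delta> \<tau>" y] by (simp add: Mon_def)
  with Cons.IH xs show ?case
    by simp
qed simp

lemma map_app_list_mon:
  assumes "fs \<in> mon_tuples S (map (arrs \<Delta>) \<tau>s)" "xs \<in> mon_tuples S \<Delta>"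
  shows "map (\<lambda>f. app_list S f xs) fs \<in> mon_tuples S \<tau>s"
  using assms by (auto simp: mon_tuples_iff[of fs] mon_tuples_iff[of "map _ _"] intro: app_list_Mon)

lemma map_app_list_joins:
  assumes "fs \<in> env S (map (arrs \<Delta>) \<tau>s)" "gs \<in> env S (map (arrs \<Delta>) \<tau>s)" "xs \<in> env S \<Delta>"
  shows "map (\<lambda>f. app_list S f xs) (joins S (map (arrs \<Delta>) \<tau>s) fs gs) =
    joins S \<tau>s (map (\<lambda>f. app_list S f xs) fs) (map (\<lambda>f. app_list S f xs) gs)"
  using assms by (intro nth_equalityI) (auto simp: env_iff[of fs] env_iff[of gs] app_list_join)

lemma tuples_in_joins:
  assumes "as \<in> env S (map Star \<sigma>s)" "bs \<in> env S (map Star \<sigma>s)"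
  shows "tuples_in S \<sigma>s as \<subseteq> tuples_in S \<sigma>s (joins S (map Star \<sigma>s) as bs)"
    "tuples_in S \<sigma>s bs \<subseteq> tuples_in S \<sigma>s (joins S (map Star \<sigma>s) as bs)"
  using assms by (auto simp: tuples_in_def listset_iff env_iff elems_union)

text \<open>
  Taking joins of positive witnesses preserves truth for each fixed negative witness, because a
  join of functions is pointwise and a join of sets is their union. Truth is not preserved under
  arbitrary majorants.
\<close>

lemma interp_joins:
  assumes "as \<in> mon_tuples S (pos (I_mb S) C)" "as' \<in> mon_tuples S (pos (I_mb S) C)"
    "bs \<in> mon_tuples S (neg (I_mb S) C)"
    "interp S (I_mb S) C e as bs \<or> interp S (I_mb S) C e as' bs"
  shows "interp S (I_mb S) C e (joins S (pos (I_mb S) C) as as') bs"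
  using assms
proof (induction C arbitrary: e as as' bs)
  case (Ipred \<sigma> t)
  show ?case
  proof (cases "dagger \<sigma>")
    case (Some \<sigma>')
    then show ?thesis
      using Ipred join_upper[OF dagger_arith[OF Some]] maj_smaj[OF Some]
      by (auto simp: mon_tuples_Cons joins_Cons)
  qed simp
next
  case (And C D)
  obtain a1 a2 where a: "as = a1 @ a2" "a1 \<in> mon_tuples S (pos (I_mb S) C)" "a2 \<in> mon_tuples S (pos (I_mb S) D)"
    using And.prems(1) by (auto elim: mon_tuples_appendE)
  obtain a1' a2' where a': "as' = a1' @ a2'" "a1' \<in> mon_tuples S (pos (I_mb S) C)" "a2' \<in> mon_tuples S (pos (I_mb S) D)"
    using And.prems(2) by (auto elim: mon_tuples_appendE)
  obtain b1 b2 where b: "bs = b1 @ b2" "b1 \<in> mon_tuples S (neg (I_mb S) C)" "b2 \<in> mon_tuples S (neg (I_mb S) D)"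
    using And.prems(3) by (auto elim: mon_tuples_appendE)
  show ?case
    using And.prems(4) And.IH(1)[OF a(2) a'(2) b(2)] And.IH(2)[OF a(3) a'(3) b(3)] a a' b
    by (auto simp: joins_append mon_tuples_length)
next
  case (Imp C D)
  let ?fT = "map (arrs (pos (I_mb S) C)) (pos (I_mb S) D)"
  let ?gT = "map (arrs (pos (I_mb S) C @ neg (I_mb S) D)) (map Star (neg (I_mb S) C))"
  have pos: "pos (I_mb S) (Imp C D) = ?fT @ ?gT"
    by simp
  obtain fs gs where a: "as = fs @ gs" "fs \<in> mon_tuples S ?fT" "gs \<in> mon_tuples S ?gT"
    using Imp.prems(1) unfolding pos by (auto elim: mon_tuples_appendE)
  obtain fs' gs' where a': "as' = fs' @ gs'" "fs' \<in> mon_tuples S ?fT" "gs' \<in> mon_tuples S ?gT"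
    using Imp.prems(2) unfolding pos by (auto elim: mon_tuples_appendE)
  obtain x d where b: "bs = x @ d" "x \<in> mon_tuples S (pos (I_mb S) C)" "d \<in> mon_tuples S (neg (I_mb S) D)"
    using Imp.prems(3) by (auto elim: mon_tuples_appendE)
  have xd: "x @ d \<in> mon_tuples S (pos (I_mb S) C @ neg (I_mb S) D)"
    using b by (simp add: mon_tuples_append)
  let ?F = "map (\<lambda>f. app_list S f x)" and ?G = "map (\<lambda>g. app_list S g (x @ d))"
  have F: "?F fs \<in> mon_tuples S (pos (I_mb S) D)" "?F fs' \<in> mon_tuples S (pos (I_mb S) D)"
    using a a' b by (auto intro: map_app_list_mon)
  have G: "?G gs \<in> env S (map Star (neg (I_mb S) C))" "?G gs' \<in> env S (map Star (neg (I_mb S) C))"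
    using a a' xd by (blast intro: mon_tuples_env map_app_list_mon)+
  have joins: "joins S (?fT @ ?gT) as as' = joins S ?fT fs fs' @ joins S ?gT gs gs'"
    using a a' by (simp only: joins_append mon_tuples_length)
  have "?F (joins S ?fT fs fs') = joins S (pos (I_mb S) D) (?F fs) (?F fs')"
    using a a' b by (intro map_app_list_joins mon_tuples_env)
  moreover have "?G (joins S ?gT gs gs') = joins S (map Star (neg (I_mb S) C)) (?G gs) (?G gs')"
    using a a' xd by (intro map_app_list_joins mon_tuples_env)
  moreover have len: "length x = length (pos (I_mb S) C)" "length fs = length (pos (I_mb S) D)"
    "length fs' = length (pos (I_mb S) D)"
    using a a' b by (simp_all add: mon_tuples_length)
  ultimately show ?case
    using Imp.prems(4) tuples_in_joins[OF G] Imp.IH(2)[OF F b(3)]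
    unfolding pos joins unfolding a(1) a'(1) b(1)
    by (auto simp: interp_Imp_append simp del: interp.simps)
next
  case (All \<sigma> C)
  then show ?case
    by auto
next
  case (Ex \<sigma> C)
  \<comment> \<open>The element that verifies the quantifier for one witness also does so for the
    join. The induction hypothesis asks for monotone negative witnesses, and
    \<open>tuples_in\<close> contains no others.\<close>
  have "b \<in> mon_tuples S (neg (I_mb S) C)" if "b \<in> tuples_in S (neg (I_mb S) C) bs" for b
    using that by (simp add: tuples_in_def)
  with Ex.prems Ex.IH show ?case
    by auto meson+
qed auto

section \<open>Realizers uniform in a set of assignments\<close>

text \<open>One closed realizer has to serve all assignments in \<open>E\<close>. The set is
  arbitrary, so that a premise without counter-witnesses can be turned into a restriction of
  \<open>E\<close>.\<close>

definition realizable :: "'u list set \<Rightarrow> fm \<Rightarrow> bool" where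
  "realizable E C \<longleftrightarrow> (\<exists>F. mdefs [] (pos (I_mb S) C) F \<and>
     (\<forall>bs\<in>mon_tuples S (neg (I_mb S) C). \<forall>e\<in>E. interp S (I_mb S) C e (F []) bs))"

lemma U_interpretableI:
  assumes "realizable (env S \<Gamma>) C"
  shows "U_interpretable S (I_mb S) \<Gamma> C"
proof -
  obtain F where F: "mdefs [] (pos (I_mb S) C) F"
    "\<forall>bs\<in>mon_tuples S (neg (I_mb S) C). \<forall>e\<in>env S \<Gamma>. interp S (I_mb S) C e (F []) bs"
    using assms unfolding realizable_def by blast
  obtain ts where "list_all2 (has_type []) ts (pos (I_mb S) C)" "map (eval S []) ts = F []"
    using mdefs_terms[OF F(1)] by auto
  moreover have "F [] \<in> mon_tuples S (pos (I_mb S) C)"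
    by (rule mdefs_mon[OF F(1)]) simp
  ultimately show ?thesis
    using F(2) unfolding U_interpretable_def by metis
qed

text \<open>Lets the two parts of a realizer be given as functions of open arguments. Abstraction
  turns them into the closed functionals that the clause for implication asks for.\<close>

lemma realizable_Imp:
  assumes f: "mdefs (pos (I_mb S) C) (pos (I_mb S) D) f"
    and g: "mdefs (pos (I_mb S) C @ neg (I_mb S) D) (map Star (neg (I_mb S) C)) g"
    and fg: "\<And>e a d. e \<in> E \<Longrightarrow> a \<in> mon_tuples S (pos (I_mb S) C) \<Longrightarrow> d \<in> mon_tuples S (neg (I_mb S) D) \<Longrightarrow>
      \<forall>b\<in>tuples_in S (neg (I_mb S) C) (g (a @ d)). interp S (I_mb S) C e a b \<Longrightarrow>
      interp S (I_mb S) D e (f a) d"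
  shows "realizable E (Imp C D)"
proof -
  have "mdefs ([] @ pos (I_mb S) C) (pos (I_mb S) D) f"
    using f by simp
  from mdefs_abs_list[OF this]
  obtain F where F: "mdefs [] (map (arrs (pos (I_mb S) C)) (pos (I_mb S) D)) F"
    "\<forall>e\<in>env S []. \<forall>xs\<in>env S (pos (I_mb S) C). map (\<lambda>f. app_list S f xs) (F e) = f (e @ xs)"
    by blast
  have "mdefs ([] @ pos (I_mb S) C @ neg (I_mb S) D) (map Star (neg (I_mb S) C)) g"
    using g by simp
  from mdefs_abs_list[OF this]
  obtain G where G: "mdefs [] (map (arrs (pos (I_mb S) C @ neg (I_mb S) D)) (map Star (neg (I_mb S) C))) G"
    "\<forall>e\<in>env S []. \<forall>xs\<in>env S (pos (I_mb S) C @ neg (I_mb S) D). map (\<lambda>f. app_list S f xs) (G e) = g (e @ xs)"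
    by blast
  have "interp S (I_mb S) (Imp C D) e (F [] @ G []) bs"
    if e: "e \<in> E" and bs: "bs \<in> mon_tuples S (neg (I_mb S) (Imp C D))" for e bs
  proof -
    obtain a d where ad: "bs = a @ d" "a \<in> mon_tuples S (pos (I_mb S) C)" "d \<in> mon_tuples S (neg (I_mb S) D)"
      using bs by (auto elim: mon_tuples_appendE)
    have "map (\<lambda>f. app_list S f a) (F []) = f a"
      using F(2) mon_tuples_env[OF ad(2)] by simp
    moreover have "map (\<lambda>g. app_list S g (a @ d)) (G []) = g (a @ d)"
      using G(2) mon_tuples_env[OF mon_tuples_append[OF ad(2,3)]] by simp
    moreover have "length (F []) = length (pos (I_mb S) D)" "length a = length (pos (I_mb S) C)"
      using mdefs_length[OF F(1)] ad(2) by (simp_all add: mon_tuples_length)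
    ultimately show ?thesis
      unfolding ad(1) using fg[OF e ad(2,3)] by (simp add: interp_Imp_append del: interp.simps)
  qed
  moreover have "mdefs [] (pos (I_mb S) (Imp C D)) (\<lambda>e. F e @ G e)"
    using mdefs_append[OF F(1) G(1)] by (simp add: comp_def)
  ultimately show ?thesis
    unfolding realizable_def by (intro exI[of _ "\<lambda>e. F e @ G e"]) blast
qed

lemma mdefs_closed: "mdefs [] \<Delta> F \<Longrightarrow> mdefs \<Gamma> \<Delta> (\<lambda>e. F [])"
  by (rule mdefs_comp[of _ "[]" "\<lambda>e. []"]) simp_all

text \<open>A premise without counter-witnesses acts as a mere condition on the assignment. It is
  traded for a smaller set of assignments, on which a constant realizer of \<open>D\<close>
  suffices.\<close>

lemma realizable_Imp_hyp:
  assumes "neg (I_mb S) C = []" "realizable {e \<in> E. \<exists>a. interp S (I_mb S) C e a []} D"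
  shows "realizable E (Imp C D)"
proof -
  obtain F where F: "mdefs [] (pos (I_mb S) D) F"
    "\<forall>bs\<in>mon_tuples S (neg (I_mb S) D). \<forall>e\<in>{e \<in> E. \<exists>a. interp S (I_mb S) C e a []}.
      interp S (I_mb S) D e (F []) bs"
    using assms(2) unfolding realizable_def by blast
  show ?thesis
  proof (rule realizable_Imp)
    show "mdefs (pos (I_mb S) C) (pos (I_mb S) D) (\<lambda>e. F [])"
      by (rule mdefs_closed[OF F(1)])
    show "mdefs (pos (I_mb S) C @ neg (I_mb S) D) (map Star (neg (I_mb S) C)) (\<lambda>e. [])"
      by (simp add: assms(1))
    show "interp S (I_mb S) D e (F []) d"
      if "e \<in> E" "d \<in> mon_tuples S (neg (I_mb S) D)"
        "\<forall>b\<in>tuples_in S (neg (I_mb S) C) []. interp S (I_mb S) C e a b" for e a d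
      using that F(2) assms(1) by (auto simp: tuples_in_def)
  qed
qed

lemma realizable_subset: "realizable E C \<Longrightarrow> E' \<subseteq> E \<Longrightarrow> realizable E' C"
  unfolding realizable_def by blast

lemma realizable_Alls: "realizable (env S \<Gamma>) C \<Longrightarrow> realizable {[]} (Alls \<Gamma> C)"
  unfolding realizable_def by (simp add: interp_Alls)

text \<open>The premise about the parameters is a conjunction of predicates \<open>Ipred\<close>, so
  it has no counter-witnesses and is absorbed by \<open>realizable_Imp_hyp\<close>. What remains is
  to find one realizer for all values of the parameters.\<close>

lemma I_interpretableI:
  assumes "realizable (env S \<Gamma>) (relativize C)"
  shows "I_interpretable S (I_mb S) \<Gamma> C"
proof -
  let ?Ds = "map (\<lambda>i. Ipred (\<Gamma> ! i) (Var i)) [0..<length \<Gamma>]"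
  have "realizable (env S \<Gamma>) (Conj_imp ?Ds (relativize C))"
  proof (cases ?Ds)
    case (Cons D Ds)
    then have "\<forall>D\<in>set (D # Ds). neg (I_mb S) D = []"
      by (metis (no_types, lifting) I_mb_simps(2) imageE list.set_map neg.simps(2))
    then have "neg (I_mb S) (foldl And D Ds) = []"
      by (intro neg_conj) auto
    with assms show ?thesis
      unfolding Cons by (auto intro!: realizable_Imp_hyp elim: realizable_subset)
  qed (use assms in auto)
  from realizable_Alls[OF this] show ?thesis
    unfolding I_interpretable_def by (intro U_interpretableI) (auto elim: realizable_subset)
qed

lemma realizable_Eq: "(\<And>e. e \<in> E \<Longrightarrow> eval S e s = eval S e t) \<Longrightarrow> realizable E (Eq \<sigma> s t)"
  unfolding realizable_def by auto

lemma realizable_Bot: "E = {} \<Longrightarrow> realizable E Bot"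
  unfolding realizable_def by auto

text \<open>The box with a single tuple: the way to challenge a premise at exactly one
  counter-witness.\<close>

definition singles :: "ty list \<Rightarrow> 'u list \<Rightarrow> 'u list" where
  "singles \<sigma>s xs = map (\<lambda>i. mk_set S (\<sigma>s ! i) {xs ! i}) [0..<length \<sigma>s]"

lemma length_singles [simp]: "length (singles \<sigma>s xs) = length \<sigma>s"
  by (simp add: singles_def)

lemma mdefs_singles:
  assumes "mdefs \<Gamma> \<sigma>s F"
  shows "mdefs \<Gamma> (map Star \<sigma>s) (\<lambda>e. singles \<sigma>s (F e))"
  using mdef_Single[OF mdefs_nth[OF assms]] by (simp add: mdefs_def singles_def)

lemma elems_singles:
  assumes "xs \<in> env S \<sigma>s"
  shows "listset (map (elems S) (singles \<sigma>s xs)) = {xs}"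
  using assms by (auto simp: listset_iff singles_def env_iff elems_mk_set intro: nth_equalityI)

lemma tuples_in_singles:
  assumes "xs \<in> mon_tuples S \<sigma>s"
  shows "tuples_in S \<sigma>s (singles \<sigma>s xs) = {xs}"
  using elems_singles[OF mon_tuples_env[OF assms]] assms by (simp add: tuples_in_def)

lemma tuples_in_append:
  assumes "length as = length \<sigma>s" "b \<in> tuples_in S \<sigma>s as" "c \<in> tuples_in S \<tau>s bs"
  shows "b @ c \<in> tuples_in S (\<sigma>s @ \<tau>s) (as @ bs)"
  using assms by (auto simp: tuples_in_def mon_tuples_append listset_iff nth_append)

section \<open>Substitution of equals and case distinction on Booleans\<close>

text \<open>The equation has no witnesses and only restricts the assignments. On the remaining ones
  both instances of \<open>D\<close> are the same statement, so the witness is passed on unchanged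
  and the challenge is passed back as a singleton.\<close>

lemma eq_subst_interpretable:
  "I_interpretable S (I_mb S) (\<sigma> # \<sigma> # \<Gamma>)
     (Imp (Eq \<sigma> (Var 0) (Var 1)) (Imp (inst 2 (Var 0) D) (inst 2 (Var 1) D)))"
proof -
  let ?D = "relativize D"
  have "realizable {e \<in> env S (\<sigma> # \<sigma> # \<Gamma>). e ! 0 = e ! 1} (Imp (inst 2 (Var 0) ?D) (inst 2 (Var 1) ?D))"
  proof (rule realizable_Imp)
    let ?n = "length (pos (I_mb S) ?D)"
    show "mdefs (pos (I_mb S) (inst 2 (Var 0) ?D)) (pos (I_mb S) (inst 2 (Var 1) ?D)) (\<lambda>e. e)"
      by (simp add: mdefs_id)
    show "mdefs (pos (I_mb S) (inst 2 (Var 0) ?D) @ neg (I_mb S) (inst 2 (Var 1) ?D))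
        (map Star (neg (I_mb S) (inst 2 (Var 0) ?D))) (\<lambda>e. singles (neg (I_mb S) ?D) (drop ?n e))"
      by (simp add: mdefs_singles[OF mdefs_drop])
    show "interp S (I_mb S) (inst 2 (Var 1) ?D) e a d"
      if "e \<in> {e \<in> env S (\<sigma> # \<sigma> # \<Gamma>). e ! 0 = e ! 1}" "a \<in> mon_tuples S (pos (I_mb S) (inst 2 (Var 0) ?D))"
        "d \<in> mon_tuples S (neg (I_mb S) (inst 2 (Var 1) ?D))"
        "\<forall>b\<in>tuples_in S (neg (I_mb S) (inst 2 (Var 0) ?D)) (singles (neg (I_mb S) ?D) (drop ?n (a @ d))).
          interp S (I_mb S) (inst 2 (Var 0) ?D) e a b" for e a d
      using that by (auto simp: env_Cons interp_inst tuples_in_singles mon_tuples_length)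
  qed
  then have "realizable (env S (\<sigma> # \<sigma> # \<Gamma>))
      (Imp (Eq \<sigma> (Var 0) (Var 1)) (Imp (inst 2 (Var 0) ?D) (inst 2 (Var 1) ?D)))"
    by (rule realizable_Imp_hyp[rotated, OF realizable_subset]) auto
  then show ?thesis
    by (intro I_interpretableI) simp
qed

text \<open>\<open>B\<close> is bounded, so the realizer does not learn which Boolean it is to
  serve. It joins the witness for 0 with the one for 1 and challenges both instances with the same
  \<open>d\<close>; by \<open>interp_joins\<close> the join is good for either.\<close>

lemma bool_ind_interpretable:
  "I_interpretable S (I_mb S) \<Gamma> (Imp (And (inst 0 (Con Bool0) D) (inst 0 (Con Bool1) D)) (All B D))"
proof -
  define C where "C = relativize D"
  define p n where "p = pos (I_mb S) C" and "n = neg (I_mb S) C"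
  have "realizable (env S \<Gamma>)
    (Imp (And (inst 0 (Con Bool0) C) (inst 0 (Con Bool1) C)) (All B (Imp (Ipred B (Var 0)) C)))"
  proof (rule realizable_Imp, simp_all only: pos.simps neg.simps pos_inst neg_inst p_def[symmetric] n_def[symmetric])
    have "mdefs (p @ p) p (\<lambda>e. joins S p (take (length p) e) (drop (length p) e))"
      by (intro mdefs_joins mdefs_take mdefs_drop) (simp add: p_def arith_pos)
    then show "mdefs (p @ p) (map (arrs (Ipos (I_mb S) B)) p @
        map (\<lambda>\<tau>. arrs (Ipos (I_mb S) B @ n) (Star \<tau>)) (Ineg (I_mb S) B))
        (\<lambda>e. joins S p (take (length p) e) (drop (length p) e))"
      by simp
    have "mdefs ((p @ p) @ n) n (drop (length (p @ p)))"
      by (rule mdefs_drop)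
    then show "mdefs ((p @ p) @ Ipos (I_mb S) B @ n) (map Star (n @ n))
        (\<lambda>e. singles n (drop (length (p @ p)) e) @ singles n (drop (length (p @ p)) e))"
      by (simp only: map_append I_mb_simps dagger.simps option.case append_Nil) (intro mdefs_append mdefs_singles)
    fix e a d
    assume e: "e \<in> env S \<Gamma>" and a: "a \<in> mon_tuples S (p @ p)" and d': "d \<in> mon_tuples S (Ipos (I_mb S) B @ n)"
      and *: "\<forall>b\<in>tuples_in S (n @ n) (singles n (drop (length (p @ p)) (a @ d)) @ singles n (drop (length (p @ p)) (a @ d))).
          interp S (I_mb S) (And (inst 0 (Con Bool0) C) (inst 0 (Con Bool1) C)) e a b"
    obtain a1 a2 where a12: "a = a1 @ a2" "a1 \<in> mon_tuples S p" "a2 \<in> mon_tuples S p"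
      using a by (rule mon_tuples_appendE)
    have d: "d \<in> mon_tuples S n"
      using d' by simp
    have "d @ d \<in> tuples_in S (n @ n) (singles n d @ singles n d)"
      using d by (intro tuples_in_append) (simp_all add: tuples_in_singles)
    with * have "interp S (I_mb S) (And (inst 0 (Con Bool0) C) (inst 0 (Con Bool1) C)) e a (d @ d)"
      using a by (simp add: mon_tuples_length del: interp.simps)
    then have "interp S (I_mb S) C (bool S False # e) a1 d" "interp S (I_mb S) C (bool S True # e) a2 d"
      using a12 d by (simp_all add: interp_inst p_def[symmetric] n_def[symmetric] mon_tuples_length)
    with interp_joins[OF a12(2)[unfolded p_def] a12(3)[unfolded p_def] d[unfolded n_def]]
    have "interp S (I_mb S) C (x # e) (joins S p a1 a2) d" if "x \<in> Dom S B" for x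
      using that by (auto simp: Dom_B p_def)
    then show "interp S (I_mb S) (All B (Imp (Ipred B (Var 0)) C)) e
        (joins S p (take (length p) a) (drop (length p) a)) d"
      using a12 by (auto simp: p_def mon_tuples_length Let_def tuples_in_def)
  qed
  then show ?thesis
    by (intro I_interpretableI) (simp add: C_def)
qed

section \<open>Induction\<close>

lemma mdefs_weaken: "mdefs \<Gamma> \<tau>s F \<Longrightarrow> mdefs (\<Gamma> @ \<Delta>) \<tau>s (\<lambda>e. F (take (length \<Gamma>) e))"
  by (rule mdefs_comp[OF mdefs_take])

lemma mdef_weaken: "mdef \<Gamma> \<tau> F \<Longrightarrow> mdef (\<Gamma> @ \<Delta>) \<tau> (\<lambda>e. F (take (length \<Gamma>) e))"
  by (rule mdef_comp[OF mdefs_take])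

text \<open>An inclusion and not an equation, since the union is taken in each component separately:
  the resulting box may also contain tuples whose components stem from different
  \<open>b\<close>.\<close>

lemma mdefs_Union_tuples:
  assumes "mdefs \<Gamma> (map Star \<Delta>) A" "mdefs (\<Gamma> @ \<Delta>) (map Star \<tau>s) F"
  shows "\<exists>G. mdefs \<Gamma> (map Star \<tau>s) G \<and>
    (\<forall>e\<in>env S \<Gamma>. \<forall>b\<in>listset (map (elems S) (A e)).
      listset (map (elems S) (F (e @ b))) \<subseteq> listset (map (elems S) (G e)))"
proof -
  have "\<forall>i<length \<tau>s. \<exists>G. mdef \<Gamma> (Star (\<tau>s ! i)) G \<and>
    (\<forall>e\<in>env S \<Gamma>. elems S (G e) = (\<Union>b\<in>listset (map (elems S) (A e)). elems S (F (e @ b) ! i)))"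
    using mdefs_nth[OF assms(2)] by (intro allI impI mdef_Union_tuples[OF assms(1)]) simp
  then obtain G where G: "mdef \<Gamma> (Star (\<tau>s ! i)) (G i)"
    "\<forall>e\<in>env S \<Gamma>. elems S (G i e) = (\<Union>b\<in>listset (map (elems S) (A e)). elems S (F (e @ b) ! i))"
    if "i < length \<tau>s" for i
    by metis
  let ?G = "\<lambda>e. map (\<lambda>i. G i e) [0..<length \<tau>s]"
  have "mdefs \<Gamma> (map Star \<tau>s) ?G"
    using G(1) by (simp add: mdefs_def)
  moreover have "listset (map (elems S) (F (e @ b))) \<subseteq> listset (map (elems S) (?G e))"
    if e: "e \<in> env S \<Gamma>" and b: "b \<in> listset (map (elems S) (A e))" for e b
  proof -
    have "b \<in> env S \<Delta>"
      using b mdefs_env[OF assms(1) e] elems_subset by (fastforce simp: listset_iff env_iff)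
    then have "length (F (e @ b)) = length \<tau>s"
      using mdefs_length[OF assms(2) env_append[OF e]] by simp
    moreover have "elems S (F (e @ b) ! i) \<subseteq> elems S (G i e)" if "i < length \<tau>s" for i
      using G(2)[OF that] e b by blast
    ultimately show ?thesis
      unfolding listset_iff subset_iff by simp
  qed
  ultimately show ?thesis
    by blast
qed

lemma listset_joins:
  assumes "as \<in> env S (map Star \<sigma>s)" "bs \<in> env S (map Star \<sigma>s)"
  shows "listset (map (elems S) as) \<subseteq> listset (map (elems S) (joins S (map Star \<sigma>s) as bs))"
    "listset (map (elems S) bs) \<subseteq> listset (map (elems S) (joins S (map Star \<sigma>s) as bs))"
  using assms by (auto simp: listset_iff env_iff elems_union)

lemma jrec_env:
  assumes "w \<in> env S \<sigma>s" "\<And>v. v \<in> env S \<sigma>s \<Longrightarrow> f v \<in> env S \<sigma>s"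
  shows "jrec S \<sigma>s n w f \<in> env S \<sigma>s"
proof (induction n)
  case (Suc n)
  with assms(2)[OF Suc] show ?case
    by (simp add: env_iff join_Dom)
qed (use assms in simp)

lemma listset_jrec_mono:
  assumes "w \<in> env S (map Star \<sigma>s)" "\<And>v. v \<in> env S (map Star \<sigma>s) \<Longrightarrow> f v \<in> env S (map Star \<sigma>s)" "n \<le> m"
  shows "listset (map (elems S) (jrec S (map Star \<sigma>s) n w f)) \<subseteq>
    listset (map (elems S) (jrec S (map Star \<sigma>s) m w f))"
  using assms(3)
proof (induction m rule: dec_induct)
  case (step m)
  have "jrec S (map Star \<sigma>s) m w f \<in> env S (map Star \<sigma>s)"
    using assms by (intro jrec_env) auto
  from listset_joins(1)[OF this assms(2)[OF this]] step show ?case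
    by simp
qed simp

text \<open>All steps receive the same first argument \<open>m\<close>. Used with at most
  \<open>m\<close> steps, it bounds the running count, and a bound is all that a witness for
  \<open>Ipred N\<close> has to be.\<close>

definition iterates :: "ty list \<Rightarrow> nat \<Rightarrow> 'u \<Rightarrow> 'u list \<Rightarrow> 'u list \<Rightarrow> 'u list" where
  "iterates \<sigma>s j m ws fs = jrec S \<sigma>s j ws (\<lambda>v. map (\<lambda>f. app_list S f (m # v)) fs)"

lemma mdefs_iterates:
  assumes "list_all arith_star_type \<sigma>s" "mdef \<Gamma> N M" "mdefs \<Gamma> \<sigma>s W"
    and F: "mdefs \<Gamma> (map (arrs (N # \<sigma>s)) \<sigma>s) F"
  shows "mdefs \<Gamma> \<sigma>s (\<lambda>e. iterates \<sigma>s (nat_of S (M e)) (M e) (W e) (F e))"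
proof -
  let ?F = "\<lambda>e. map (\<lambda>f. app_list S f (M (take (length \<Gamma>) e) # drop (length \<Gamma>) e)) (F (take (length \<Gamma>) e))"
  have "mdefs (\<Gamma> @ \<sigma>s) \<sigma>s ?F"
    using assms by (intro mdefs_app_list[of _ "N # \<sigma>s"] mdefs_Cons mdefs_drop mdef_weaken mdefs_weaken)
  from mdefs_jrec[OF assms(1-3) this] show ?thesis
    by (rule mdefs_cong[THEN iffD1, rotated]) (simp add: env_length iterates_def)
qed

lemma iterates_env:
  assumes "m \<in> Dom S N" "ws \<in> env S \<sigma>s" "fs \<in> env S (map (arrs (N # \<sigma>s)) \<sigma>s)"
  shows "iterates \<sigma>s j m ws fs \<in> env S \<sigma>s"
  unfolding iterates_def
proof (rule jrec_env)
  show "map (\<lambda>f. app_list S f (m # v)) fs \<in> env S \<sigma>s" if v: "v \<in> env S \<sigma>s" for v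
  proof -
    have "app_list S (fs ! i) (m # v) \<in> Dom S (\<sigma>s ! i)" if "i < length \<sigma>s" for i
    proof (rule app_list_Dom)
      show "fs ! i \<in> Dom S (arrs (N # \<sigma>s) (\<sigma>s ! i))"
        using assms(3) that by (auto simp: env_iff simp del: arrs_simps)
      show "m # v \<in> env S (N # \<sigma>s)"
        using assms(1) v by simp
    qed
    then show ?thesis
      using assms(3) by (simp add: env_iff del: app_list_simps)
  qed
qed (rule assms)

text \<open>
  The set \<open>W e\<close> contains all iterates. The sets \<open>s k\<close> collect, backwards along the iteration, the
  counter-witnesses that \<open>k\<close> applications of the induction step lead to when one starts from \<open>D e\<close>.
\<close>

lemma induction_challenges:
  assumes arith: "list_all arith_star_type p" "list_all arith_star_type n"
    and M: "mdef \<Gamma> N M" and A: "mdefs \<Gamma> p A" and F: "mdefs \<Gamma> (map (arrs (N # p)) p) F"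
    and G: "mdefs \<Gamma> (map (arrs (N # p @ n)) (map Star n)) G" and D: "mdefs \<Gamma> n D"
  obtains W E where "mdefs \<Gamma> (map Star p) W" "mdefs \<Gamma> (map Star n) E"
    "\<And>e. e \<in> env S \<Gamma> \<Longrightarrow> \<exists>s. s (nat_of S (M e)) = listset (map (elems S) (E e)) \<and>
      D e \<in> s 0 \<and> (\<forall>k l. k \<le> l \<longrightarrow> s k \<subseteq> s l) \<and>
      (\<forall>j\<le>nat_of S (M e). iterates p j (M e) (A e) (F e) \<in> listset (map (elems S) (W e)) \<and>
        (\<forall>k. \<forall>b\<in>s k. listset (map (elems S) (map (\<lambda>g. app_list S g (M e # iterates p j (M e) (A e) (F e) @ b)) (G e)))
          \<subseteq> s (Suc k)))"
proof -
  have wt: "mdefs ((\<Gamma> @ map Star \<Delta>) @ \<Delta>') \<tau>s (\<lambda>e. H (take (length \<Gamma>) e))"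
    if "mdefs \<Gamma> \<tau>s H" for H \<Delta> \<Delta>' \<tau>s
    using mdefs_weaken[OF that, of "map Star \<Delta> @ \<Delta>'"] by simp
  have wt1: "mdef ((\<Gamma> @ map Star \<Delta>) @ \<Delta>') \<tau> (\<lambda>e. H (take (length \<Gamma>) e))"
    if "mdef \<Gamma> \<tau> H" for H \<Delta> \<Delta>' \<tau>
    using mdef_weaken[OF that, of "map Star \<Delta> @ \<Delta>'"] by simp
  define next_v where "next_v e v = joins S p v (map (\<lambda>f. app_list S f (M e # v)) (F e))" for e v
  let ?hd = "take (length \<Gamma>)"
  have "mdefs ((\<Gamma> @ map Star p) @ p) p (\<lambda>e. next_v (?hd e) (drop (length (\<Gamma> @ map Star p)) e))"
    unfolding next_v_def
    by (intro mdefs_joins arith mdefs_drop mdefs_app_list[of _ "N # p"] mdefs_Cons wt wt1 M F)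
  from mdefs_Union_tuples[OF mdefs_drop[of \<Gamma> "map Star p"] mdefs_singles[OF this]]
  obtain U where U: "mdefs (\<Gamma> @ map Star p) (map Star p) U"
    "\<forall>e\<in>env S (\<Gamma> @ map Star p). \<forall>v\<in>listset (map (elems S) (drop (length \<Gamma>) e)).
      listset (map (elems S) (singles p (next_v (?hd (e @ v)) (drop (length (\<Gamma> @ map Star p)) (e @ v)))))
        \<subseteq> listset (map (elems S) (U e))"
    by blast
  \<comment> \<open>\<open>U\<close> pushes a box forward through one step, so \<open>Ws j\<close>
    contains the \<open>j\<close>-th iterate. As \<open>jrec\<close> joins each box with the
    previous one, the final box still contains all earlier iterates.\<close>
  define Ws where "Ws j e = jrec S (map Star p) j (singles p (A e)) (\<lambda>w. U (e @ w))" for j e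
  define W where "W e = Ws (nat_of S (M e)) e" for e
  have W: "mdefs \<Gamma> (map Star p) W"
    unfolding W_def Ws_def using arith M A U(1) by (intro mdefs_jrec mdefs_singles) (auto simp: list_all_iff)
  have "mdefs ((\<Gamma> @ map Star n) @ (p @ n)) (map Star n)
      (\<lambda>e. map (\<lambda>g. app_list S g (M (?hd e) # drop (length (\<Gamma> @ map Star n)) e)) (G (?hd e)))"
    by (intro mdefs_app_list[of _ "N # p @ n"] mdefs_Cons mdefs_drop wt wt1 M G)
  moreover have "mdefs (\<Gamma> @ map Star n) (map Star (p @ n)) (\<lambda>e. W (?hd e) @ drop (length \<Gamma>) e)"
    unfolding map_append by (intro mdefs_append mdefs_weaken W mdefs_drop)
  ultimately obtain X where X: "mdefs (\<Gamma> @ map Star n) (map Star n) X"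
    "\<forall>e\<in>env S (\<Gamma> @ map Star n). \<forall>c\<in>listset (map (elems S) (W (?hd e) @ drop (length \<Gamma>) e)).
      listset (map (elems S) (map (\<lambda>g. app_list S g (M (?hd (e @ c)) # drop (length (\<Gamma> @ map Star n)) (e @ c)))
        (G (?hd (e @ c))))) \<subseteq> listset (map (elems S) (X e))"
    using mdefs_Union_tuples by blast
  \<comment> \<open>\<open>X\<close> combines the challenges found so far with every tuple in the
    box \<open>W\<close>. The collection thus does not depend on the position \<open>j\<close> of
    the iterate at which a challenge is raised.\<close>
  define Es where "Es j e = jrec S (map Star n) j (singles n (D e)) (\<lambda>w. X (e @ w))" for j e
  define E where "E e = Es (nat_of S (M e)) e" for e
  have E: "mdefs \<Gamma> (map Star n) E"
    unfolding E_def Es_def using arith M D X(1) by (intro mdefs_jrec mdefs_singles) (auto simp: list_all_iff)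
  show thesis
  proof (rule that[OF W E])
    fix e assume e: "e \<in> env S \<Gamma>"
    define v where "v j = iterates p j (M e) (A e) (F e)" for j
    define s where "s k = listset (map (elems S) (Es k e))" for k
    have v: "v j \<in> env S p" for j
      unfolding v_def using mdef_Dom[OF M e] mdefs_env[OF A e] mdefs_env[OF F e] by (rule iterates_env)
    have U_env: "U (e @ w) \<in> env S (map Star p)" if "w \<in> env S (map Star p)" for w
      using that e by (intro mdefs_env[OF U(1)] env_append)
    have X_env: "X (e @ w) \<in> env S (map Star n)" if "w \<in> env S (map Star n)" for w
      using that e by (intro mdefs_env[OF X(1)] env_append)
    have A_env: "singles p (A e) \<in> env S (map Star p)" and D_env: "singles n (D e) \<in> env S (map Star n)"
      using e mdefs_env[OF mdefs_singles[OF A]] mdefs_env[OF mdefs_singles[OF D]] by blast+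
    have Ws_env: "Ws j e \<in> env S (map Star p)" for j
      unfolding Ws_def using A_env U_env by (rule jrec_env)
    have Es_env: "Es j e \<in> env S (map Star n)" for j
      unfolding Es_def using D_env X_env by (rule jrec_env)
    have v_Ws: "v j \<in> listset (map (elems S) (Ws j e))" for j
    proof (induction j)
      case 0
      then show ?case
        using elems_singles[OF mdefs_env[OF A e]] by (simp add: v_def iterates_def Ws_def)
    next
      case (Suc j)
      \<comment> \<open>The iterates are themselves recursions with joins, so \<open>next_v\<close>
        already contains the join with the previous iterate.\<close>
      have "v (Suc j) = next_v e (v j)"
        by (simp add: v_def iterates_def next_v_def)
      moreover have "next_v e (v j) \<in> env S p"
        using calculation v[of "Suc j"] by simp
      moreover have "listset (map (elems S) (singles p (next_v e (v j)))) \<subseteq> listset (map (elems S) (U (e @ Ws j e)))"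
        using U(2)[rule_format, OF env_append[OF e Ws_env], of "v j" j] Suc e Ws_env[of j]
        by (simp add: env_length)
      ultimately have "v (Suc j) \<in> listset (map (elems S) (U (e @ Ws j e)))"
        by (simp add: elems_singles)
      then show ?case
        using listset_joins(2)[OF Ws_env U_env[OF Ws_env]] by (auto simp: Ws_def)
    qed
    have s_mono: "s k \<subseteq> s l" if "k \<le> l" for k l
      unfolding s_def Es_def using D_env X_env that by (rule listset_jrec_mono)
    have v_W: "v j \<in> listset (map (elems S) (W e))" if "j \<le> nat_of S (M e)" for j
      using v_Ws[of j] listset_jrec_mono[OF A_env _ that, of "\<lambda>w. U (e @ w)"] U_env by (auto simp: W_def Ws_def)
    have step: "listset (map (elems S) (map (\<lambda>g. app_list S g (M e # v j @ b)) (G e))) \<subseteq> s (Suc k)"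
      if "j \<le> nat_of S (M e)" "b \<in> s k" for j k b
    proof -
      have "v j @ b \<in> listset (map (elems S) (W e @ Es k e))"
        using v_W[OF that(1)] that(2) by (auto simp: s_def listset_iff nth_append)
      then have "listset (map (elems S) (map (\<lambda>g. app_list S g (M e # v j @ b)) (G e))) \<subseteq>
          listset (map (elems S) (X (e @ Es k e)))"
        using X(2)[rule_format, OF env_append[OF e Es_env], of "v j @ b" k] e Es_env[of k]
        by (simp add: env_length del: app_list_simps)
      also have "\<dots> \<subseteq> s (Suc k)"
        using listset_joins(2)[OF Es_env X_env[OF Es_env]] by (simp add: s_def Es_def)
      finally show ?thesis .
    qed
    have "D e \<in> s 0"
      using elems_singles[OF mdefs_env[OF D e]] by (simp add: s_def Es_def)
    with s_mono v_W step
    show "\<exists>s. s (nat_of S (M e)) = listset (map (elems S) (E e)) \<and>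
      D e \<in> s 0 \<and> (\<forall>k l. k \<le> l \<longrightarrow> s k \<subseteq> s l) \<and>
      (\<forall>j\<le>nat_of S (M e). iterates p j (M e) (A e) (F e) \<in> listset (map (elems S) (W e)) \<and>
        (\<forall>k. \<forall>b\<in>s k. listset (map (elems S) (map (\<lambda>g. app_list S g (M e # iterates p j (M e) (A e) (F e) @ b)) (G e)))
          \<subseteq> s (Suc k)))"
      by (intro exI[of _ s]) (simp add: v_def[symmetric] s_def E_def del: app_list_simps)
  qed
qed

lemma listset_append:
  "xs \<in> listset As \<Longrightarrow> ys \<in> listset Bs \<Longrightarrow> xs @ ys \<in> listset (As @ Bs)"
  by (auto simp: listset_iff nth_append)

text \<open>The second half of \<open>smaj\<close> at set types says that all members of a monotone
  set are monotone, so the intersection in \<open>tuples_in\<close> removes nothing.\<close>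

lemma tuples_in_eq_listset:
  assumes "as \<in> mon_tuples S (map Star \<sigma>s)"
  shows "tuples_in S \<sigma>s as = listset (map (elems S) as)"
proof -
  have "x \<in> Mon S (\<sigma>s ! i)" if "i < length \<sigma>s" "x \<in> elems S (as ! i)" for x i
    using assms that elems_subset[of "as ! i" "\<sigma>s ! i"] by (auto simp: mon_tuples_iff Mon_def)
  moreover have "length as = length \<sigma>s"
    using assms by (simp add: mon_tuples_iff)
  ultimately show ?thesis
    by (auto simp: tuples_in_def listset_iff mon_tuples_iff)
qed

text \<open>Each further step is a join whose left argument already realizes the formula, so a good
  iterate stays good.\<close>

lemma interp_jrec:
  assumes "w \<in> mon_tuples S (pos (I_mb S) C)"
    and f: "\<And>v. v \<in> mon_tuples S (pos (I_mb S) C) \<Longrightarrow> f v \<in> mon_tuples S (pos (I_mb S) C)"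
    and "bs \<in> mon_tuples S (neg (I_mb S) C)" "j \<le> k"
    and "interp S (I_mb S) C e (jrec S (pos (I_mb S) C) j w f) bs"
  shows "interp S (I_mb S) C e (jrec S (pos (I_mb S) C) k w f) bs"
  using \<open>j \<le> k\<close>
proof (induction k rule: dec_induct)
  case (step k)
  have "jrec S (pos (I_mb S) C) k w f \<in> mon_tuples S (pos (I_mb S) C)"
    using assms arith_pos by (intro jrec_mon) auto
  with step f assms(3) show ?case
    by (auto intro!: interp_joins)
qed (rule assms)

lemma nat_ind_interpretable:
  "I_interpretable S (I_mb S) \<Gamma>
     (Imp (And (inst 0 (Con Zero) D) (All N (Imp D (inst 1 (Con Succ \<bullet> Var 0) D)))) (All N D))"
proof -
  define C where "C = relativize D"
  define p n where "p = pos (I_mb S) C" and "n = neg (I_mb S) C"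
  define C0 where "C0 = inst 0 (Con Zero) C"
  define C1 where "C1 = inst 1 (Con Succ \<bullet> Var 0) C"
  define Step where "Step = All N (Imp (Ipred N (Var 0)) (Imp C C1))"
  \<comment> \<open>Types of the step witnesses: \<open>FT\<close> leads from a witness of D(n) to
    one of D(n+1), \<open>GT\<close> from a challenge to D(n+1) back to challenges to D(n). The
    leading \<open>N\<close> is the bound on n that comes with \<open>Ipred N\<close>.\<close>
  define FT GT where "FT = map (arrs (N # p)) p" and "GT = map (arrs (N # p @ n)) (map Star n)"
  have arith: "list_all arith_star_type p" "list_all arith_star_type n"
    by (simp_all add: p_def n_def arith_pos arith_neg)
  have pn: "pos (I_mb S) C0 = p" "neg (I_mb S) C0 = n" "pos (I_mb S) C1 = p" "neg (I_mb S) C1 = n"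
    by (simp_all add: C0_def C1_def p_def n_def)
  have posP: "pos (I_mb S) (And C0 Step) = p @ FT @ GT"
    by (simp add: pn Step_def FT_def GT_def p_def[symmetric] n_def[symmetric] comp_def)
  have negP: "neg (I_mb S) (And C0 Step) = n @ N # p @ n"
    by (simp add: pn Step_def p_def[symmetric] n_def[symmetric])
  let ?Q = "All N (Imp (Ipred N (Var 0)) C)"
  have posQ: "pos (I_mb S) ?Q = map (arrs [N]) p" and negQ: "neg (I_mb S) ?Q = N # n"
    by (simp_all add: p_def n_def)
  have p_n: "pos (I_mb S) C = p" "neg (I_mb S) C = n"
    by (simp_all add: p_def n_def)
  have len: "length FT = length p" "length GT = length n"
    by (simp_all add: FT_def GT_def)
  \<comment> \<open>The arguments are laid out as \<open>a1 @ fs @ gs @ m # d'\<close>: the witness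
    of D(0), the forward and the backward part of the step, the bound, and the challenge to
    D.\<close>
  define M where "M e = e ! length (p @ FT @ GT)" for e :: "'u list"
  define F where "F e = take (length FT) (drop (length p) e)" for e :: "'u list"
  define G where "G e = take (length GT) (drop (length (p @ FT)) e)" for e :: "'u list"
  define A where "A e = take (length p) e" for e :: "'u list"
  define X where "X e = drop (length (p @ FT @ GT @ [N])) e" for e :: "'u list"
  have defs: "mdef (p @ FT @ GT @ N # \<Delta>) N M" "mdefs (p @ FT @ GT @ N # \<Delta>) p A"
    "mdefs (p @ FT @ GT @ N # \<Delta>) FT F" "mdefs (p @ FT @ GT @ N # \<Delta>) GT G"
    "mdefs (p @ FT @ GT @ N # \<Delta>) \<Delta> X" for \<Delta>
    unfolding M_def A_def F_def G_def X_def
    using mdefs_take[of p] mdefs_slice[of "p @ FT @ GT @ N # \<Delta>" p FT] mdefs_slice[of "p @ FT @ GT @ N # \<Delta>" "p @ FT" GT]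
      mdefs_drop[of "p @ FT @ GT @ [N]" \<Delta>]
    by (auto intro: mdef_var simp: nth_append)
  \<comment> \<open>The witness of the conclusion at the bound \<open>m\<close> is the
    \<open>m\<close>-th iterate.\<close>
  have "mdefs ((p @ FT @ GT) @ [N]) p (\<lambda>e. iterates p (nat_of S (M e)) (M e) (A e) (F e))"
    using mdefs_iterates[OF arith(1), folded FT_def, OF defs(1-3)[of "[]"]] by simp
  from mdefs_abs_list[OF this] obtain V where V: "mdefs (p @ FT @ GT) (map (arrs [N]) p) V"
    "\<forall>e\<in>env S (p @ FT @ GT). \<forall>xs\<in>env S [N]. map (\<lambda>f. app_list S f xs) (V e) =
      iterates p (nat_of S (M (e @ xs))) (M (e @ xs)) (A (e @ xs)) (F (e @ xs))"
    by blast
  obtain W E where WE: "mdefs (p @ FT @ GT @ N # n) (map Star p) W" "mdefs (p @ FT @ GT @ N # n) (map Star n) E"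
    and s_ex: "\<And>e. e \<in> env S (p @ FT @ GT @ N # n) \<Longrightarrow> \<exists>s. s (nat_of S (M e)) = listset (map (elems S) (E e)) \<and>
      X e \<in> s 0 \<and> (\<forall>k l. k \<le> l \<longrightarrow> s k \<subseteq> s l) \<and>
      (\<forall>j\<le>nat_of S (M e). iterates p j (M e) (A e) (F e) \<in> listset (map (elems S) (W e)) \<and>
        (\<forall>k. \<forall>b\<in>s k. listset (map (elems S) (map (\<lambda>g. app_list S g (M e # iterates p j (M e) (A e) (F e) @ b)) (G e)))
          \<subseteq> s (Suc k)))"
    by (rule induction_challenges[OF arith, folded FT_def GT_def, OF defs]) blast
  have "realizable (env S \<Gamma>) (Imp (And C0 Step) ?Q)"
  proof (rule realizable_Imp, unfold posP negP posQ negQ)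
    show "mdefs (p @ FT @ GT) (map (arrs [N]) p) V"
      by (rule V(1))
    \<comment> \<open>In the order of the negative witnesses of the premise: challenges to D(0),
      then for the induction step the bound, the iterates, and the challenges to D(n+1).\<close>
    let ?g = "\<lambda>e. E e @ mk_set S N {M e} # W e @ E e"
    have "mdefs (p @ FT @ GT @ N # n) (map Star n @ Star N # map Star p @ map Star n) ?g"
      by (intro mdefs_append mdefs_Cons mdef_Single WE defs)
    then show "mdefs ((p @ FT @ GT) @ N # n) (map Star (n @ N # p @ n)) ?g"
      by simp
    fix e0 a d
    assume a: "a \<in> mon_tuples S (p @ FT @ GT)" and d: "d \<in> mon_tuples S (N # n)"
      and prem: "\<forall>b\<in>tuples_in S (n @ N # p @ n) (?g (a @ d)). interp S (I_mb S) (And C0 Step) e0 a b"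
    obtain a1 fs gs where a1: "a = a1 @ fs @ gs" "a1 \<in> mon_tuples S p" "fs \<in> mon_tuples S FT"
      "gs \<in> mon_tuples S GT"
      using a by (auto elim!: mon_tuples_appendE)
    obtain m d' where d': "d = m # d'" "m \<in> Mon S N" "d' \<in> mon_tuples S n"
      using d by (auto simp: mon_tuples_Cons)
    have lens: "length a1 = length p" "length fs = length p" "length gs = length n"
      using a1 len by (simp_all add: mon_tuples_length)
    have proj: "M (a @ d) = m" "A (a @ d) = a1" "F (a @ d) = fs" "G (a @ d) = gs" "X (a @ d) = d'"
      using lens len by (simp_all add: a1(1) d'(1) M_def A_def F_def G_def X_def nth_append)
    have e: "a @ d \<in> mon_tuples S (p @ FT @ GT @ N # n)"
      using mon_tuples_append[OF a d] by simp
    define K where "K = nat_of S m"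
    define step where "step v = map (\<lambda>f. app_list S f (m # v)) fs" for v
    define v where "v j = iterates p j m a1 fs" for j
    have v_jrec: "v j = jrec S p j a1 step" for j
      by (simp add: v_def iterates_def step_def[abs_def])
    have step_mon: "step w \<in> mon_tuples S p" if "w \<in> mon_tuples S p" for w
      unfolding step_def using a1(3) d'(2) that by (intro map_app_list_mon[of _ "N # p"]) (simp_all add: FT_def)
    have v_mon: "v j \<in> mon_tuples S p" for j
      unfolding v_jrec using arith(1) a1(2) step_mon by (rule jrec_mon)
    obtain s where s: "s K = listset (map (elems S) (E (a @ d)))" "d' \<in> s 0"
      "\<And>k l. k \<le> l \<Longrightarrow> s k \<subseteq> s l"
      "\<And>j. j \<le> K \<Longrightarrow> v j \<in> listset (map (elems S) (W (a @ d)))"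
      "\<And>j k b. j \<le> K \<Longrightarrow> b \<in> s k \<Longrightarrow>
        listset (map (elems S) (map (\<lambda>g. app_list S g (m # v j @ b)) gs)) \<subseteq> s (Suc k)"
      using s_ex[OF mon_tuples_env[OF e], unfolded proj, folded K_def v_def] by metis
    have E_mon: "E (a @ d) \<in> mon_tuples S (map Star n)" and W_mon: "W (a @ d) \<in> mon_tuples S (map Star p)"
      using mdefs_mon[OF WE(2) e] mdefs_mon[OF WE(1) e] by blast+
    have s_mon: "b \<in> mon_tuples S n" if "b \<in> s K" for b
      using that tuples_in_eq_listset[OF E_mon] by (auto simp: s(1) tuples_in_def)
    \<comment> \<open>A counter-witness of the conjunction always addresses D(0) and the step
      together. Each later use concerns one of them and fills the other part with some member of
      \<open>s K\<close>.\<close>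
    have prem': "interp S (I_mb S) C0 e0 a1 b0 \<and> interp S (I_mb S) Step e0 (fs @ gs) (m # v j @ b)"
      if b: "b0 \<in> s K" "b \<in> s K" and j: "j \<le> K" for b0 b j
    proof -
      have "m \<in> elems S (mk_set S N {m})"
        using d'(2) by (simp add: elems_mk_set Mon_def)
      with b j have "b0 @ m # v j @ b \<in> listset (map (elems S) (?g (a @ d)))"
        unfolding map_append list.map proj by (intro listset_append) (simp_all add: s set_Cons_def listset_append)
      moreover have "b0 @ m # v j @ b \<in> mon_tuples S (n @ N # p @ n)"
        using b v_mon d'(2) s_mon by (intro mon_tuples_append) (simp_all add: mon_tuples_append)
      ultimately have "interp S (I_mb S) (And C0 Step) e0 a (b0 @ m # v j @ b)"
        using prem by (simp add: tuples_in_def del: interp.simps)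
      then show ?thesis
        using lens s_mon[OF b(1)] by (simp add: pn a1(1) mon_tuples_length)
    qed
    \<comment> \<open>The index of \<open>s\<close> decreases as \<open>j\<close> grows. A challenge
      in \<open>s (K - Suc j)\<close> at stage \<open>Suc j\<close> leads back to challenges in
      \<open>s (Suc (K - Suc j)) = s (K - j)\<close> at stage \<open>j\<close>, where the induction
      hypothesis applies. At stage 0 one arrives in \<open>s K\<close>, the box given by
      \<open>E\<close>.\<close>
    have claim: "interp S (I_mb S) C (num S j # e0) (v j) b" if "j \<le> K" "b \<in> s (K - j)" for j b
      using that
    proof (induction j arbitrary: b)
      case 0
      then have "interp S (I_mb S) C0 e0 a1 b"
        using prem'[of b d' 0] s(2) s(3)[of 0 K] by auto
      then show ?case
        by (simp add: C0_def interp_inst v_jrec)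
    next
      case (Suc j)
      have j: "j \<le> K" "Suc (K - Suc j) = K - j"
        using Suc.prems(1) by simp_all
      have bK: "b \<in> s K"
        using Suc.prems(2) s(3)[of "K - Suc j" K] by auto
      then have b_mon: "b \<in> mon_tuples S n"
        by (rule s_mon)
      have "interp S (I_mb S) C (num S j # e0) (v j) b'"
        if "b' \<in> tuples_in S n (map (\<lambda>g. app_list S g (m # v j @ b)) gs)" for b'
        using that Suc.IH[OF j(1), of b'] s(5)[OF j(1) Suc.prems(2)] unfolding j(2) tuples_in_def by blast
      \<comment> \<open>The step is used for the number \<open>j\<close> with the bound
        \<open>m\<close>; this is where \<open>j \<le> K\<close> enters.\<close>
      moreover have "interp S (I_mb S) Step e0 (fs @ gs) (m # v j @ b)"
        using prem'[of b b j] bK j(1) by blast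
      ultimately have "interp S (I_mb S) C1 (num S j # e0) (step (v j)) b"
        using lens j(1) v_mon[of j]
        by (simp add: Step_def pn p_n Let_def tuples_in_def K_def step_def comp_def mon_tuples_length FT_def GT_def)
      then have "interp S (I_mb S) C (num S (Suc j) # e0) (step (v j)) b"
        by (simp add: C1_def interp_inst del: const_val.simps)
      \<comment> \<open>\<open>v j\<close> was good for D(j), and only the new part is known to be
        good for D(j+1). \<open>interp_joins\<close> accepts one good part on either side.\<close>
      then have "interp S (I_mb S) C (num S (Suc j) # e0) (joins S p (v j) (step (v j))) b"
        using interp_joins[of "v j" C "step (v j)" b] v_mon[of j] step_mon b_mon unfolding p_n by blast
      then show ?case
        by (simp add: v_jrec)
    qed
    have "map (\<lambda>f. app_list S f [m]) (V a) = v K"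
      using V(2)[rule_format, OF mon_tuples_env[OF a], of "[m]"] d'(2) lens len
      by (simp add: a1(1) M_def A_def F_def nth_append Mon_def K_def v_def)
    \<comment> \<open>The iterate that belongs to \<open>x\<close> is good for \<open>x\<close>, and
      the remaining iterations up to \<open>K\<close> preserve this. The challenge \<open>d'\<close>
      is in every \<open>s k\<close>, so the claim can be applied at any stage.\<close>
    moreover have "interp S (I_mb S) C (x # e0) (v K) d'" if x: "x \<in> Dom S N" "nat_of S x \<le> K" for x
    proof -
      have "d' \<in> s (K - nat_of S x)"
        using s(2) s(3)[of 0 "K - nat_of S x"] by auto
      then have "interp S (I_mb S) C (x # e0) (v (nat_of S x)) d'"
        using claim[OF x(2)] x(1) by simp
      with x(2) show ?thesis
        unfolding v_jrec using interp_jrec[of a1 C step d', unfolded p_n] a1(2) step_mon d'(3) by blast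
    qed
    moreover have "length (V a) = length p"
      using mdefs_length[OF V(1) mon_tuples_env[OF a]] by simp
    ultimately show "interp S (I_mb S) ?Q e0 (V a) d"
      by (simp add: d'(1) p_n Let_def tuples_in_def K_def)
  qed
  then show ?thesis
    by (intro I_interpretableI) (simp add: C_def C0_def C1_def Step_def)
qed

end

section \<open>Majorants of the constants\<close>

fun daggers :: "ty list \<Rightarrow> ty list" where
  "daggers [] = []"
| "daggers (\<sigma> # \<Gamma>) = (case dagger \<sigma> of None \<Rightarrow> daggers \<Gamma> | Some \<sigma>' \<Rightarrow> \<sigma>' # daggers \<Gamma>)"

text \<open>In \<open>majs S \<Gamma> xs as\<close>, the list \<open>as\<close> has an entry only for each unbounded type in \<open>\<Gamma>\<close>.\<close>

fun majs :: "'u type_structure \<Rightarrow> ty list \<Rightarrow> 'u list \<Rightarrow> 'u list \<Rightarrow> bool" where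
  "majs S [] xs as \<longleftrightarrow> xs = [] \<and> as = []"
| "majs S (\<sigma> # \<Gamma>) xs as \<longleftrightarrow> (\<exists>x xs'. xs = x # xs' \<and> x \<in> Dom S \<sigma> \<and>
     (case dagger \<sigma> of
        None \<Rightarrow> majs S \<Gamma> xs' as
      | Some \<sigma>' \<Rightarrow> \<exists>a as'. as = a # as' \<and> a \<in> Dom S \<sigma>' \<and> maj S \<sigma> x a \<and> majs S \<Gamma> xs' as'))"

lemma daggers_append: "daggers (\<Gamma> @ \<Delta>) = daggers \<Gamma> @ daggers \<Delta>"
  by (induction \<Gamma>) (auto split: option.splits)

lemma dagger_arrs:
  "dagger (arrs \<Gamma> \<tau>) = (case dagger \<tau> of None \<Rightarrow> None | Some \<tau>' \<Rightarrow> Some (arrs (daggers \<Gamma>) \<tau>'))"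
  by (induction \<Gamma>) (auto split: option.splits)

lemma step_type_eq: "step_type \<sigma>s = arrs (N # \<sigma>s)"
  by (rule ext) (simp add: step_type_def)

text \<open>Translating the steps of a simultaneous recursion gives the steps of a recursion on the
  unbounded components alone. Hence the majorant can be an iteration at
  \<open>daggers \<sigma>s\<close>.\<close>

lemma daggers_step_type: "daggers (map (step_type \<sigma>s) \<Gamma>) = map (step_type (daggers \<sigma>s)) (daggers \<Gamma>)"
  by (induction \<Gamma>) (auto simp: step_type_def dagger_arrs split: option.splits)

lemma arith_daggers: "list_all arith_star_type (daggers \<Gamma>)"
  by (induction \<Gamma>) (auto simp: dagger_arith split: option.splits)

text \<open>Bounded types leave no entry, so the position of a component is the number of unbounded
  types before it.\<close>

lemma daggers_nth:
  assumes "i < length \<sigma>s" "dagger (\<sigma>s ! i) = Some \<tau>"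
  shows "length (daggers (take i \<sigma>s)) < length (daggers \<sigma>s)" "daggers \<sigma>s ! length (daggers (take i \<sigma>s)) = \<tau>"
proof -
  have "\<sigma>s = take i \<sigma>s @ \<sigma>s ! i # drop (Suc i) \<sigma>s"
    using assms(1) by (rule id_take_nth_drop)
  from arg_cong[OF this, of daggers] assms(2)
  have *: "daggers \<sigma>s = daggers (take i \<sigma>s) @ \<tau> # daggers (drop (Suc i) \<sigma>s)"
    by (simp only: daggers_append daggers.simps option.case)
  show "length (daggers (take i \<sigma>s)) < length (daggers \<sigma>s)"
    by (subst *) simp
  show "daggers \<sigma>s ! length (daggers (take i \<sigma>s)) = \<tau>"
    by (subst *) simp
qed

context star_structure
begin

lemma majs_env: "majs S \<Gamma> xs as \<Longrightarrow> as \<in> env S (daggers \<Gamma>)"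
  by (induction \<Gamma> arbitrary: xs as) (auto split: option.splits)

lemma majs_env_left: "majs S \<Gamma> xs as \<Longrightarrow> xs \<in> env S \<Gamma>"
  by (induction \<Gamma> arbitrary: xs as) (auto split: option.splits)

lemma majs_mon: "majs S \<Gamma> xs as \<Longrightarrow> as \<in> mon_tuples S (daggers \<Gamma>)"
  by (induction \<Gamma> arbitrary: xs as) (auto simp: Mon_def maj_refl_right split: option.splits)

lemma majs_appendE:
  assumes "majs S (\<Gamma> @ \<Delta>) xs as"
  obtains xs1 xs2 as1 as2 where "xs = xs1 @ xs2" "as = as1 @ as2" "majs S \<Gamma> xs1 as1" "majs S \<Delta> xs2 as2"
proof -
  have "\<exists>xs1 xs2 as1 as2. xs = xs1 @ xs2 \<and> as = as1 @ as2 \<and> majs S \<Gamma> xs1 as1 \<and> majs S \<Delta> xs2 as2"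
    using assms
  proof (induction \<Gamma> arbitrary: xs as)
    case (Cons \<sigma> \<Gamma>)
    from Cons.prems obtain x xs' where xs: "xs = x # xs'" "x \<in> Dom S \<sigma>"
      by auto
    show ?case
    proof (cases "dagger \<sigma>")
      case None
      with Cons.prems xs have "majs S (\<Gamma> @ \<Delta>) xs' as"
        by simp
      from Cons.IH[OF this] obtain xs1 xs2 as1 as2
        where "xs' = xs1 @ xs2" "as = as1 @ as2" "majs S \<Gamma> xs1 as1" "majs S \<Delta> xs2 as2"
        by blast
      with xs None show ?thesis
        by (intro exI[of _ "x # xs1"] exI[of _ xs2] exI[of _ as1] exI[of _ as2]) simp
    next
      case (Some \<sigma>')
      with Cons.prems xs obtain a as' where a: "as = a # as'" "a \<in> Dom S \<sigma>'" "maj S \<sigma> x a"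
        "majs S (\<Gamma> @ \<Delta>) xs' as'"
        by auto
      from Cons.IH[OF a(4)] obtain xs1 xs2 as1 as2
        where "xs' = xs1 @ xs2" "as' = as1 @ as2" "majs S \<Gamma> xs1 as1" "majs S \<Delta> xs2 as2"
        by blast
      with xs Some a show ?thesis
        by (intro exI[of _ "x # xs1"] exI[of _ xs2] exI[of _ "a # as1"] exI[of _ as2]) simp
    qed
  qed simp
  with that show ?thesis
    by blast
qed

lemma majs_tmaj:
  "majs S \<Gamma> xs as \<Longrightarrow> bs \<in> env S (daggers \<Gamma>) \<Longrightarrow> tmaj (daggers \<Gamma>) as bs \<Longrightarrow> majs S \<Gamma> xs bs"
proof (induction \<Gamma> arbitrary: xs as bs)
  case (Cons \<sigma> \<Gamma>)
  then show ?case
    by (cases "dagger \<sigma>") (auto simp: env_Cons intro: maj_smaj)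
qed simp

lemma majs_nth:
  "majs S \<Gamma> xs as \<Longrightarrow> i < length \<Gamma> \<Longrightarrow> dagger (\<Gamma> ! i) = Some \<tau> \<Longrightarrow>
    maj S (\<Gamma> ! i) (xs ! i) (as ! length (daggers (take i \<Gamma>)))"
proof (induction \<Gamma> arbitrary: xs as i)
  case (Cons \<sigma> \<Gamma>)
  then show ?case
    by (cases i) (auto split: option.splits)
qed simp

text \<open>Reduces majorization of a curried function to full application. At function types
  \<open>maj\<close> also demands a monotone majorant, which the values at majorized arguments do
  not show; hence the separate premise on \<open>g\<close>.\<close>

lemma maj_arrsI:
  assumes "dagger \<tau> = Some \<tau>'"
  shows "smaj S (arrs (daggers \<Gamma>) \<tau>') g g \<Longrightarrow>
    (\<And>xs as. majs S \<Gamma> xs as \<Longrightarrow> maj S \<tau> (app_list S f xs) (app_list S g as)) \<Longrightarrow>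
    maj S (arrs \<Gamma> \<tau>) f g"
proof (induction \<Gamma> arbitrary: f g)
  case Nil
  then show ?case
    using Nil(2)[of "[]" "[]"] by simp
next
  case (Cons \<sigma> \<Gamma>)
  note [simp] = dagger_arrs assms
  show ?case
  proof (cases "dagger \<sigma>")
    case None
    have "maj S (arrs \<Gamma> \<tau>) (app S f x) g" if "x \<in> Dom S \<sigma>" for x
    proof (rule Cons.IH)
      show "smaj S (arrs (daggers \<Gamma>) \<tau>') g g"
        using Cons.prems(1) None by simp
      show "maj S \<tau> (app_list S (app S f x) xs) (app_list S g as)" if "majs S \<Gamma> xs as" for xs as
        using Cons.prems(2)[of "x # xs" as] that None \<open>x \<in> Dom S \<sigma>\<close> by simp
    qed
    with None Cons.prems(1) show ?thesis
      by simp
  next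
    case (Some \<sigma>')
    have "maj S (arrs \<Gamma> \<tau>) (app S f x) (app S g a)"
      if xa: "x \<in> Dom S \<sigma>" "a \<in> Dom S \<sigma>'" "maj S \<sigma> x a" for x a
    proof (rule Cons.IH)
      show "smaj S (arrs (daggers \<Gamma>) \<tau>') (app S g a) (app S g a)"
        using Cons.prems(1) Some xa maj_refl_right[OF Some xa(3)] by simp
      show "maj S \<tau> (app_list S (app S f x) xs) (app_list S (app S g a) as)" if "majs S \<Gamma> xs as" for xs as
        using Cons.prems(2)[of "x # xs" "a # as"] that Some xa by simp
    qed
    with Some Cons.prems(1) show ?thesis
      by simp
  qed
qed

lemma maj_arrsD:
  assumes "dagger \<tau> = Some \<tau>'"
  shows "maj S (arrs \<Gamma> \<tau>) f g \<Longrightarrow> majs S \<Gamma> xs as \<Longrightarrow> maj S \<tau> (app_list S f xs) (app_list S g as)"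
proof (induction \<Gamma> arbitrary: f g xs as)
  case (Cons \<sigma> \<Gamma>)
  then show ?case
    by (cases "dagger \<sigma>") auto
qed simp

lemma majs_map_app_list:
  assumes "majs S \<Gamma> xs as"
  shows "majs S (map (arrs \<Gamma>) \<tau>s) fs gs \<Longrightarrow>
    majs S \<tau>s (map (\<lambda>f. app_list S f xs) fs) (map (\<lambda>g. app_list S g as) gs)"
proof (induction \<tau>s arbitrary: fs gs)
  case (Cons \<tau> \<tau>s)
  then obtain f fs' where fs: "fs = f # fs'" "f \<in> Dom S (arrs \<Gamma> \<tau>)"
    by auto
  have f: "app_list S f xs \<in> Dom S \<tau>"
    using fs(2) majs_env_left[OF assms] by (rule app_list_Dom)
  show ?case
  proof (cases "dagger \<tau>")
    case None
    with Cons fs f show ?thesis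
      by (simp add: dagger_arrs)
  next
    case (Some \<tau>')
    with Cons.prems fs obtain g gs' where g: "gs = g # gs'" "g \<in> Dom S (arrs (daggers \<Gamma>) \<tau>')"
      "maj S (arrs \<Gamma> \<tau>) f g" "majs S (map (arrs \<Gamma>) \<tau>s) fs' gs'"
      by (auto simp: dagger_arrs)
    have "app_list S g as \<in> Dom S \<tau>'"
      using g(2) majs_env[OF assms] by (rule app_list_Dom)
    with Some fs f g Cons.IH maj_arrsD[OF Some g(3) assms] show ?thesis
      by simp
  qed
qed simp

text \<open>If the result type is bounded, so is the type of the constant, and there is nothing to
  realize. Otherwise the majorant is a function of bounds for the unbounded arguments alone.\<close>

lemma realizable_const:
  assumes "const_type c = arrs \<Gamma> \<tau>"
    and "\<And>\<tau>'. dagger \<tau> = Some \<tau>' \<Longrightarrow>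
      \<exists>G. mdef (daggers \<Gamma>) \<tau>' G \<and> (\<forall>xs as. majs S \<Gamma> xs as \<longrightarrow> maj S \<tau> (app_list S (const_val S c) xs) (G as))"
  shows "realizable E (Ipred (const_type c) (Con c))"
proof (cases "dagger \<tau>")
  case None
  then show ?thesis
    unfolding realizable_def assms(1) by (auto simp: dagger_arrs)
next
  case (Some \<tau>')
  from assms(2)[OF Some] obtain G where G: "mdef (daggers \<Gamma>) \<tau>' G"
    "\<forall>xs as. majs S \<Gamma> xs as \<longrightarrow> maj S \<tau> (app_list S (const_val S c) xs) (G as)"
    by blast
  have "mdef ([] @ daggers \<Gamma>) \<tau>' G"
    using G(1) by simp
  from mdef_abs_list[OF this] obtain H where H: "mdef [] (arrs (daggers \<Gamma>) \<tau>') H"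
    "\<forall>e\<in>env S []. \<forall>xs\<in>env S (daggers \<Gamma>). app_list S (H e) xs = G (e @ xs)"
    by blast
  have "maj S (arrs \<Gamma> \<tau>) (const_val S c) (H [])"
  proof (rule maj_arrsI[OF Some])
    show "smaj S (arrs (daggers \<Gamma>) \<tau>') (H []) (H [])"
      using mdef_Mon[OF H(1), of "[]"] by (simp add: Mon_def)
    show "maj S \<tau> (app_list S (const_val S c) xs) (app_list S (H []) as)" if "majs S \<Gamma> xs as" for xs as
      using H(2) G(2) that majs_env[OF that] by simp
  qed
  moreover have "mdefs [] [arrs (daggers \<Gamma>) \<tau>'] (\<lambda>e. [H e])"
    using H(1) by (simp add: mdefs_def)
  ultimately show ?thesis
    unfolding realizable_def using assms(1) Some
    by (intro exI[of _ "\<lambda>e. [H e]"]) (simp add: dagger_arrs del: const_val.simps)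
qed

section \<open>The individual constants\<close>

lemma realizable_CPi: "realizable E (Ipred (const_type (CPi \<sigma> \<tau>)) (Con (CPi \<sigma> \<tau>)))"
proof (rule realizable_const[of _ "[\<sigma>, \<tau>]" \<sigma>])
  fix \<sigma>' assume "dagger \<sigma> = Some \<sigma>'"
  then show "\<exists>G. mdef (daggers [\<sigma>, \<tau>]) \<sigma>' G \<and>
      (\<forall>xs as. majs S [\<sigma>, \<tau>] xs as \<longrightarrow> maj S \<sigma> (app_list S (const_val S (CPi \<sigma> \<tau>)) xs) (G as))"
    by (intro exI[of _ "\<lambda>e. e ! 0"] conjI mdef_var)
      (auto simp del: const_val.simps split: option.splits)
qed simp

lemma maj_bounded: "dagger \<sigma> = None \<Longrightarrow> maj S (\<sigma> \<rightarrow> \<tau>) f c \<Longrightarrow> x \<in> Dom S \<sigma> \<Longrightarrow> maj S \<tau> (app S f x) c"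
  and maj_unbounded: "dagger \<sigma> = Some \<sigma>' \<Longrightarrow> maj S (\<sigma> \<rightarrow> \<tau>) f g \<Longrightarrow> x \<in> Dom S \<sigma> \<Longrightarrow> a \<in> Dom S \<sigma>' \<Longrightarrow>
    maj S \<sigma> x a \<Longrightarrow> maj S \<tau> (app S f x) (app S g a)"
  by simp_all

text \<open>An argument of bounded type disappears from the majorant together with the application
  to it. For unbounded \<tau>, the term x z (y z) shrinks to x if \<rho> and \<sigma> are bounded,
  to x z if only \<sigma> is, and to x y if only \<rho> is.\<close>

lemma realizable_CSigma: "realizable E (Ipred (const_type (CSigma \<rho> \<sigma> \<tau>)) (Con (CSigma \<rho> \<sigma> \<tau>)))"
proof (rule realizable_const[of _ "[\<rho> \<rightarrow> \<sigma> \<rightarrow> \<tau>, \<rho> \<rightarrow> \<sigma>, \<rho>]" \<tau>])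
  fix \<tau>' assume \<tau>': "dagger \<tau> = Some \<tau>'"
  let ?\<Gamma> = "[\<rho> \<rightarrow> \<sigma> \<rightarrow> \<tau>, \<rho> \<rightarrow> \<sigma>, \<rho>]"
  note [simp del] = maj.simps const_val.simps
  show "\<exists>G. mdef (daggers ?\<Gamma>) \<tau>' G \<and>
      (\<forall>xs as. majs S ?\<Gamma> xs as \<longrightarrow> maj S \<tau> (app_list S (const_val S (CSigma \<rho> \<sigma> \<tau>)) xs) (G as))"
  proof (cases "dagger \<sigma>")
    case \<sigma>: None
    show ?thesis
    proof (cases "dagger \<rho>")
      case \<rho>: None
      have "mdef (daggers ?\<Gamma>) \<tau>' (\<lambda>e. e ! 0)"
        using \<rho> \<sigma> \<tau>' by (intro mdef_var) simp_all
      with \<rho> \<sigma> \<tau>' show ?thesis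
        by (intro exI[of _ "\<lambda>e. e ! 0"]) (auto intro!: maj_bounded[OF \<sigma> maj_bounded[OF \<rho>] app_Dom[of _ \<rho> \<sigma>]])
    next
      case \<rho>: (Some \<rho>')
      have "mdef (daggers ?\<Gamma>) \<tau>' (\<lambda>e. app S (e ! 0) (e ! 1))"
        using \<rho> \<sigma> \<tau>' by (intro mdef_app[of _ \<rho>'] mdef_var) simp_all
      with \<rho> \<sigma> \<tau>' show ?thesis
        by (intro exI[of _ "\<lambda>e. app S (e ! 0) (e ! 1)"])
          (auto intro!: maj_bounded[OF \<sigma> maj_unbounded[OF \<rho>] app_Dom[of _ \<rho> \<sigma>]])
    qed
  next
    case \<sigma>: (Some \<sigma>')
    show ?thesis
    proof (cases "dagger \<rho>")
      case \<rho>: None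
      have "mdef (daggers ?\<Gamma>) \<tau>' (\<lambda>e. app S (e ! 0) (e ! 1))"
        using \<rho> \<sigma> \<tau>' by (intro mdef_app[of _ \<sigma>'] mdef_var) simp_all
      with \<rho> \<sigma> \<tau>' show ?thesis
        by (intro exI[of _ "\<lambda>e. app S (e ! 0) (e ! 1)"])
          (auto intro!: maj_unbounded[OF \<sigma> maj_bounded[OF \<rho>] app_Dom[of _ \<rho> \<sigma>] _ maj_bounded[OF \<rho>]])
    next
      case \<rho>: (Some \<rho>')
      have "mdef (daggers ?\<Gamma>) \<tau>' (\<lambda>e. app S (app S (e ! 0) (e ! 2)) (app S (e ! 1) (e ! 2)))"
        using \<rho> \<sigma> \<tau>' by (intro mdef_app[of _ \<sigma>'] mdef_app[of _ \<rho>'] mdef_var) simp_all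
      with \<rho> \<sigma> \<tau>' show ?thesis
        by (intro exI[of _ "\<lambda>e. app S (app S (e ! 0) (e ! 2)) (app S (e ! 1) (e ! 2))"])
          (auto intro!: maj_unbounded[OF \<sigma> maj_unbounded[OF \<rho>] app_Dom[of _ \<rho> \<sigma>]
            app_Dom[of _ \<rho>' \<sigma>'] maj_unbounded[OF \<rho>]])
    qed
  qed
qed simp

lemma mdef_num: "mdef \<Gamma> N (\<lambda>e. num S 0)"
  using mdef_const[of Zero N] by simp

lemma realizable_Zero: "realizable E (Ipred (const_type Zero) (Con Zero))"
  by (rule realizable_const[of _ "[]" N]) (auto intro!: exI[of _ "\<lambda>e. num S 0"] mdef_num)

lemma realizable_Succ: "realizable E (Ipred (const_type Succ) (Con Succ))"
proof (rule realizable_const[of _ "[N]" N])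
  have "mdef [N] N (\<lambda>e. app S (const_val S Succ) (e ! 0))"
    by (intro mdef_app[of _ N] mdef_var mdef_const) (simp_all del: const_val.simps)
  then show "\<exists>G. mdef (daggers [N]) \<tau>' G \<and>
      (\<forall>xs as. majs S [N] xs as \<longrightarrow> maj S N (app_list S (const_val S Succ) xs) (G as))"
    if "dagger N = Some \<tau>'" for \<tau>'
    using that by (intro exI[of _ "\<lambda>e. app S (const_val S Succ) (e ! 0)"]) (auto simp del: const_val.simps)
qed simp

text \<open>The Boolean leaves no entry, so the majorant cannot branch; it is the join of bounds for
  both branches.\<close>

lemma realizable_Cond: "realizable E (Ipred (const_type (Cond \<sigma>)) (Con (Cond \<sigma>)))"
proof (rule realizable_const[of _ "[B, \<sigma>, \<sigma>]" \<sigma>])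
  fix \<sigma>' assume \<sigma>': "dagger \<sigma> = Some \<sigma>'"
  have "mdef [\<sigma>', \<sigma>'] \<sigma>' (\<lambda>e. join S \<sigma>' (e ! 0) (e ! 1))"
    using dagger_arith[OF \<sigma>'] by (intro mdef_join mdef_var) simp_all
  moreover have "maj S \<sigma> (if i = bool S False then x else y) (join S \<sigma>' a b)"
    if "a \<in> Dom S \<sigma>'" "b \<in> Dom S \<sigma>'" "maj S \<sigma> x a" "maj S \<sigma> y b" for i x y a b
    using that join_upper[OF dagger_arith[OF \<sigma>'], of a b] maj_refl_right[OF \<sigma>'] maj_smaj[OF \<sigma>']
    by (auto simp: Mon_def)
  ultimately show "\<exists>G. mdef (daggers [B, \<sigma>, \<sigma>]) \<sigma>' G \<and>
      (\<forall>xs as. majs S [B, \<sigma>, \<sigma>] xs as \<longrightarrow> maj S \<sigma> (app_list S (const_val S (Cond \<sigma>)) xs) (G as))"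
    using \<sigma>' by (intro exI[of _ "\<lambda>e. join S \<sigma>' (e ! 0) (e ! 1)"]) (auto simp del: const_val.simps)
qed simp

text \<open>Two comparisons: after \<open>j\<close> steps the iteration with the constant count
  \<open>m\<close> majorizes the recursion, as \<open>m\<close> bounds every true count; and the
  iterates increase from step \<open>n\<close> to step \<open>nat_of S m\<close>.\<close>

lemma majs_rec_values:
  assumes ws: "majs S \<sigma>s ws ws'" and fs: "majs S (map (step_type \<sigma>s) \<sigma>s) fs fs'"
    and m: "m \<in> Dom S N" "n \<le> nat_of S m"
  shows "majs S \<sigma>s (rec_values S n ws fs) (iterates (daggers \<sigma>s) (nat_of S m) m ws' fs')"
proof -
  let ?step = "\<lambda>v. map (\<lambda>f. app_list S f (m # v)) fs'"
  have ws'_mon: "ws' \<in> mon_tuples S (daggers \<sigma>s)"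
    by (rule majs_mon[OF ws])
  have fs'_mon: "fs' \<in> mon_tuples S (map (arrs (N # daggers \<sigma>s)) (daggers \<sigma>s))"
    using majs_mon[OF fs, unfolded daggers_step_type, unfolded step_type_eq] .
  have step_mon: "?step v \<in> mon_tuples S (daggers \<sigma>s)" if "v \<in> mon_tuples S (daggers \<sigma>s)" for v
    using m(1) that by (intro map_app_list_mon[OF fs'_mon]) (simp add: Mon_def)
  have iter_mon: "iterates (daggers \<sigma>s) j m ws' fs' \<in> mon_tuples S (daggers \<sigma>s)" for j
    unfolding iterates_def using arith_daggers ws'_mon step_mon by (rule jrec_mon)
  have "majs S \<sigma>s (rec_values S j ws fs) (iterates (daggers \<sigma>s) j m ws' fs')" if "j \<le> nat_of S m" for j
    using that
  proof (induction j)
    case (Suc j)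
    let ?v = "iterates (daggers \<sigma>s) j m ws' fs'"
    have "majs S (N # \<sigma>s) (num S j # rec_values S j ws fs) (m # ?v)"
      using Suc m(1) by simp
    from majs_map_app_list[OF this, folded step_type_eq, OF fs]
    have "majs S \<sigma>s (rec_values S (Suc j) ws fs) (?step ?v)"
      by simp
    moreover have "iterates (daggers \<sigma>s) (Suc j) m ws' fs' = joins S (daggers \<sigma>s) ?v (?step ?v)"
      by (simp add: iterates_def)
    moreover have "tmaj (daggers \<sigma>s) (?step ?v) (joins S (daggers \<sigma>s) ?v (?step ?v))"
      using joins_upper[OF arith_daggers iter_mon step_mon[OF iter_mon]] by blast
    ultimately show ?case
      using majs_tmaj[OF _ mon_tuples_env[OF iter_mon]] by metis
  qed (simp add: ws iterates_def)
  then have "majs S \<sigma>s (rec_values S n ws fs) (iterates (daggers \<sigma>s) n m ws' fs')"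
    using m(2) .
  moreover have "tmaj (daggers \<sigma>s) (iterates (daggers \<sigma>s) n m ws' fs')
      (iterates (daggers \<sigma>s) (nat_of S m) m ws' fs')"
    unfolding iterates_def using arith_daggers ws'_mon step_mon m(2) by (rule jrec_increasing)
  ultimately show ?thesis
    by (rule majs_tmaj[OF _ mon_tuples_env[OF iter_mon]])
qed

lemma realizable_Rec:
  assumes i: "i < length \<sigma>s"
  shows "realizable E (Ipred (const_type (Rec \<sigma>s i)) (Con (Rec \<sigma>s i)))"
proof (rule realizable_const[of _ "N # \<sigma>s @ map (step_type \<sigma>s) \<sigma>s" "\<sigma>s ! i"])
  fix \<tau> assume \<tau>: "dagger (\<sigma>s ! i) = Some \<tau>"
  define \<sigma>s' where "\<sigma>s' = daggers \<sigma>s"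
  define i' where "i' = length (daggers (take i \<sigma>s))"
  have i': "i' < length \<sigma>s'" "\<sigma>s' ! i' = \<tau>"
    using daggers_nth[OF i \<tau>] by (simp_all add: \<sigma>s'_def i'_def)
  let ?\<Gamma> = "N # \<sigma>s @ map (step_type \<sigma>s) \<sigma>s"
  let ?FT = "map (arrs (N # \<sigma>s')) \<sigma>s'"
  have \<Gamma>: "daggers ?\<Gamma> = N # \<sigma>s' @ ?FT"
    by (simp add: daggers_append daggers_step_type \<sigma>s'_def step_type_def)
  let ?k = "length \<sigma>s'"
  let ?G = "\<lambda>e. iterates \<sigma>s' (nat_of S (e ! 0)) (e ! 0) (take ?k (drop 1 e)) (drop (Suc ?k) e)"
  have "mdefs (N # \<sigma>s' @ ?FT) \<sigma>s' ?G"
    using mdefs_slice[of _ "[N]" \<sigma>s' ?FT] mdefs_drop[of "N # \<sigma>s'" ?FT]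
    by (intro mdefs_iterates mdef_var) (simp_all add: \<sigma>s'_def arith_daggers)
  then have "mdef (daggers ?\<Gamma>) \<tau> (\<lambda>e. ?G e ! i')"
    unfolding \<Gamma> using mdefs_nth i' by blast
  moreover have "maj S (\<sigma>s ! i) (app_list S (const_val S (Rec \<sigma>s i)) xs) (?G as ! i')" if maj: "majs S ?\<Gamma> xs as" for xs as
  proof -
    obtain n m xs' as' where 1: "xs = n # xs'" "as = m # as'" "n \<in> Dom S N" "m \<in> Dom S N"
      "nat_of S n \<le> nat_of S m" "majs S (\<sigma>s @ map (step_type \<sigma>s) \<sigma>s) xs' as'"
      using maj by auto
    obtain ws fs ws' fs' where 2: "xs' = ws @ fs" "as' = ws' @ fs'" "majs S \<sigma>s ws ws'"
      "majs S (map (step_type \<sigma>s) \<sigma>s) fs fs'"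
      using 1(6) by (rule majs_appendE)
    have "length ws' = length \<sigma>s'"
      using majs_env[OF 2(3)] by (simp add: \<sigma>s'_def env_length)
    then have "?G as = iterates \<sigma>s' (nat_of S m) m ws' fs'"
      by (simp add: 1 2)
    moreover have "app_list S (const_val S (Rec \<sigma>s i)) xs = rec_values S (nat_of S n) ws fs ! i"
      unfolding 1(1) 2(1) using i 1(3) majs_env_left[OF 2(3)] majs_env_left[OF 2(4)] by (rule app_Rec)
    ultimately show ?thesis
      using majs_nth[OF majs_rec_values[OF 2(3,4) 1(4,5)] i \<tau>] by (simp add: \<sigma>s'_def i'_def)
  qed
  ultimately show "\<exists>G. mdef (daggers ?\<Gamma>) \<tau> G \<and>
      (\<forall>xs as. majs S ?\<Gamma> xs as \<longrightarrow> maj S (\<sigma>s ! i) (app_list S (const_val S (Rec \<sigma>s i)) xs) (G as))"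
    by blast
qed simp

lemma constants_interpretable:
  assumes "ha_const c"
  shows "U_interpretable S (I_mb S) [] (Ipred (const_type c) (Con c))"
proof (rule U_interpretableI)
  show "realizable (env S []) (Ipred (const_type c) (Con c))"
  proof (cases c)
    case (Rec \<sigma>s i)
    with assms realizable_Rec show ?thesis
      by (simp add: ha_const_def del: const_type.simps)
  next
    case Bool0
    then show ?thesis
      by (auto simp: realizable_def intro!: exI[of _ "\<lambda>e. []"])
  next
    case Bool1
    then show ?thesis
      by (auto simp: realizable_def intro!: exI[of _ "\<lambda>e. []"])
  qed (use assms realizable_CPi realizable_CSigma realizable_Zero realizable_Succ realizable_Cond
      in \<open>auto simp: ha_const_def\<close>)
qed

section \<open>Application and the list of axioms\<close>

lemma realizable_All:
  "realizable {x # e |x e. x \<in> Dom S \<sigma> \<and> e \<in> E} C \<Longrightarrow> realizable E (All \<sigma> C)"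
  unfolding realizable_def by auto

text \<open>The bound for the value is the bound for the function applied to that for the argument.
  If \<sigma> is bounded, the bound for the function already bounds all its values; if \<tau> is
  bounded, no witness is asked for.\<close>

lemma application_interpretable:
  "U_interpretable S (I_mb S) [] (All \<sigma> (All (\<sigma> \<rightarrow> \<tau>)
    (Imp (And (Ipred \<sigma> (Var 1)) (Ipred (\<sigma> \<rightarrow> \<tau>) (Var 0))) (Ipred \<tau> (Var 0 \<bullet> Var 1)))))"
proof (intro U_interpretableI realizable_All)
  let ?C = "And (Ipred \<sigma> (Var 1)) (Ipred (\<sigma> \<rightarrow> \<tau>) (Var 0))"
  let ?E = "{x # e |x e. x \<in> Dom S (\<sigma> \<rightarrow> \<tau>) \<and> e \<in> {x # e |x e. x \<in> Dom S \<sigma> \<and> e \<in> env S []}}"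
  have neg: "neg (I_mb S) ?C = []"
    by simp
  have realizableI: "realizable ?E (Imp ?C (Ipred \<tau> (Var 0 \<bullet> Var 1)))"
    if f: "mdefs (pos (I_mb S) ?C) (pos (I_mb S) (Ipred \<tau> (Var 0 \<bullet> Var 1))) f"
      and maj: "\<And>x g a. x \<in> Dom S \<sigma> \<Longrightarrow> g \<in> Dom S (\<sigma> \<rightarrow> \<tau>) \<Longrightarrow> a \<in> mon_tuples S (pos (I_mb S) ?C) \<Longrightarrow>
        interp S (I_mb S) ?C [g, x] a [] \<Longrightarrow> interp S (I_mb S) (Ipred \<tau> (Var 0 \<bullet> Var 1)) [g, x] (f a) []" for f
  proof (rule realizable_Imp[OF f, of "\<lambda>e. []"])
    show "interp S (I_mb S) (Ipred \<tau> (Var 0 \<bullet> Var 1)) e (f a) d"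
      if "e \<in> ?E" "a \<in> mon_tuples S (pos (I_mb S) ?C)" "d \<in> mon_tuples S (neg (I_mb S) (Ipred \<tau> (Var 0 \<bullet> Var 1)))"
        "\<forall>b\<in>tuples_in S (neg (I_mb S) ?C) []. interp S (I_mb S) ?C e a b" for e a d
    proof -
      obtain g x where e: "e = [g, x]" "x \<in> Dom S \<sigma>" "g \<in> Dom S (\<sigma> \<rightarrow> \<tau>)"
        using \<open>e \<in> ?E\<close> by auto
      moreover have "interp S (I_mb S) ?C [g, x] a []" "d = []"
        using that e(1) unfolding neg by (simp_all add: tuples_in_def del: interp.simps)
      ultimately show ?thesis
        using maj that(2) by blast
    qed
  qed simp
  show "realizable ?E (Imp ?C (Ipred \<tau> (Var 0 \<bullet> Var 1)))"
  proof (cases "dagger \<tau>")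
    case None
    then show ?thesis
      by (intro realizableI[of "\<lambda>e. []"]) simp_all
  next
    case \<tau>: (Some \<tau>')
    show ?thesis
    proof (cases "dagger \<sigma>")
      case \<sigma>: None
      have "mdefs [\<tau>'] [\<tau>'] (\<lambda>e. e)"
        by (rule mdefs_id)
      with \<sigma> \<tau> show ?thesis
        by (intro realizableI[of "\<lambda>e. e"]) auto
    next
      case \<sigma>: (Some \<sigma>')
      have "mdefs [\<sigma>', \<sigma>' \<rightarrow> \<tau>'] [\<tau>'] (\<lambda>e. [app S (e ! 1) (e ! 0)])"
        by (intro mdefs_Cons mdef_app[of _ \<sigma>'] mdef_var) simp_all
      with \<sigma> \<tau> show ?thesis
        by (intro realizableI[of "\<lambda>e. [app S (e ! 1) (e ! 0)]"]) (auto simp: mon_tuples_Cons Mon_def)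
    qed
  qed
qed

text \<open>An equation has no witnesses, so truth under all assignments suffices.\<close>

lemma Eq_interpretable:
  assumes "\<And>e. e \<in> env S \<Gamma> \<Longrightarrow> eval S e s = eval S e t"
  shows "I_interpretable S (I_mb S) \<Gamma> (Eq \<sigma> s t)"
  by (rule I_interpretableI) (simp add: realizable_Eq assms)

lemma map_eval_Var: "length e = k \<Longrightarrow> map (eval S e) (map Var [0..<k]) = e"
  by (rule nth_equalityI) simp_all

lemma map_eval_Var_tl: "length e = Suc k \<Longrightarrow> map (eval S e) (map Var [1..<Suc k]) = tl e"
  by (rule nth_equalityI) (simp_all add: nth_tl del: upt_Suc)

lemma axioms_interpretable:
  assumes "ha_axiom \<Gamma> C"
  shows "I_interpretable S (I_mb S) \<Gamma> C"
  using assms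
proof cases
  case (rec_zero \<sigma>s i k)
  have "eval S e (apps (Con (Rec \<sigma>s i)) (Con Zero # map Var [0..<2 * k])) = eval S e (Var i)"
    if e_env: "e \<in> env S \<Gamma>" for e
  proof -
    obtain ws fs where e: "e = ws @ fs" "ws \<in> env S \<sigma>s" "fs \<in> env S (map (step_type \<sigma>s) \<sigma>s)"
      using e_env unfolding rec_zero(1) by (rule env_appendE)
    then have len: "length ws = k" "length fs = k"
      using rec_zero by (simp_all add: env_length)
    then have "map (eval S e) (map Var [0..<2 * k]) = ws @ fs"
      using e(1) by (simp only: map_eval_Var length_append mult_2)
    then show ?thesis
      using app_Rec[OF rec_zero(4) num_Dom[of 0] e(2,3)] rec_zero(4,5) len
      by (simp add: eval_apps e(1) nth_append del: const_val.simps(5) app_list_simps map_map)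
  qed
  then show ?thesis
    unfolding rec_zero(2) by (rule Eq_interpretable)
next
  case (rec_succ \<sigma>s i k)
  have "eval S e (apps (Con (Rec \<sigma>s i)) ((Con Succ \<bullet> Var 0) # map Var [1..<2 * k + 1])) =
      eval S e (apps (Var (k + 1 + i))
          (Var 0 # map (\<lambda>j. apps (Con (Rec \<sigma>s j)) (map Var [0..<2 * k + 1])) [0..<k]))"
    if e_env: "e \<in> env S \<Gamma>" for e
  proof -
    obtain n ws fs where e: "e = n # ws @ fs" "n \<in> Dom S N" "ws \<in> env S \<sigma>s" "fs \<in> env S (map (step_type \<sigma>s) \<sigma>s)"
      using e_env unfolding rec_succ(1) env_Cons by (blast elim: env_appendE)
    then have len: "length ws = k" "length fs = k"
      using rec_succ by (simp_all add: env_length)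
    have vars: "map (eval S e) (map Var [0..<2 * k + 1]) = n # ws @ fs"
      "map (eval S e) (map Var [1..<2 * k + 1]) = ws @ fs"
      using e(1) len map_eval_Var[of e "2 * k + 1"] map_eval_Var_tl[of e "2 * k"] by simp_all
    let ?r = "rec_values S (nat_of S n) ws fs"
    have "eval S e (apps (Con (Rec \<sigma>s j)) (map Var [0..<2 * k + 1])) = ?r ! j" if "j < k" for j
    proof -
      have "j < length \<sigma>s"
        using that rec_succ(5) by simp
      then show ?thesis
        by (simp only: eval_apps vars eval.simps app_Rec[OF _ e(2-4)])
    qed
    \<comment> \<open>The previous stage of all components at once; the step function of component
      \<open>i\<close> is applied to this whole tuple.\<close>
    then have recs: "map (eval S e) (map (\<lambda>j. apps (Con (Rec \<sigma>s j)) (map Var [0..<2 * k + 1])) [0..<k]) = ?r"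
      using rec_values_env[OF e(3,4), of "nat_of S n"] rec_succ(5)
      by (intro nth_equalityI) (auto simp: env_length)
    have proj: "e ! 0 = n" "e ! (k + 1 + i) = fs ! i"
      using len by (simp_all add: e(1) nth_append)
    have "eval S e (apps (Con (Rec \<sigma>s i)) ((Con Succ \<bullet> Var 0) # map Var [1..<2 * k + 1])) =
        app_list S (const_val S (Rec \<sigma>s i)) (num S (Suc (nat_of S n)) # ws @ fs)"
      by (simp only: eval_apps list.map eval.simps vars(2) proj(1) app_Succ[OF e(2)])
    also have "\<dots> = app_list S (fs ! i) (n # ?r)"
      using app_Rec[OF rec_succ(4) num_Dom e(3,4)] rec_succ(4,5) e(2) len
      by (simp del: const_val.simps app_list_simps)
    also have "\<dots> = eval S e (apps (Var (k + 1 + i))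
        (Var 0 # map (\<lambda>j. apps (Con (Rec \<sigma>s j)) (map Var [0..<2 * k + 1])) [0..<k]))"
      by (simp only: eval_apps list.map eval.simps recs proj)
    finally show ?thesis .
  qed
  then show ?thesis
    unfolding rec_succ(2) by (rule Eq_interpretable)
next
  case succ_inj
  have "nat_of S (app S (const_val S Succ) x) = Suc (nat_of S x)" if "x \<in> Dom S N" for x
    using that by (simp del: const_val.simps)
  then have "x = y" if "x \<in> Dom S N" "y \<in> Dom S N" "app S (const_val S Succ) x = app S (const_val S Succ) y" for x y
    using that by (metis num_nat_of nat.inject)
  then show ?thesis
    unfolding succ_inj
    by (intro I_interpretableI) (auto simp: env_Cons simp del: const_val.simps intro!: realizable_Imp_hyp realizable_Eq)
next
  case succ_zero
  have "app S (const_val S Succ) x \<noteq> const_val S Zero" if "x \<in> Dom S N" for x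
    using that by (simp del: const_val.simps(4))
  then show ?thesis
    unfolding succ_zero
    by (intro I_interpretableI)
      (auto simp: env_Cons simp del: const_val.simps intro!: realizable_Imp_hyp realizable_Bot)
next
  case bool_distinct
  then show ?thesis
    by (intro I_interpretableI) (auto intro!: realizable_Imp_hyp realizable_Bot)
next
  case (eq_subst \<sigma> \<Gamma>' D)
  then show ?thesis
    using eq_subst_interpretable by simp
next
  case (bool_ind D)
  then show ?thesis
    using bool_ind_interpretable by simp
next
  case (nat_ind D)
  then show ?thesis
    using nat_ind_interpretable by simp
qed (auto intro!: Eq_interpretable simp: env_Cons simp del: const_val.simps(1,2,8))

end

lemma base_interpretation_I_mb: "base_interpretation (I_mb S)"
  by (auto simp: base_interpretation_def dagger_arith split: option.split)

theorem theorem8p14: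
  fixes S :: "'u type_structure"
  assumes "full_star_structure S"
  shows "sound_type_informative_base_interpretation S (I_mb S)"
proof -
  interpret star_structure S
    by standard (rule assms)
  show ?thesis
    unfolding sound_type_informative_base_interpretation_def
    using base_interpretation_I_mb constants_interpretable application_interpretable axioms_interpretable
    by blast
qed

end
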